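(* Let $\mathbb{F}\in\{\mathbb{R},\mathbb{C}\}$ and let $\mathcal{X}$ be a Banach space over $\mathbb{F}$ with $\dim\mathcal{X}\ge 3$. Let $\phi:\mathcal{B}(\mathcal{X})\to\mathcal{B}(\mathcal{X})$ be a surjective map (no linearity or continuity assumed) satisfying $$\alpha(ABA)=\alpha(\phi(A)\phi(B)\phi(A))\quad\text{for every } A,B\in\mathcal{B}(\mathcal{X}),$$ or $$\delta(ABA)=\delta(\phi(A)\phi(B)\phi(A))\quad\text{for every } A,B\in\mathcal{B}(\mathcal{X}).$$ (I) If $\mathcal{X}$ is infinite-dimensional, then either there exist an invertible bounded linear or conjugate-linear operator $A:\mathcal{X}\to\mathcal{X}$ and a map $\lambda:\mathcal{B}(\mathcal{X})\to\mathbb{F}^*$ such that $$\phi(T)=\lambda(T)\,ATA^{-1},\qquad T\in\mathcal{B}(\mathcal{X}),$$ or $\mathcal{X}$ is reflexive and there exist an invertible bounded linear or conjugate-linear operator $A:\mathcal{X}^*\to\mathcal{X}$ and a map $\lambda:\mathcal{B}(\mathcal{X})\to\mathbb{F}^*$ such that $$\phi(T)=\lambda(T)\,AT'A^{-1},\qquad T\in\mathcal{B}(\mathcal{X}).$$ (II) If $\mathcal{X}$ has finite dimension $n\ge 3$, identify operators on $\mathcal{X}$ with $n\times n$ matrices in $M_n(\mathbb{F})$. Then there exist a nonsingular matrix $A\in M_n(\mathbb{F})$, a field automorphism $\tau$ of $\mathbb{F}$ and a map $\lambda:M_n(\mathbb{F})\to\mathbb{F}^*$ such that either $$\phi(T)=\lambda(T)\,A[\tau(t_{ij})]A^{-1}\quad\text{for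 all } T=[t_{ij}]\in M_n(\mathbb{F}),$$ or $$\phi(T)=\lambda(T)\,A[\tau(t_{ij})]^{\mathrm{tr}}A^{-1}\quad\text{for all } T=[t_{ij}]\in M_n(\mathbb{F}),$$ where ${}^{\mathrm{tr}}$ denotes transposition.
   Context: $\mathcal{B}(\mathcal{X})$ is the algebra of all bounded linear operators on $\mathcal{X}$; $\mathbb{F}^*=\mathbb{F}\setminus\{0\}$; $\mathcal{X}^*$ is the dual space of bounded functionals and $T'$ is the adjoint operator of $T$ acting on $\mathcal{X}^*$. For $T\in\mathcal{B}(\mathcal{X})$ the ascent and the descent are $$\alpha(T)=\inf\{n\in\mathbb{N}\cup\{0\}:\ker(T^n)=\ker(T^{n+1})\},\qquad \delta(T)=\inf\{n\in\mathbb{N}\cup\{0\}:\mathrm{range}(T^n)=\mathrm{range}(T^{n+1})\},$$ with $T^0=I$, and with value $\infty$ if no such $n$ exists. *)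

theory Defs
  imports
    "HOL-Analysis.Analysis"
    "HOL-Library.Extended_Nat"
    "Jordan_Normal_Form.Matrix"
begin

section \<open>The scalar field\<close>

text \<open>
  The scalar field is \<open>\<real>\<close> or \<open>\<complex>\<close>. To treat both at once, we use a class whose members are,
  up to isometric isomorphism, exactly these two fields: an isometric field embedding
  into the complex numbers is given, with image \<open>\<real>\<close> or everything.
  The class also carries complex conjugation, which is the identity in the real case.
\<close>

class real_or_complex = real_normed_field +
  fixes to_complex :: "'a \<Rightarrow> complex"
    and scalar_conj :: "'a \<Rightarrow> 'a"
  assumes to_complex_add: "to_complex (x + y) = to_complex x + to_complex y"
    and to_complex_mult: "to_complex (x * y) = to_complex x * to_complex y"
    and to_complex_scaleR: "to_complex (scaleR r x) = r *\<^sub>R to_complex x"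
    and cmod_to_complex: "cmod (to_complex x) = norm x"
    and to_complex_scalar_conj: "to_complex (scalar_conj x) = cnj (to_complex x)"
    and range_to_complex: "range to_complex = \<real> \<or> range to_complex = UNIV"

instantiation real :: real_or_complex
begin

definition "to_complex (x :: real) = complex_of_real x"
definition "scalar_conj (x :: real) = x"

instance
  by standard (auto simp: to_complex_real_def scalar_conj_real_def Reals_def scaleR_conv_of_real)

end

instantiation complex :: real_or_complex
begin

definition "to_complex (z :: complex) = z"
definition "scalar_conj (z :: complex) = cnj z"

instance
  by standard (auto simp: to_complex_complex_def scalar_conj_complex_def)

end


section \<open>Banach spaces over the scalar field\<close>

text \<open>
  A Banach space over the scalar field \<open>'f\<close> is a real Banach space with a compatible
  scalar multiplication by \<open>'f\<close>. For \<open>'f = real\<close>, it is forced to be \<^const>\<open>scaleR\<close>.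
\<close>

locale banach_space_over = vector_space scl
  for scl :: "'f::real_or_complex \<Rightarrow> 'x::banach \<Rightarrow> 'x" +
  assumes norm_scl: "norm (scl c x) = norm c * norm x"
    and scl_of_real: "scl (of_real r) x = r *\<^sub>R x"

lemma banach_space_over_real: "banach_space_over (scaleR :: real \<Rightarrow> 'x::banach \<Rightarrow> 'x)"
  by unfold_locales (auto simp: algebra_simps)

lemma banach_space_over_complex: "banach_space_over ((*) :: complex \<Rightarrow> complex \<Rightarrow> complex)"
  by unfold_locales (auto simp: algebra_simps norm_mult scaleR_conv_of_real)

definition finite_dimensional :: "('f::real_or_complex \<Rightarrow> 'x::banach \<Rightarrow> 'x) \<Rightarrow> bool" where
  "finite_dimensional scl \<longleftrightarrow> (\<exists>S. finite S \<and> Modules.module.span scl S = UNIV)"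

definition ordered_basis :: "('f::real_or_complex \<Rightarrow> 'x::banach \<Rightarrow> 'x) \<Rightarrow> 'x list \<Rightarrow> bool" where
  "ordered_basis scl bs \<longleftrightarrow> distinct bs \<and> \<not> Modules.module.dependent scl (set bs)
     \<and> Modules.module.span scl (set bs) = UNIV"

text \<open>
  The type \<open>'x \<Rightarrow>\<^sub>L 'x\<close> consists of the bounded real-linear maps, so the algebra of bounded
  operators is in general a proper subset of it.
\<close>

definition bounded_ops ::
    "('f::real_or_complex \<Rightarrow> 'x::banach \<Rightarrow> 'x) \<Rightarrow> ('x \<Rightarrow>\<^sub>L 'x) set" where
  "bounded_ops scl = {T. Vector_Spaces.linear scl scl (blinfun_apply T)}"

definition conj_bounded_ops ::
    "('f::real_or_complex \<Rightarrow> 'x::banach \<Rightarrow> 'x) \<Rightarrow> ('x \<Rightarrow>\<^sub>L 'x) set" where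
  "conj_bounded_ops scl =
     {T. Vector_Spaces.linear scl (\<lambda>c. scl (scalar_conj c)) (blinfun_apply T)}"

definition ascent :: "('x::banach \<Rightarrow>\<^sub>L 'x) \<Rightarrow> enat" where
  "ascent T = Inf {enat n | n.
     {x. (blinfun_apply T ^^ n) x = 0} = {x. (blinfun_apply T ^^ (n + 1)) x = 0}}"

definition descent :: "('x::banach \<Rightarrow>\<^sub>L 'x) \<Rightarrow> enat" where
  "descent T = Inf {enat n | n.
     range (blinfun_apply T ^^ n) = range (blinfun_apply T ^^ (n + 1))}"


section \<open>Dual space, adjoint, reflexivity\<close>

definition dual :: "('f::real_or_complex \<Rightarrow> 'x::banach \<Rightarrow> 'x) \<Rightarrow> ('x \<Rightarrow>\<^sub>L 'f) set" where
  "dual scl = {f. Vector_Spaces.linear scl (*) (blinfun_apply f)}"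

definition dual_scl :: "'f::real_or_complex \<Rightarrow> ('x::banach \<Rightarrow>\<^sub>L 'f) \<Rightarrow> ('x \<Rightarrow>\<^sub>L 'f)" where
  "dual_scl c f = blinfun_mult_right c o\<^sub>L f"

definition adjoint_op :: "('x::banach \<Rightarrow>\<^sub>L 'x) \<Rightarrow> ('x \<Rightarrow>\<^sub>L 'f::real_or_complex) \<Rightarrow> ('x \<Rightarrow>\<^sub>L 'f)" where
  "adjoint_op T f = f o\<^sub>L T"

text \<open>Linearity and boundedness of maps that are only relevant on a linear subspace \<open>V\<close>.\<close>

definition linear_map_on ::
    "'v::real_normed_vector set \<Rightarrow> ('f \<Rightarrow> 'v \<Rightarrow> 'v) \<Rightarrow> ('f \<Rightarrow> 'w \<Rightarrow> 'w)
      \<Rightarrow> ('v \<Rightarrow> 'w::real_normed_vector) \<Rightarrow> bool" where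
  "linear_map_on V sV sW A \<longleftrightarrow>
     (\<forall>f\<in>V. \<forall>g\<in>V. A (f + g) = A f + A g) \<and> (\<forall>c. \<forall>f\<in>V. A (sV c f) = sW c (A f))"

definition bounded_map_on ::
    "'v::real_normed_vector set \<Rightarrow> ('v \<Rightarrow> 'w::real_normed_vector) \<Rightarrow> bool" where
  "bounded_map_on V A \<longleftrightarrow> (\<exists>K. \<forall>f\<in>V. norm (A f) \<le> K * norm f)"

definition reflexive_space :: "('f::real_or_complex \<Rightarrow> 'x::banach \<Rightarrow> 'x) \<Rightarrow> bool" where
  "reflexive_space scl \<longleftrightarrow>
     (\<forall>\<Phi> :: ('x \<Rightarrow>\<^sub>L 'f) \<Rightarrow> 'f.
        linear_map_on (dual scl) dual_scl (*) \<Phi> \<and> bounded_map_on (dual scl) \<Phi>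
        \<longrightarrow> (\<exists>x. \<forall>f\<in>dual scl. \<Phi> f = blinfun_apply f x))"

text \<open>\<open>A\<close> is an invertible bounded linear or conjugate-linear operator, with inverse \<open>B\<close>.\<close>

definition inverse_ops ::
    "('f::real_or_complex \<Rightarrow> 'x::banach \<Rightarrow> 'x) \<Rightarrow> ('x \<Rightarrow>\<^sub>L 'x) \<Rightarrow> ('x \<Rightarrow>\<^sub>L 'x) \<Rightarrow> bool" where
  "inverse_ops scl A B \<longleftrightarrow> A \<in> bounded_ops scl \<union> conj_bounded_ops scl
     \<and> A o\<^sub>L B = id_blinfun \<and> B o\<^sub>L A = id_blinfun"

definition inverse_ops_from_dual ::
    "('f::real_or_complex \<Rightarrow> 'x::banach \<Rightarrow> 'x)
      \<Rightarrow> (('x \<Rightarrow>\<^sub>L 'f) \<Rightarrow> 'x) \<Rightarrow> ('x \<Rightarrow> ('x \<Rightarrow>\<^sub>L 'f)) \<Rightarrow> bool" where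
  "inverse_ops_from_dual scl A B \<longleftrightarrow>
     (linear_map_on (dual scl) dual_scl scl A
       \<or> linear_map_on (dual scl) dual_scl (\<lambda>c. scl (scalar_conj c)) A)
     \<and> bounded_map_on (dual scl) A \<and> bounded_map_on UNIV B
     \<and> (\<forall>x. B x \<in> dual scl \<and> A (B x) = x) \<and> (\<forall>f\<in>dual scl. B (A f) = f)"


section \<open>Matrices\<close>

text \<open>Column \<open>j\<close> of the matrix of \<open>T\<close> holds the coordinates of \<open>T (bs ! j)\<close>.\<close>

definition matrix_of_op ::
    "('f::real_or_complex \<Rightarrow> 'x::banach \<Rightarrow> 'x) \<Rightarrow> 'x list \<Rightarrow> ('x \<Rightarrow>\<^sub>L 'x) \<Rightarrow> 'f mat" where
  "matrix_of_op scl bs T = Matrix.mat (length bs) (length bs)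
     (\<lambda>(i, j). Modules.module.representation scl (set bs) (blinfun_apply T (bs ! j)) (bs ! i))"

definition field_automorphism :: "('f::field \<Rightarrow> 'f) \<Rightarrow> bool" where
  "field_automorphism \<tau> \<longleftrightarrow> bij \<tau> \<and> \<tau> 1 = 1
     \<and> (\<forall>x y. \<tau> (x + y) = \<tau> x + \<tau> y) \<and> (\<forall>x y. \<tau> (x * y) = \<tau> x * \<tau> y)"

end

(*
On operators of finite rank the ascent and the descent obey the same algebraic rules, for instance
X^2 = 0 and X \<noteq> 0 give index 2, and these rules are all that is used of the index. They characterise
operators of rank at most one and, among those, the nilpotent ones y \<otimes> g with g(y) = 0, by the
indices of the sandwiches ABA and CAC; so \<phi> permutes the nilpotent rank one operators up to scalars.
For such N = y \<otimes> g, the index of NBN is 2 exactly if g(By) \<noteq> 0, which makes the adjacency relation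
"same y or same g" visible. Hence \<phi> induces either a collineation of points y, or a map from points
to hyperplanes, and the fundamental theorem of projective geometry provides a semilinear map S. After
composing with S, the operator \<phi>(A) is compared with A through rank two operators of the form
1 \<oplus> J \<oplus> 0 with a nilpotent 2 x 2 block J, and turns out to be a multiple of A. In infinite dimension
a gliding hump shows that the field automorphism of S is the identity or the conjugation, and the
uniform boundedness principle gives continuity.
*)

theory Submission
  imports Defs "HOL-Library.Function_Algebras" "Jordan_Normal_Form.Determinant"
begin

section \<open>Collineations and semilinear maps\<close>

text \<open>The map is known only through indices of sandwiches. It offers neither additivity nor
  control of scalars, so every structure has to be encoded as a statement "some index is 2" or "no
  index exceeds 2" that survives a surjection. Index 3 separates rank one from higher rank: a
  sandwich with a rank one factor has rank at most one, hence index at most 2, while index 3 needs a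
  chain of three independent vectors and so dimension 3. The alternative between points and
  hyperplanes raises a second obstacle. Transposition exchanges kernels and ranges, so in infinite
  dimension neither ascent nor descent is invariant under it. Polynomial identities such as Z^2 = cZ
  are invariant, and the comparison of \<phi>(A) with A therefore relies on such identities alone on
  the image side. The rank two probes are forced as well: an operator y \<otimes> g with g(y) = 0
  tests only whether g(Ty) = 0 and cannot distinguish T from T + bI. A suitable probe sandwich has
  index 3 for T, and an added nonzero multiple of I lowers this to at most 2.\<close>

context vector_space
begin

section \<open>Coordinates on the spans of one, two and three vectors\<close>

lemma span_pair: "x \<in> span {a, b} \<longleftrightarrow> (\<exists>p q. x = scale p a + scale q b)"
proof -
  have "x \<in> span {a, b} \<longleftrightarrow> (\<exists>p q. x - scale p a = scale q b)"
    by (auto simp: span_insert span_singleton)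
  then show ?thesis
    by (simp add: algebra_simps)
qed

lemma span_one: "x \<in> span {a} \<longleftrightarrow> (\<exists>p. x = scale p a)"
  by (auto simp: span_singleton)

lemma scale_in_span_one: "x \<in> span {y} \<Longrightarrow> x \<noteq> 0 \<Longrightarrow> \<exists>c. c \<noteq> 0 \<and> x = scale c y"
  by (auto simp: span_one)

lemma span_one_sym: "x \<in> span {y} \<Longrightarrow> x \<noteq> 0 \<Longrightarrow> y \<in> span {x}"
proof -
  assume "x \<in> span {y}" "x \<noteq> 0"
  then obtain c where "c \<noteq> 0" "x = scale c y" using scale_in_span_one by blast
  then have "y = scale (inverse c) x" by simp
  then show ?thesis using span_one by blast
qed

lemma add_notin_span: "x \<in> span A \<Longrightarrow> y \<notin> span A \<Longrightarrow> x + y \<notin> span A"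
    "x \<in> span A \<Longrightarrow> y \<notin> span A \<Longrightarrow> y + x \<notin> span A"
  by (simp_all add: span_add_eq span_add_eq2)

lemma add_nonzero:
  assumes "b \<notin> span {a}" shows "a + b \<noteq> 0"
proof
  assume "a + b = 0"
  then have "b = scale (- 1) a" by (simp add: eq_neg_iff_add_eq_0 add.commute)
  then show False using assms span_one by blast
qed

lemma coeffs_unique2:
  assumes "a \<noteq> 0" "b \<notin> span {a}" "scale p a + scale q b = scale p' a + scale q' b"
  shows "p = p' \<and> q = q'"
proof -
  have eq: "scale (q - q') b = scale (p' - p) a"
    using assms(3) by (simp add: algebra_simps)
  have "q = q'"
  proof (rule ccontr)
    assume "q \<noteq> q'"
    then have "b = scale (inverse (q - q')) (scale (q - q') b)" by simp
    also have "\<dots> = scale (inverse (q - q') * (p' - p)) a" by (simp add: eq)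
    finally show False using assms(2) span_one by blast
  qed
  with eq assms(1) show ?thesis by auto
qed

lemma coeffs_unique3:
  assumes "a \<noteq> 0" "b \<notin> span {a}" "c \<notin> span {a, b}"
    "scale p a + scale q b + scale r c = scale p' a + scale q' b + scale r' c"
  shows "p = p' \<and> q = q' \<and> r = r'"
proof -
  have eq: "scale (r - r') c = scale (p' - p) a + scale (q' - q) b"
    using assms(4) by (simp add: algebra_simps)
  have "r = r'"
  proof (rule ccontr)
    assume "r \<noteq> r'"
    then have "c = scale (inverse (r - r')) (scale (r - r') c)" by simp
    also have "\<dots> = scale (inverse (r - r') * (p' - p)) a + scale (inverse (r - r') * (q' - q)) b"
      by (simp add: eq scale_right_distrib)
    finally show False using assms(3) span_pair by blast
  qed
  with coeffs_unique2[OF assms(1,2)] assms(4) show ?thesis by simp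
qed

lemma span_pair_exchange:
  assumes "x \<in> span {a, b}" "x \<notin> span {a}" shows "b \<in> span {a, x}"
  using assms in_span_insert[of x b "{a}"] by (simp add: insert_commute)

lemma span_pair_mono: "x \<in> span {a} \<Longrightarrow> x \<in> span {a, b}" "x \<in> span {b} \<Longrightarrow> x \<in> span {a, b}"
  using span_mono[of "{a}" "{a, b}"] span_mono[of "{b}" "{a, b}"] by auto

end

text \<open>\<open>\<sigma>\<close> picks a representative vector for the image of each projective
  point, so all conditions are invariant under rescaling its values. Surjectivity is demanded only
  on lines through two image points: in the hyperplane case the target is the space of all
  functions, of which only functionals in \<open>D\<close> are reached.\<close>

locale collineation = vector_space_pair s1 s2
  for s1 :: "'f::field \<Rightarrow> 'b::ab_group_add \<Rightarrow> 'b" and s2 :: "'f \<Rightarrow> 'c::ab_group_add \<Rightarrow> 'c" +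
  fixes \<sigma> :: "'b \<Rightarrow> 'c"
  assumes nonzero: "x \<noteq> 0 \<Longrightarrow> \<sigma> x \<noteq> 0"
    and collinear: "x \<noteq> 0 \<Longrightarrow> y \<noteq> 0 \<Longrightarrow> z \<noteq> 0 \<Longrightarrow>
      z \<in> vs1.span {x, y} \<longleftrightarrow> \<sigma> z \<in> vs2.span {\<sigma> x, \<sigma> y}"
    and onto_line: "x \<noteq> 0 \<Longrightarrow> y \<noteq> 0 \<Longrightarrow> w \<noteq> 0 \<Longrightarrow> w \<in> vs2.span {\<sigma> x, \<sigma> y} \<Longrightarrow>
      \<exists>z. z \<noteq> 0 \<and> w \<in> vs2.span {\<sigma> z}"
    and dim_ge_3: "\<exists>z. z \<notin> vs1.span {x, y}"
begin

section \<open>Normalising the representatives of a collineation\<close>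

lemma proportional: "x \<noteq> 0 \<Longrightarrow> y \<noteq> 0 \<Longrightarrow> y \<in> vs1.span {x} \<longleftrightarrow> \<sigma> y \<in> vs2.span {\<sigma> x}"
  using collinear[of x x y] by simp

lemma notin_span_nonzero: "y \<notin> vs1.span A \<Longrightarrow> y \<noteq> 0"
  using vs1.span_zero by blast

lemma exists_nonzero: "\<exists>x::'b. x \<noteq> 0"
  using dim_ge_3[of 0 0] vs1.span_zero by metis

text \<open>\<open>T y\<close> is the representative of the point \<open>\<sigma> y\<close> for
  which \<open>\<sigma> e + T y\<close> represents the image of \<open>e + y\<close>; fixing
  \<open>\<sigma> e\<close> thus fixes all scales at once. Additivity comes from the point of
  \<open>e + y + z\<close>, which lies on the line through \<open>e + y\<close> and \<open>z\<close>
  and on the line through \<open>e + z\<close> and \<open>y\<close>.\<close>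

lemma exists_additive_on_complement:
  assumes e: "e \<noteq> 0"
  shows "\<exists>T. (\<forall>y. y \<notin> vs1.span {e} \<longrightarrow>
      (\<exists>r k. r \<noteq> 0 \<and> k \<noteq> 0 \<and> T y = s2 r (\<sigma> y) \<and> \<sigma> (e + y) = s2 k (\<sigma> e + T y)))
    \<and> (\<forall>y z. y \<notin> vs1.span {e} \<longrightarrow> z \<notin> vs1.span {e, y} \<longrightarrow> T (y + z) = T y + T z)"
proof -
  have "\<exists>t. y \<notin> vs1.span {e} \<longrightarrow>
      (\<exists>r k. r \<noteq> 0 \<and> k \<noteq> 0 \<and> t = s2 r (\<sigma> y) \<and> \<sigma> (e + y) = s2 k (\<sigma> e + t))" for y
  proof (cases "y \<in> vs1.span {e}")
    case False
    have y: "y \<noteq> 0" using False notin_span_nonzero by blast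
    have ey: "e + y \<notin> vs1.span {e}"
      using False by (simp add: vs1.span_add_eq vs1.span_base)
    have ey0: "e + y \<noteq> 0" using ey notin_span_nonzero by blast
    have "e \<notin> vs1.span {y}" using False e vs1.span_one_sym by blast
    then have ey': "e + y \<notin> vs1.span {y}"
      by (simp add: vs1.span_add_eq2 vs1.span_base)
    have "e + y \<in> vs1.span {e, y}"
      by (simp add: vs1.span_add vs1.span_base)
    then obtain p q where pq: "\<sigma> (e + y) = s2 p (\<sigma> e) + s2 q (\<sigma> y)"
      using collinear[OF e y ey0] vs2.span_pair by auto
    have "p \<noteq> 0" using pq ey' proportional[OF y ey0] vs2.span_one by auto
    moreover have "q \<noteq> 0" using pq ey proportional[OF e ey0] vs2.span_one by auto
    moreover have "\<sigma> (e + y) = s2 p (\<sigma> e + s2 (q / p) (\<sigma> y))"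
      using pq \<open>p \<noteq> 0\<close> by (simp add: vs2.scale_right_distrib)
    ultimately show ?thesis by (intro exI[of _ "s2 (q / p) (\<sigma> y)"] impI exI[of _ "q / p"] exI[of _ p]) auto
  qed auto
  then obtain T where T: "\<And>y. y \<notin> vs1.span {e} \<Longrightarrow>
      (\<exists>r k. r \<noteq> 0 \<and> k \<noteq> 0 \<and> T y = s2 r (\<sigma> y) \<and> \<sigma> (e + y) = s2 k (\<sigma> e + T y))" by metis
  have T_add: "T (y + z) = T y + T z" if y: "y \<notin> vs1.span {e}" and z: "z \<notin> vs1.span {e, y}" for y z
  proof -
    have z': "z \<notin> vs1.span {e}" using z vs1.span_pair_mono by blast
    have yz: "y + z \<notin> vs1.span {e}"
    proof
      assume "y + z \<in> vs1.span {e}"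
      then have "(y + z) - y \<in> vs1.span {e, y}"
        using vs1.span_diff vs1.span_pair_mono vs1.span_base by (metis insertI1)
      with z show False by simp
    qed
    have nz: "y \<noteq> 0" "z \<noteq> 0" "y + z \<noteq> 0" "\<sigma> e \<noteq> 0"
      using y z yz notin_span_nonzero nonzero e by blast+
    obtain ry ky where ry: "ry \<noteq> 0" "ky \<noteq> 0" "T y = s2 ry (\<sigma> y)" "\<sigma> (e + y) = s2 ky (\<sigma> e + T y)"
      using T[OF y] by blast
    obtain rz kz where rz: "rz \<noteq> 0" "kz \<noteq> 0" "T z = s2 rz (\<sigma> z)" "\<sigma> (e + z) = s2 kz (\<sigma> e + T z)"
      using T[OF z'] by blast
    obtain r k where r: "r \<noteq> 0" "k \<noteq> 0" "T (y + z) = s2 r (\<sigma> (y + z))"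
        "\<sigma> (e + (y + z)) = s2 k (\<sigma> e + T (y + z))"
      using T[OF yz] by blast
    have sy: "\<sigma> y = s2 (inverse ry) (T y)" and sz: "\<sigma> z = s2 (inverse rz) (T z)"
      using ry rz by simp_all
    have ind1: "T y \<notin> vs2.span {\<sigma> e}"
    proof
      assume "T y \<in> vs2.span {\<sigma> e}"
      then have "\<sigma> y \<in> vs2.span {\<sigma> e}" unfolding sy by (rule vs2.span_scale)
      then show False using y proportional[OF e nz(1)] by simp
    qed
    have ind2: "T z \<notin> vs2.span {\<sigma> e, T y}"
    proof
      assume "T z \<in> vs2.span {\<sigma> e, T y}"
      then have "\<sigma> z \<in> vs2.span {\<sigma> e, T y}" unfolding sz by (rule vs2.span_scale)
      then obtain p q where "\<sigma> z = s2 p (\<sigma> e) + s2 q (T y)" using vs2.span_pair by auto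
      then have "\<sigma> z = s2 p (\<sigma> e) + s2 (q * ry) (\<sigma> y)" by (simp add: ry)
      then have "\<sigma> z \<in> vs2.span {\<sigma> e, \<sigma> y}" using vs2.span_pair by blast
      then show False using z collinear[OF e nz(1,2)] by simp
    qed
    have ne: "e + y \<noteq> 0" "e + z \<noteq> 0" "e + (y + z) \<noteq> 0"
      using y z' yz vs1.add_nonzero by blast+
    \<comment> \<open>One of two expansions over \<open>\<sigma> e, T y, T z\<close>: this line
      makes the coefficients of \<open>\<sigma> e\<close> and \<open>T y\<close> agree, the other
      one those of \<open>\<sigma> e\<close> and \<open>T z\<close>.\<close>
    have "e + (y + z) = s1 1 (e + y) + s1 1 z" by (simp add: add.assoc)
    then have "e + (y + z) \<in> vs1.span {e + y, z}" using vs1.span_pair by blast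
    then obtain a b where "\<sigma> (e + (y + z)) = s2 a (\<sigma> (e + y)) + s2 b (\<sigma> z)"
      using collinear[OF ne(1) nz(2) ne(3)] vs2.span_pair by auto
    then have A: "\<sigma> (e + (y + z)) = s2 (a * ky) (\<sigma> e) + s2 (a * ky) (T y) + s2 (b * inverse rz) (T z)"
      by (simp add: ry(4) sz vs2.scale_right_distrib)
    have "e + (y + z) = s1 1 (e + z) + s1 1 y" by (simp add: algebra_simps)
    then have "e + (y + z) \<in> vs1.span {e + z, y}" using vs1.span_pair by blast
    then obtain c d where "\<sigma> (e + (y + z)) = s2 c (\<sigma> (e + z)) + s2 d (\<sigma> y)"
      using collinear[OF ne(2) nz(1) ne(3)] vs2.span_pair by auto
    then have C: "\<sigma> (e + (y + z)) = s2 (c * kz) (\<sigma> e) + s2 (d * inverse ry) (T y) + s2 (c * kz) (T z)"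
      by (simp add: rz(4) sy vs2.scale_right_distrib add_ac)
    have "b * inverse rz = a * ky"
      using vs2.coeffs_unique3[OF nz(4) ind1 ind2 trans[OF A[symmetric] C]] by simp
    with A have A': "\<sigma> (e + (y + z)) = s2 (a * ky) (\<sigma> e) + s2 (a * ky) (T y) + s2 (a * ky) (T z)"
      by simp
    \<comment> \<open>The line through \<open>y\<close> and \<open>z\<close> carries no
      \<open>\<sigma> e\<close> component, so comparison with the expansion \<open>A'\<close> forces
      both coefficients of \<open>T (y + z)\<close> to be 1.\<close>
    have "y + z = s1 1 y + s1 1 z" by simp
    then have "y + z \<in> vs1.span {y, z}" using vs1.span_pair by blast
    then obtain m n where "\<sigma> (y + z) = s2 m (\<sigma> y) + s2 n (\<sigma> z)"
      using collinear[OF nz(1,2,3)] vs2.span_pair by auto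
    then have T1: "T (y + z) = s2 (r * m * inverse ry) (T y) + s2 (r * n * inverse rz) (T z)"
      by (simp add: r(3) sy sz vs2.scale_right_distrib mult.assoc)
    have "\<sigma> (e + (y + z)) = s2 k (\<sigma> e) + s2 (k * (r * m * inverse ry)) (T y) + s2 (k * (r * n * inverse rz)) (T z)"
      unfolding r(4) T1 by (simp add: vs2.scale_right_distrib add.assoc)
    from vs2.coeffs_unique3[OF nz(4) ind1 ind2 trans[OF A'[symmetric] this]]
    have "r * m * inverse ry = 1" "r * n * inverse rz = 1" using r(2) by auto
    with T1 show ?thesis by simp
  qed
  show ?thesis
    by (rule exI[of _ T], intro conjI allI impI) (fact T, fact T_add)
qed

text \<open>On the missing line \<open>span {e}\<close> additivity leaves no choice:
  \<open>S d\<close> has to be \<open>T (d + w) - T w\<close> for any \<open>w\<close> off the line.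
  The work is to see that this does not depend on \<open>w\<close> and still lies over
  \<open>\<sigma> d\<close>; both use a third direction, which dimension 3 provides.\<close>

lemma exists_additive:
  "\<exists>S. (\<forall>x y. S (x + y) = S x + S y) \<and> (\<forall>x. x \<noteq> 0 \<longrightarrow> S x \<noteq> 0 \<and> S x \<in> vs2.span {\<sigma> x})"
proof -
  obtain e :: 'b where e: "e \<noteq> 0" using exists_nonzero by blast
  obtain T where T: "\<And>y. y \<notin> vs1.span {e} \<Longrightarrow>
      \<exists>r k. r \<noteq> 0 \<and> k \<noteq> 0 \<and> T y = s2 r (\<sigma> y) \<and> \<sigma> (e + y) = s2 k (\<sigma> e + T y)"
    and T_add: "\<And>y z. y \<notin> vs1.span {e} \<Longrightarrow> z \<notin> vs1.span {e, y} \<Longrightarrow> T (y + z) = T y + T z"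
    using exists_additive_on_complement[OF e] by metis
  let ?E = "vs1.span {e}"
  have third: "\<exists>w. w \<notin> ?E \<and> w \<notin> vs1.span {e, u}" for u
    using dim_ge_3[of e u] vs1.span_pair_mono by blast
  have shift: "u + d \<notin> ?E" "u + d \<notin> vs1.span {e, w} \<longleftrightarrow> u \<notin> vs1.span {e, w}"
      "u \<notin> vs1.span {e, w + d} \<longleftrightarrow> u \<notin> vs1.span {e, w}"
    if "d \<in> ?E" "u \<notin> ?E" for u d w
  proof -
    show "u + d \<notin> ?E" using that vs1.add_notin_span by blast
    have d: "d \<in> vs1.span {e, w}" for w using that vs1.span_pair_mono by blast
    then show "u + d \<notin> vs1.span {e, w} \<longleftrightarrow> u \<notin> vs1.span {e, w}"
      by (simp add: vs1.span_add_eq2)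
    have "w + d \<in> vs1.span {e, w}" "w \<in> vs1.span {e, w + d}"
      using d[of w] d[of "w + d"] vs1.span_add vs1.span_base vs1.span_diff
       apply (metis insert_subset order_refl vs1.span_superset)
      by (metis \<open>d \<in> vs1.span {e, w + d}\<close> add_diff_cancel_right' insertCI vs1.span_base vs1.span_diff)
    then have "vs1.span {e, w + d} = vs1.span {e, w}"
      by (intro vs1.span_eq[THEN iffD2]) (auto simp: vs1.span_base)
    then show "u \<notin> vs1.span {e, w + d} \<longleftrightarrow> u \<notin> vs1.span {e, w}" by simp
  qed
  \<comment> \<open>Expanding \<open>T (d + w + w')\<close> in two ways settles the case of
    \<open>w'\<close> independent of \<open>e, w\<close>; otherwise a vector outside that plane
    links the two differences.\<close>
  have indep: "T (d + w) - T w = T (d + w') - T w'"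
    if d: "d \<in> ?E" and w: "w \<notin> ?E" "w' \<notin> ?E" for d w w'
  proof -
    have *: "T (d + w) - T w = T (d + w') - T w'" if w: "w \<notin> ?E" "w' \<notin> ?E" "w' \<notin> vs1.span {e, w}" for w w'
    proof -
      have 1: "d + w \<notin> ?E" "d + w' \<notin> ?E"
        using vs1.add_notin_span(1)[OF d] w by blast+
      have "w' \<notin> vs1.span {e, d + w}" "d + w' \<notin> vs1.span {e, w}"
        using shift(3)[OF d w(2), of w] shift(2)[OF d w(2), of w] w(3) by (simp_all add: add.commute)
      then have "T (d + w + w') = T (d + w) + T w'" "T (w + (d + w')) = T w + T (d + w')"
        using T_add 1 w by blast+
      then have "T (d + w) + T w' = T w + T (d + w')" by (simp add: add_ac)
      then show ?thesis by (simp add: algebra_simps)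
    qed
    show ?thesis
    proof (cases "w' \<in> vs1.span {e, w}")
      case True
      obtain w'' where w'': "w'' \<notin> ?E" "w'' \<notin> vs1.span {e, w}" using third by blast
      have "w'' \<notin> vs1.span {e, w'}"
      proof
        assume "w'' \<in> vs1.span {e, w'}"
        moreover have "{e, w'} \<subseteq> vs1.span {e, w}" using True vs1.span_base by auto
        ultimately show False using w'' vs1.span_mono vs1.span_span by blast
      qed
      with *[OF w(1) w''] *[OF w(2) w''(1)] show ?thesis by simp
    qed (use * w in blast)
  qed
  obtain y0 where y0: "y0 \<notin> ?E" using third by blast
  define S where "S v = (if v \<in> ?E then T (v + y0) - T y0 else T v)" for v
  have S_E: "S d = T (d + w) - T w" if "d \<in> ?E" "w \<notin> ?E" for d w
    using indep[OF that(1) y0 that(2)] that by (simp add: S_def)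
  have S_T: "S v = T v" if "v \<notin> ?E" for v using that by (simp add: S_def)
  \<comment> \<open>Additivity is known only for vectors independent modulo \<open>e\<close>. Adding
    a transversal \<open>w\<close>, to be cancelled later, handles two summands in one plane through
    \<open>e\<close>.\<close>
  have TT: "T (u + v + w) = T u + T v + T w"
    if "u \<notin> ?E" "v \<notin> ?E" "w \<notin> ?E" "v \<in> vs1.span {e, u}" "w \<notin> vs1.span {e, u}" for u v w
  proof -
    have "{e, v} \<subseteq> vs1.span {e, u}" using that vs1.span_base by auto
    then have w: "w \<notin> vs1.span {e, v}" using that(5) vs1.span_mono vs1.span_span by blast
    have "v + w \<notin> vs1.span {e, u}" using that vs1.add_notin_span by blast
    then have "T (u + (v + w)) = T u + T (v + w)" using T_add that by blast
    also have "T (v + w) = T v + T w" using T_add w that by blast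
    finally show ?thesis by (simp add: add.assoc)
  qed
  have S_add: "S (u + v) = S u + S v" for u v
  proof -
    have mixed: "S (d + w) = S d + S w" if "d \<in> ?E" "w \<notin> ?E" for d w
      using S_E[OF that] S_T that vs1.add_notin_span by (metis diff_add_cancel)
    consider "u \<in> ?E" "v \<in> ?E" | "u \<in> ?E" "v \<notin> ?E" | "u \<notin> ?E" "v \<in> ?E"
      | "u \<notin> ?E" "v \<notin> ?E" "v \<in> vs1.span {e, u}" | "u \<notin> ?E" "v \<notin> vs1.span {e, u}"
      by blast
    then show ?thesis
    proof cases
      case 1
      have "v + y0 \<notin> ?E" using 1 y0 vs1.add_notin_span by blast
      then have "S (u + (v + y0)) = S u + (S v + S y0)" using 1 y0 mixed by metis
      moreover have "S ((u + v) + y0) = S (u + v) + S y0" using 1 y0 mixed vs1.span_add by metis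
      ultimately show ?thesis by (simp add: add_ac)
    next
      case 2 then show ?thesis using mixed by blast
    next
      case 3 then show ?thesis using mixed by (metis add.commute)
    next
      case 4
      obtain w where w: "w \<notin> ?E" "w \<notin> vs1.span {e, u}" using third by blast
      have t: "T (u + v + w) = T u + T v + T w" using TT 4 w by blast
      have uv: "u + v \<in> vs1.span {e, u}" using 4 by (simp add: vs1.span_add vs1.span_base)
      show ?thesis
      proof (cases "u + v \<in> ?E")
        case True
        then show ?thesis using S_E[OF True w(1)] t 4 S_T by simp
      next
        case False
        have "{e, u + v} \<subseteq> vs1.span {e, u}" using uv vs1.span_base by auto
        then have "w \<notin> vs1.span {e, u + v}" using w(2) vs1.span_mono vs1.span_span by blast
        then have "T (u + v + w) = T (u + v) + T w" using T_add False by blast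
        then show ?thesis using t 4 S_T False by simp
      qed
    next
      case 5
      then have "v \<notin> ?E" using vs1.span_pair_mono by blast
      moreover have "u + v \<notin> ?E"
      proof
        assume "u + v \<in> ?E"
        then have "(u + v) - u \<in> vs1.span {e, u}"
          using vs1.span_diff vs1.span_pair_mono vs1.span_base by (metis insertCI)
        with 5 show False by simp
      qed
      ultimately show ?thesis using 5 T_add S_T by simp
    qed
  qed
  have "S x \<noteq> 0 \<and> S x \<in> vs2.span {\<sigma> x}" if x: "x \<noteq> 0" for x
  proof (cases "x \<in> ?E")
    case False
    then obtain r where "r \<noteq> 0" "S x = s2 r (\<sigma> x)" using T S_T by metis
    then show ?thesis using nonzero x by (auto simp: vs2.span_one)
  next
    case True
    have e_x: "e \<in> vs1.span {x}" using True x vs1.span_one_sym by blast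
    have sub: "\<exists>p q. S x = s2 p (\<sigma> x) + s2 q (\<sigma> w)" and ne: "S x \<noteq> 0" if w: "w \<notin> ?E" for w
    proof -
      have w0: "w \<noteq> 0" using w notin_span_nonzero by blast
      have xw: "x + w \<notin> ?E" using True w vs1.add_notin_span by blast
      then have xw0: "x + w \<noteq> 0" using notin_span_nonzero by blast
      obtain r where r: "r \<noteq> 0" "T (x + w) = s2 r (\<sigma> (x + w))" using T[OF xw] by blast
      obtain r' where r': "r' \<noteq> 0" "T w = s2 r' (\<sigma> w)" using T[OF w] by blast
      have "x + w = s1 1 x + s1 1 w" by simp
      then have "x + w \<in> vs1.span {x, w}" using vs1.span_pair by blast
      then obtain m n where "\<sigma> (x + w) = s2 m (\<sigma> x) + s2 n (\<sigma> w)"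
        using collinear[OF x w0 xw0] vs2.span_pair by auto
      then have "S x = s2 (r * m) (\<sigma> x) + s2 (r * n - r') (\<sigma> w)"
        using S_E[OF True w] r r' by (simp add: vs2.scale_right_distrib vs2.scale_left_diff_distrib)
      then show "\<exists>p q. S x = s2 p (\<sigma> x) + s2 q (\<sigma> w)" by blast
      show "S x \<noteq> 0"
      proof
        assume "S x = 0"
        then have "s2 r (\<sigma> (x + w)) = s2 r' (\<sigma> w)" using S_E[OF True w] r r' by simp
        then have "s2 (inverse r) (s2 r (\<sigma> (x + w))) = s2 (inverse r) (s2 r' (\<sigma> w))" by simp
        then have "\<sigma> (x + w) = s2 (inverse r * r') (\<sigma> w)" using r by simp
        then have "x + w \<in> vs1.span {w}" using proportional[OF w0 xw0] vs2.span_one by blast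
        then have "x \<in> vs1.span {w}" using vs1.add_notin_span vs1.span_base by (metis insertI1)
        then show False using w x True vs1.span_one_sym e_x vs1.span_mono vs1.span_span
          by (metis empty_subsetI insert_subset subset_iff)
      qed
    qed
    \<comment> \<open>\<open>S x\<close> lies in the image planes of \<open>x, y0\<close> and of
      \<open>x, w\<close>. As \<open>x, y0, w\<close> are independent, these planes meet only in the
      line of \<open>\<sigma> x\<close>.\<close>
    obtain w where w: "w \<notin> ?E" "w \<notin> vs1.span {e, y0}" using third by blast
    obtain p q where pq: "S x = s2 p (\<sigma> x) + s2 q (\<sigma> y0)" using sub y0 by blast
    obtain p' q' where pq': "S x = s2 p' (\<sigma> x) + s2 q' (\<sigma> w)" using sub w by blast
    have y0x: "y0 \<notin> vs1.span {x}" and wx: "w \<notin> vs1.span {x, y0}"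
    proof -
      have "{x} \<subseteq> ?E" "{x, y0} \<subseteq> vs1.span {e, y0}"
        using True vs1.span_base vs1.span_pair_mono by auto
      then show "y0 \<notin> vs1.span {x}" "w \<notin> vs1.span {x, y0}"
        using y0 w vs1.span_mono vs1.span_span by blast+
    qed
    have nz: "y0 \<noteq> 0" "w \<noteq> 0" using y0 w notin_span_nonzero by blast+
    have "s2 p (\<sigma> x) + s2 q (\<sigma> y0) + s2 0 (\<sigma> w) = s2 p' (\<sigma> x) + s2 0 (\<sigma> y0) + s2 q' (\<sigma> w)"
      using pq pq' by simp
    then have "q = 0"
      using vs2.coeffs_unique3[OF nonzero[OF x]] y0x wx proportional[OF x nz(1)] collinear[OF x nz] by blast
    then show ?thesis using pq ne[OF y0] by (auto simp: vs2.span_one)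
  qed
  with S_add show ?thesis by blast
qed

text \<open>Comparing the value of \<open>S\<close> at c (u + v) with its values at c u and c v, for
  independent \<open>u, v\<close>, shows that the factor between \<open>S (s1 c x)\<close> and
  \<open>S x\<close> depends on \<open>c\<close> only. It is additive and multiplicative because
  \<open>S\<close> is additive; its surjectivity rests on \<open>onto_line\<close>.\<close>

theorem fundamental_theorem:
  "\<exists>S \<theta>. (\<forall>x y. S (x + y) = S x + S y) \<and> (\<forall>c x. S (s1 c x) = s2 (\<theta> c) (S x))
    \<and> (\<forall>x. x \<noteq> 0 \<longrightarrow> S x \<noteq> 0 \<and> S x \<in> vs2.span {\<sigma> x}) \<and> field_automorphism \<theta>"
proof -
  obtain S where S_add: "\<And>x y. S (x + y) = S x + S y"
    and S_nz: "\<And>x. x \<noteq> 0 \<Longrightarrow> S x \<noteq> 0" and S_span: "\<And>x. x \<noteq> 0 \<Longrightarrow> S x \<in> vs2.span {\<sigma> x}"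
    using exists_additive by blast
  have S0: "S 0 = 0" using S_add[of 0 0] by simp
  have \<sigma>_span: "\<sigma> x \<in> vs2.span {S x}" if "x \<noteq> 0" for x
    using S_span[OF that] S_nz[OF that] vs2.span_one_sym by blast
  have ind: "S v \<notin> vs2.span {S u}" if "u \<noteq> 0" "v \<notin> vs1.span {u}" for u v
  proof
    assume "S v \<in> vs2.span {S u}"
    have v: "v \<noteq> 0" using that notin_span_nonzero by blast
    have "\<sigma> v \<in> vs2.span {S v}" using \<sigma>_span v by blast
    moreover have "{S v} \<subseteq> vs2.span {\<sigma> u}"
      using \<open>S v \<in> vs2.span {S u}\<close> S_span[OF that(1)] vs2.span_mono vs2.span_span
      by (metis empty_subsetI insert_subset subset_iff)
    ultimately have "\<sigma> v \<in> vs2.span {\<sigma> u}" using vs2.span_mono vs2.span_span by blast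
    then show False using that proportional[OF that(1) v] by blast
  qed
  have sc_ex: "\<exists>d. S (s1 c x) = s2 d (S x)" if x: "x \<noteq> 0" for c x
  proof (cases "c = 0")
    case True then show ?thesis using S0 by (intro exI[of _ 0]) simp
  next
    case False
    then have cx: "s1 c x \<noteq> 0" using x by simp
    have "s1 c x \<in> vs1.span {x}" using vs1.span_one by blast
    then have "\<sigma> (s1 c x) \<in> vs2.span {\<sigma> x}" using proportional[OF x cx] by blast
    then obtain a where a: "\<sigma> (s1 c x) = s2 a (\<sigma> x)" using vs2.span_one by blast
    obtain b where b: "S (s1 c x) = s2 b (\<sigma> (s1 c x))" using S_span[OF cx] vs2.span_one by blast
    obtain b' where b': "\<sigma> x = s2 b' (S x)" using \<sigma>_span[OF x] vs2.span_one by blast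
    show ?thesis using a b b' by auto
  qed
  define t where "t c x = (SOME d. S (s1 c x) = s2 d (S x))" for c x
  have t: "S (s1 c x) = s2 (t c x) (S x)" if "x \<noteq> 0" for c x
    using someI_ex[OF sc_ex[OF that]] by (simp add: t_def)
  have t_ind: "t c u = t c v" if u: "u \<noteq> 0" and v: "v \<notin> vs1.span {u}" for c u v
  proof -
    have v0: "v \<noteq> 0" using v notin_span_nonzero by blast
    have uv: "u + v \<noteq> 0" using v
      by (metis add_eq_0_iff insertI1 vs1.span_base vs1.span_neg)
    have "S (s1 c (u + v)) = s2 (t c (u + v)) (S u) + s2 (t c (u + v)) (S v)"
      using t[OF uv] S_add by (simp add: vs2.scale_right_distrib)
    moreover have "S (s1 c (u + v)) = s2 (t c u) (S u) + s2 (t c v) (S v)"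
      using t u v0 S_add by (simp add: vs1.scale_right_distrib)
    ultimately show ?thesis
      using vs2.coeffs_unique2[OF S_nz[OF u] ind[OF u v]] by metis
  qed
  have t_eq: "t c u = t c v" if u: "u \<noteq> 0" and v: "v \<noteq> 0" for c u v
  proof (cases "v \<in> vs1.span {u}")
    case True
    obtain w where w: "w \<notin> vs1.span {u}" using dim_ge_3[of u u] by auto
    then have w0: "w \<noteq> 0" using notin_span_nonzero by blast
    have "w \<notin> vs1.span {v}" using w True vs1.span_mono vs1.span_span
      by (metis empty_subsetI insert_subset subset_iff)
    then show ?thesis using t_ind u v w by metis
  qed (use t_ind u in blast)
  obtain e :: 'b where e: "e \<noteq> 0" using exists_nonzero by blast
  obtain e' where e': "e' \<notin> vs1.span {e}" using dim_ge_3[of e e] by auto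
  then have e'0: "e' \<noteq> 0" using notin_span_nonzero by blast
  define \<theta> where "\<theta> c = t c e" for c
  have sc: "S (s1 c x) = s2 (\<theta> c) (S x)" for c x
    using t t_eq[OF _ e] S0 unfolding \<theta>_def by (cases "x = 0") auto
  have canc: "a = b" if "s2 a (S e) = s2 b (S e)" for a b
    using that S_nz[OF e] by simp
  have \<theta>_add: "\<theta> (a + b) = \<theta> a + \<theta> b" for a b
    by (rule canc) (simp add: sc[symmetric] vs1.scale_left_distrib vs2.scale_left_distrib S_add)
  have \<theta>_mult: "\<theta> (a * b) = \<theta> a * \<theta> b" for a b
    by (rule canc) (metis sc vs1.scale_scale vs2.scale_scale)
  have \<theta>_1: "\<theta> 1 = 1"
    by (rule canc) (metis sc vs1.scale_one vs2.scale_one)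
  have \<theta>_0: "\<theta> 0 = 0" using \<theta>_add[of 0 0] by (metis add_0 add_cancel_right_right)
  have \<theta>_nz: "\<theta> a \<noteq> 0" if "a \<noteq> 0" for a
    using \<theta>_mult[of a "inverse a"] \<theta>_1 that by auto
  have "inj \<theta>"
  proof (rule injI)
    fix a b assume "\<theta> a = \<theta> b"
    then have "\<theta> (a - b) = 0" using \<theta>_add[of "a - b" b] by simp
    then show "a = b" using \<theta>_nz[of "a - b"] by auto
  qed
  moreover have "\<exists>c. a = \<theta> c" for a
  proof -
    \<comment> \<open>The scalar \<open>a\<close> is the parameter of a point on the line of
      \<open>S e\<close> and \<open>S e'\<close>. The vector over that point has the form p e + q
      e', and \<open>a\<close> is then the image of q / p.\<close>
    let ?w = "S e + s2 a (S e')"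
    obtain k k' where k: "S e = s2 k (\<sigma> e)" "S e' = s2 k' (\<sigma> e')"
      using S_span e e'0 vs2.span_one by blast
    have w0: "?w \<noteq> 0"
    proof
      assume "?w = 0"
      then have "s2 1 (S e) + s2 a (S e') = s2 0 (S e) + s2 0 (S e')" by simp
      then show False using vs2.coeffs_unique2[OF S_nz[OF e] ind[OF e e']] by (metis zero_neq_one)
    qed
    have "?w = s2 k (\<sigma> e) + s2 (a * k') (\<sigma> e')" using k by simp
    then have "?w \<in> vs2.span {\<sigma> e, \<sigma> e'}" using vs2.span_pair by blast
    then obtain z where z: "z \<noteq> 0" "?w \<in> vs2.span {\<sigma> z}" using onto_line e e'0 w0 by blast
    have "\<sigma> z \<in> vs2.span {?w}" using z w0 vs2.span_one_sym by blast
    then obtain b where b: "\<sigma> z = s2 b ?w" using vs2.span_one by blast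
    obtain j j' where j: "\<sigma> e = s2 j (S e)" "\<sigma> e' = s2 j' (S e')"
      using \<sigma>_span e e'0 vs2.span_one by blast
    have "?w \<in> vs2.span {\<sigma> e, \<sigma> e'}" by fact
    then have "\<sigma> z \<in> vs2.span {\<sigma> e, \<sigma> e'}" unfolding b by (rule vs2.span_scale)
    then obtain p q where "z = s1 p e + s1 q e'"
      using collinear[OF e e'0 z(1)] vs1.span_pair by auto
    then have Sz: "S z = s2 (\<theta> p) (S e) + s2 (\<theta> q) (S e')" by (simp add: S_add sc)
    obtain m where "S z = s2 m (\<sigma> z)" using S_span[OF z(1)] vs2.span_one by blast
    then have "S z = s2 (m * b) (S e) + s2 (m * b * a) (S e')"
      by (simp add: b vs2.scale_right_distrib)
    with Sz have pq: "\<theta> p = m * b \<and> \<theta> q = m * b * a"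
      using vs2.coeffs_unique2[OF S_nz[OF e] ind[OF e e']] by metis
    have "\<theta> p \<noteq> 0"
    proof
      assume "\<theta> p = 0"
      then have "S z = 0" using Sz pq by auto
      then show False using S_nz z by blast
    qed
    then have p0: "p \<noteq> 0" using \<theta>_0 by auto
    have "\<theta> (q / p) * \<theta> p = \<theta> q" using \<theta>_mult[of "q / p" p] p0 by simp
    then have "a = \<theta> (q / p)" using pq \<open>\<theta> p \<noteq> 0\<close> by auto
    then show ?thesis by blast
  qed
  then have "surj \<theta>" by (auto simp: surj_def)
  ultimately have aut: "field_automorphism \<theta>"
    unfolding field_automorphism_def bij_def using \<theta>_add \<theta>_mult \<theta>_1 by blast
  show ?thesis
    by (intro exI[of _ S] exI[of _ \<theta>] conjI allI impI) (fact S_add, fact sc, fact S_nz, fact S_span, fact aut)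
qed

end

section \<open>Rank one operators and the index of sandwiches\<close>

text \<open>An algebraic stand-in for bounded functionals and bounded operators, both taken as plain
  functions: enough of them to separate points and to build operators of finite rank, with the norm
  out of sight. \<open>dim_ge_3\<close> is phrased so that it covers infinite dimension as
  well.\<close>

locale operator_system = vector_space scl
  for scl :: "'f::field \<Rightarrow> 'v::ab_group_add \<Rightarrow> 'v" +
  fixes D :: "('v \<Rightarrow> 'f) set" and Op :: "('v \<Rightarrow> 'v) set"
  assumes D_add: "f \<in> D \<Longrightarrow> f (x + y) = f x + f y"
    and D_scale: "f \<in> D \<Longrightarrow> f (scl c x) = c * f x"
    and D_comb: "f \<in> D \<Longrightarrow> g \<in> D \<Longrightarrow> (\<lambda>x. a * f x + b * g x) \<in> D"
    and D_separates: "x \<noteq> 0 \<Longrightarrow> \<exists>f\<in>D. f x \<noteq> 0"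
    and Op_add: "T \<in> Op \<Longrightarrow> T (x + y) = T x + T y"
    and Op_scale: "T \<in> Op \<Longrightarrow> T (scl c x) = scl c (T x)"
    and Op_rank_one: "f \<in> D \<Longrightarrow> (\<lambda>y. scl (f y) x) \<in> Op"
    and Op_plus: "T \<in> Op \<Longrightarrow> U \<in> Op \<Longrightarrow> (\<lambda>x. T x + U x) \<in> Op"
    and D_comp: "f \<in> D \<Longrightarrow> T \<in> Op \<Longrightarrow> (\<lambda>x. f (T x)) \<in> D"
    and dim_ge_3: "\<exists>z. z \<notin> span {x, y}"
begin

text \<open>Linearity apart from membership in \<open>Op\<close>. Composites, and operators pulled
  back along a semilinear map, are linear, while whether they belong to \<open>Op\<close> is a
  separate question.\<close>

definition lin :: "('v \<Rightarrow> 'v) \<Rightarrow> bool" where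
  "lin X \<longleftrightarrow> (\<forall>x y. X (x + y) = X x + X y) \<and> (\<forall>c x. X (scl c x) = scl c (X x))"

definition rk :: "'v \<Rightarrow> ('v \<Rightarrow> 'f) \<Rightarrow> 'v \<Rightarrow> 'v" where
  "rk x f = (\<lambda>y. scl (f y) x)"

definition rank_le_one :: "('v \<Rightarrow> 'v) \<Rightarrow> bool" where
  "rank_le_one A \<longleftrightarrow> (\<exists>x f. f \<in> D \<and> A = rk x f)"

lemma rk_apply [simp]: "rk x f y = scl (f y) x"
  by (simp add: rk_def)

lemma rk_in_Op [simp]: "f \<in> D \<Longrightarrow> rk x f \<in> Op"
  unfolding rk_def by (rule Op_rank_one)

lemma D_cmult: "f \<in> D \<Longrightarrow> (\<lambda>x. a * f x) \<in> D"
  using D_comb[of f f a 0] by simp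

lemma D_plus: "f \<in> D \<Longrightarrow> g \<in> D \<Longrightarrow> (\<lambda>x. f x + g x) \<in> D"
  using D_comb[of f g 1 1] by simp

lemma D_0 [simp]: "f \<in> D \<Longrightarrow> f 0 = 0"
  using D_add[of f 0 0] by (metis add_0 add_cancel_right_right)

lemma D_minus: "f \<in> D \<Longrightarrow> f (- x) = - f x"
  using D_add[of f x "- x"] by (simp add: eq_neg_iff_add_eq_0 add.commute)

lemma D_diff: "f \<in> D \<Longrightarrow> f (x - y) = f x - f y"
  using D_add[of f x "- y"] D_minus[of f y] by simp

lemmas D_simps = D_add D_scale D_minus D_diff

lemma Op_0 [simp]: "T \<in> Op \<Longrightarrow> T 0 = 0"
  using Op_add[of T 0 0] by simp

lemma Op_minus: "T \<in> Op \<Longrightarrow> T (- x) = - T x"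
  using Op_add[of T x "- x"] by (simp add: eq_neg_iff_add_eq_0 add.commute)

lemma Op_diff: "T \<in> Op \<Longrightarrow> T (x - y) = T x - T y"
  using Op_add[of T x "- y"] Op_minus[of T y] by simp

lemmas Op_simps = Op_add Op_scale Op_minus Op_diff

lemma lin_0: "lin X \<Longrightarrow> X 0 = 0"
  unfolding lin_def by (metis add_cancel_right_right)

lemma lin_Op [simp]: "T \<in> Op \<Longrightarrow> lin T"
  by (simp add: lin_def Op_simps)

lemma lin_sandwich: "A \<in> Op \<Longrightarrow> B \<in> Op \<Longrightarrow> lin (\<lambda>v. A (B (A v)))"
  by (simp add: lin_def Op_simps)

lemma notin_span_nonzero: "y \<notin> span A \<Longrightarrow> y \<noteq> 0"
  using span_zero by blast

lemma exists_nonzero: "\<exists>x::'v. x \<noteq> 0"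
  using dim_ge_3[of 0 0] span_zero by metis

lemma exists_notin_span_one: "\<exists>w. w \<notin> span {x}"
  using dim_ge_3[of x x] by simp

lemma D_zero: "(\<lambda>_. 0) \<in> D"
proof -
  obtain f where "f \<in> D" using D_separates exists_nonzero by blast
  then show ?thesis using D_cmult[of f 0] by simp
qed

lemma zero_in_Op: "(\<lambda>_. 0) \<in> Op"
  using rk_in_Op[OF D_zero, of 0] by (simp add: rk_def)

section \<open>Separation by functionals in \<open>D\<close>, and operators of rank at least
  two\<close>

lemma D_kills_span: "f \<in> D \<Longrightarrow> \<forall>v\<in>F. f v = 0 \<Longrightarrow> x \<in> span F \<Longrightarrow> f x = 0"
  by (rule span_induct) (auto intro!: subspaceI simp: D_simps)

text \<open>Induction on \<open>F\<close>. A new \<open>v\<close> outside the span of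
  \<open>F\<close> has a functional \<open>f1\<close> dual to it; separating w - f1(w) v by
  \<open>f2\<close> and subtracting f2(v) f1 gives a functional that also kills \<open>v\<close> and
  still has value 1 at \<open>w\<close>.\<close>

lemma separate:
  assumes "finite F" "w \<notin> span F"
  shows "\<exists>f\<in>D. (\<forall>v\<in>F. f v = 0) \<and> f w = 1"
  using assms
proof (induction F arbitrary: w rule: finite_induct)
  case empty
  then obtain f where f: "f \<in> D" "f w \<noteq> 0" using D_separates by auto
  then show ?case
    using D_cmult[OF f(1), of "1 / f w"] by (intro bexI[of _ "\<lambda>x. (1 / f w) * f x"]) simp_all
next
  case (insert v F)
  show ?case
  proof (cases "v \<in> span F")
    case True
    then have "w \<notin> span F" using insert.prems span_redundant by blast
    then obtain f where "f \<in> D" "\<forall>v\<in>F. f v = 0" "f w = 1" using insert.IH by blast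
    then show ?thesis using D_kills_span True by (intro bexI[of _ f]) auto
  next
    case False
    then obtain f1 where f1: "f1 \<in> D" "\<forall>v\<in>F. f1 v = 0" "f1 v = 1" using insert.IH by blast
    have "w - scl (f1 w) v \<notin> span F" using insert.prems by (auto simp: span_insert)
    then obtain f2 where f2: "f2 \<in> D" "\<forall>v\<in>F. f2 v = 0" "f2 (w - scl (f1 w) v) = 1"
      using insert.IH by blast
    have "(\<lambda>x. 1 * f2 x + (- f2 v) * f1 x) \<in> D" using f1 f2 D_comb by blast
    then show ?thesis using f1 f2
      by (intro bexI[of _ "\<lambda>x. 1 * f2 x + (- f2 v) * f1 x"]) (auto simp: D_simps mult.commute)
  qed
qed

lemma separate1: "w \<notin> span {a} \<Longrightarrow> \<exists>f\<in>D. f a = 0 \<and> f w = 1"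
  using separate[of "{a}" w] by auto

lemma separate2: "w \<notin> span {a, b} \<Longrightarrow> \<exists>f\<in>D. f a = 0 \<and> f b = 0 \<and> f w = 1"
  using separate[of "{a, b}" w] by auto

lemma separate3: "w \<notin> span {a, b, c} \<Longrightarrow> \<exists>f\<in>D. f a = 0 \<and> f b = 0 \<and> f c = 0 \<and> f w = 1"
  using separate[of "{a, b, c}" w] by auto

text \<open>Of two functionals that separate \<open>a\<close> and \<open>b\<close> individually,
  either one serves both points, or each vanishes at the other point and their sum serves
  both.\<close>

lemma separate_both:
  assumes F: "finite F" "a \<notin> span F" "b \<notin> span F"
  shows "\<exists>f\<in>D. (\<forall>v\<in>F. f v = 0) \<and> f a \<noteq> 0 \<and> f b \<noteq> 0"
proof -
  obtain f where f: "f \<in> D" "\<forall>v\<in>F. f v = 0" "f a = 1" using separate F by blast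
  obtain g where g: "g \<in> D" "\<forall>v\<in>F. g v = 0" "g b = 1" using separate F by blast
  show ?thesis
  proof (cases "f b \<noteq> 0 \<or> g a \<noteq> 0")
    case True
    have "(f a \<noteq> 0 \<and> f b \<noteq> 0) \<or> (g a \<noteq> 0 \<and> g b \<noteq> 0)" using True f(3) g(3) by auto
    then show ?thesis using f(1,2) g(1,2) by blast
  next
    case False
    then show ?thesis using f g D_plus[of f g]
      by (intro bexI[of _ "\<lambda>x. f x + g x"]) auto
  qed
qed

lemma proportional_functionals:
  assumes "f \<in> D" "g \<in> D" "\<And>x. f x = 0 \<Longrightarrow> g x = 0"
  shows "\<exists>c. g = (\<lambda>x. c * f x)"
proof (cases "\<exists>z. f z \<noteq> 0")
  case True
  then obtain z where z: "f z \<noteq> 0" by blast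
  have "g x = g z / f z * f x" for x
  proof -
    have "f (x - scl (f x / f z) z) = 0" using z assms by (simp add: D_simps)
    then have "g (x - scl (f x / f z) z) = 0" using assms by blast
    then show ?thesis using assms by (simp add: D_simps)
  qed
  then show ?thesis by blast
qed (use assms in \<open>auto intro!: exI[of _ 0]\<close>)

lemma in_span_one_if:
  assumes "\<And>f. f \<in> D \<Longrightarrow> f x = 0 \<Longrightarrow> f y = 0"
  shows "y \<in> span {x}"
  using separate1[of y x] assms zero_neq_one by metis

lemma in_span_pair_if:
  assumes "\<And>f. f \<in> D \<Longrightarrow> f a = 0 \<Longrightarrow> f b = 0 \<Longrightarrow> f y = 0"
  shows "y \<in> span {a, b}"
  using separate2[of y a b] assms zero_neq_one by metis

lemma rk_eq_zero_iff: "rk x f = (\<lambda>_. 0) \<longleftrightarrow> x = 0 \<or> f = (\<lambda>_. 0)"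
  by (auto simp: rk_def fun_eq_iff)

lemma rk_neq_scl: "rk x f \<noteq> scl c" if "c \<noteq> 0"
proof
  assume eq: "rk x f = scl c"
  obtain w where w: "w \<notin> span {x}" using exists_notin_span_one by blast
  have "scl c w = scl (f w) x" using fun_cong[OF eq, of w] by simp
  then have "w = scl (inverse c * f w) x" using that
    by (metis left_inverse scale_one scale_scale)
  then show False using w span_one by blast
qed

text \<open>If every value of \<open>T\<close> were a multiple of \<open>T u\<close>, a functional
  \<open>f\<close> with f(Tu) = 1 would exhibit \<open>T\<close> as the rank one operator Tu
  \<otimes> (f \<circ> T).\<close>

lemma rank_ge_two:
  assumes T: "T \<in> Op" "\<not> rank_le_one T"
  shows "\<exists>u v. T u \<noteq> 0 \<and> T v \<notin> span {T u}"
proof (rule ccontr)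
  assume *: "\<not> ?thesis"
  show False
  proof (cases "\<exists>u. T u \<noteq> 0")
    case True
    then obtain u where u: "T u \<noteq> 0" by blast
    then obtain f where f: "f \<in> D" "f (T u) = 1" using separate[of "{}" "T u"] by auto
    have "T v = scl (f (T v)) (T u)" for v
    proof -
      have "T v \<in> span {T u}" using * u by blast
      then obtain c where "T v = scl c (T u)" using span_one by blast
      then show ?thesis using f by (simp add: D_scale)
    qed
    then have "T = rk (T u) (\<lambda>v. f (T v))" by (simp add: rk_def)
    then show False using T(2) D_comp[OF f(1) T(1)] unfolding rank_le_one_def by blast
  next
    case False
    then have "T = rk 0 (\<lambda>_. 0)" by (auto simp: rk_def)
    then show False using T(2) D_zero unfolding rank_le_one_def by blast
  qed
qed

text \<open>These are the data for which T (u \<otimes> h) T = Tu \<otimes> (h \<circ> T) is nonzero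
  with square zero. Rank two leaves room to move \<open>u\<close> into the kernel of h \<circ> T^2
  while keeping \<open>T u\<close> nonzero.\<close>

lemma rank_ge_two_isotropic:
  assumes T: "T \<in> Op" "\<not> rank_le_one T"
  shows "\<exists>h\<in>D. \<exists>u w. h (T w) \<noteq> 0 \<and> T u \<noteq> 0 \<and> h (T (T u)) = 0"
proof -
  obtain u v where u: "T u \<noteq> 0" and v: "T v \<notin> span {T u}" using rank_ge_two[OF T] by blast
  then obtain h where h: "h \<in> D" "h (T u) = 1" using separate[of "{}" "T u"] by auto
  show ?thesis
  proof (cases "h (T (T u)) = 0")
    case True
    then show ?thesis using h u by (metis zero_neq_one)
  next
    case False
    let ?c = "h (T (T v)) / h (T (T u))"
    let ?w = "v - scl ?c u"
    have "T ?w \<noteq> 0" using v T by (auto simp: Op_simps span_one)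
    moreover have "h (T (T ?w)) = 0" using T h False by (simp add: Op_simps D_simps)
    ultimately show ?thesis using h by (metis zero_neq_one)
  qed
qed

lemma rank_one_sandwich:
  "A \<in> Op \<Longrightarrow> (\<lambda>v. A (rk x f (A v))) = rk (A x) (\<lambda>v. f (A v))"
  by (simp add: Op_simps fun_eq_iff)

lemma sandwich_rank_one:
  "f \<in> D \<Longrightarrow> B \<in> Op \<Longrightarrow> (\<lambda>v. rk x f (B (rk x f v))) = rk (scl (f (B x)) x) f"
  by (simp add: Op_simps D_simps fun_eq_iff mult.commute)

end

text \<open>The common part of ascent and descent, as values forced by polynomial identities. The
  clause \<open>X \<noteq> scl c\<close> excludes the nonzero multiples of the identity, whose
  ascent and descent are 0.\<close>

locale operator_index = operator_system +
  fixes idx :: "('b \<Rightarrow> 'b) \<Rightarrow> enat"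
  assumes idx_idempotent: "lin X \<Longrightarrow> (\<And>v. X (X v) = scl c (X v)) \<Longrightarrow> c \<noteq> 0 \<Longrightarrow> X \<noteq> scl c \<Longrightarrow> idx X = 1"
    and idx_square_zero: "lin X \<Longrightarrow> (\<And>v. X (X v) = 0) \<Longrightarrow> X w \<noteq> 0 \<Longrightarrow> idx X = 2"
    and idx_cube_zero: "lin X \<Longrightarrow> (\<And>v. X (X (X v)) = 0) \<Longrightarrow> X (X w) \<noteq> 0 \<Longrightarrow> idx X = 3"
    and idx_le_2: "lin X \<Longrightarrow> (\<And>v. X (X (X (X v))) = scl c (X (X v))) \<Longrightarrow> c \<noteq> 0 \<Longrightarrow> idx X \<le> 2"
begin

text \<open>The zero operator satisfies X^2 = X and is not the identity. Having index 1, it cannot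
  be told by its own index from a rank one operator that is not nilpotent.\<close>

lemma idx_zero: "idx (\<lambda>_. 0) = 1"
proof (rule idx_idempotent[of _ 1])
  show "(\<lambda>_. 0) \<noteq> scl 1" using exists_nonzero by (auto simp: fun_eq_iff)
qed (auto simp: lin_def)

lemma idx_rk:
  assumes f: "f \<in> D"
  shows "idx (rk x f) = (if f x = 0 \<and> x \<noteq> 0 \<and> f \<noteq> (\<lambda>_. 0) then 2 else 1)"
proof -
  consider "f x \<noteq> 0" | "x = 0 \<or> f = (\<lambda>_. 0)" | "f x = 0" "x \<noteq> 0" "f \<noteq> (\<lambda>_. 0)" by blast
  then show ?thesis
  proof cases
    case 1
    then have "idx (rk x f) = 1"
      using f by (intro idx_idempotent[of _ "f x"] rk_neq_scl) (auto simp: D_simps mult.commute)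
    with 1 show ?thesis by simp
  next
    case 2
    then show ?thesis using idx_zero rk_eq_zero_iff by metis
  next
    case 3
    then obtain z where z: "f z \<noteq> 0" by blast
    have "idx (rk x f) = 2"
      using f 3 z by (intro idx_square_zero[of _ z]) (auto simp: D_simps)
    with 3 show ?thesis by simp
  qed
qed

lemma idx_rk_le_2: "f \<in> D \<Longrightarrow> idx (rk x f) \<le> 2"
  using idx_rk[of f x] by (auto split: if_splits simp: one_enat_def numeral_eq_enat)

text \<open>Up to nonzero factors and multiples of \<open>y1\<close>, \<open>X\<close> is the chain
  z -> y2 -> y1 -> 0, a Jordan block of size three. Sandwiches of operators of rank at least two are
  brought to this shape in order to exceed the bound 2.\<close>

lemma idx_nilpotent_3:
  assumes g: "g1 \<in> D" "g2 \<in> D" "g1 y1 = 0" "g2 y1 = 0" "g2 y2 = 0" "g1 y2 \<noteq> 0" "y1 \<noteq> 0" "g2 z \<noteq> 0"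
    and X: "\<And>v. X v = scl (g1 v) y1 + scl (g2 v) y2"
  shows "idx X = 3"
proof (rule idx_cube_zero[of _ z])
  show "lin X" using g unfolding lin_def X by (auto simp: D_simps scale_left_distrib scale_right_distrib)
  have XX: "X (X v) = scl (g2 v * g1 y2) y1" for v
    using g unfolding X by (simp add: D_simps)
  show "X (X (X v)) = 0" for v
    unfolding XX X using g by (simp add: D_simps)
  show "X (X z) \<noteq> 0" unfolding XX using g by simp
qed

text \<open>Rank at least two produces a nonzero square-zero sandwich by
  \<open>rank_ge_two_isotropic\<close>, and a nilpotent rank one \<open>A\<close> has nonzero
  multiples of itself among the A B A. Within rank at most one, the negation of the condition
  singles out the nilpotent rank one operators.\<close>

lemma all_sandwiches_idx_1_iff:
  assumes A: "A \<in> Op"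
  shows "(\<forall>B\<in>Op. idx (\<lambda>v. A (B (A v))) = 1) \<longleftrightarrow> (\<exists>x f. f \<in> D \<and> A = rk x f \<and> (f x \<noteq> 0 \<or> x = 0))"
proof
  assume *: "\<forall>B\<in>Op. idx (\<lambda>v. A (B (A v))) = 1"
  have "rank_le_one A"
  proof (rule ccontr)
    assume "\<not> rank_le_one A"
    then obtain h u w where h: "h \<in> D" "h (A w) \<noteq> 0" "A u \<noteq> 0" "h (A (A u)) = 0"
      using rank_ge_two_isotropic[OF A] by blast
    have "idx (\<lambda>v. A (rk u h (A v))) = 2"
      unfolding rank_one_sandwich[OF A] using h D_comp[OF h(1) A]
      by (subst idx_rk) (auto simp: fun_eq_iff)
    then show False using * h by (simp del: rk_apply)
  qed
  then obtain x f where f: "f \<in> D" "A = rk x f" unfolding rank_le_one_def by blast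
  show "\<exists>x f. f \<in> D \<and> A = rk x f \<and> (f x \<noteq> 0 \<or> x = 0)"
  proof (cases "f x \<noteq> 0 \<or> x = 0 \<or> f = (\<lambda>_. 0)")
    case True
    then show ?thesis
    proof (elim disjE)
      assume "f = (\<lambda>_. 0)"
      then have "A = rk 0 f" using f by (auto simp: rk_def)
      then show ?thesis using f by blast
    qed (use f in blast)+
  next
    case False
    then obtain y g where y: "f y \<noteq> 0" "g \<in> D" "g x \<noteq> 0" using D_separates by blast
    have "idx (\<lambda>v. rk x f (rk y g (rk x f v))) = 2"
      using f y False by (subst sandwich_rank_one) (auto simp: idx_rk D_simps)
    then show ?thesis using * f y by (auto simp del: rk_apply)
  qed
next
  assume "\<exists>x f. f \<in> D \<and> A = rk x f \<and> (f x \<noteq> 0 \<or> x = 0)"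
  then obtain x f where f: "f \<in> D" "A = rk x f" "f x \<noteq> 0 \<or> x = 0" by blast
  have "idx (\<lambda>v. rk x f (B (rk x f v))) = 1" if "B \<in> Op" for B
    using f that by (subst sandwich_rank_one) (auto simp: idx_rk D_simps)
  then show "\<forall>B\<in>Op. idx (\<lambda>v. A (B (A v))) = 1" using f by simp
qed

text \<open>With C = u1 \<otimes> h1 + u2 \<otimes> h2, the operator C A C sends \<open>A u2\<close>
  to \<open>u2\<close> and \<open>u2\<close> to \<open>u1\<close>, up to nonzero factors and
  multiples of \<open>u1\<close>, and it kills \<open>u1\<close>.\<close>

lemma exists_idx_3_outer:
  assumes A: "A \<in> Op" and u1: "A u1 \<notin> span {u1}" and u2: "A u2 \<notin> span {u1, u2, A u1}" and u0: "u1 \<noteq> 0"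
  shows "\<exists>C\<in>Op. idx (\<lambda>v. C (A (C v))) = 3"
proof -
  have "u2 \<notin> span {u1}"
  proof
    assume "u2 \<in> span {u1}"
    then obtain p where "u2 = scl p u1" using span_one by blast
    then have "A u2 = scl p (A u1)" using A by (simp add: Op_simps)
    then show False using u2 by (simp add: span_base span_scale)
  qed
  then obtain h1 where h1: "h1 \<in> D" "h1 u1 = 0" "h1 (A u1) \<noteq> 0" "h1 u2 \<noteq> 0"
    using separate_both[of "{u1}" "A u1" u2] u1 by auto
  obtain h2 where h2: "h2 \<in> D" "h2 u1 = 0" "h2 u2 = 0" "h2 (A u1) = 0" "h2 (A u2) = 1"
    using separate3[OF u2] by blast
  define C where "C v = scl (h1 v) u1 + scl (h2 v) u2" for v
  have C: "C \<in> Op" unfolding C_def using Op_plus[OF rk_in_Op[OF h1(1)] rk_in_Op[OF h2(1)]] by simp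
  have "idx (\<lambda>v. C (A (C v))) = 3"
  proof (rule idx_nilpotent_3)
    show "h1 (scl (h1 (A u1)) u1) = 0" "h2 (scl (h1 (A u1)) u1) = 0"
      using h1 h2 by (simp_all add: D_simps)
    show "C (A (C v)) = scl (h1 v) (scl (h1 (A u1)) u1) + scl (h2 v) (scl (h1 (A u2)) u1 + u2)" for v
      using h1 h2 A unfolding C_def by (simp add: D_simps Op_simps scale_left_distrib scale_right_distrib)
    show "h2 (scl (h1 (A u2)) u1 + u2) = 0" "h1 (scl (h1 (A u2)) u1 + u2) \<noteq> 0"
      using h1 h2 by (simp_all add: D_simps)
    show "h2 (A u2) \<noteq> 0" "h1 \<in> D" "h2 \<in> D" "scl (h1 (A u1)) u1 \<noteq> 0" using h1 h2 u0 by simp_all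
  qed
  then show ?thesis using C by blast
qed

text \<open>With B = u1 \<otimes> h1 + u2 \<otimes> h2, the operator A B A is built from the vectors
  \<open>A u1\<close>, \<open>A u2\<close> and the functionals h1 \<circ> A, h2 \<circ> A; the
  hypotheses turn these into a Jordan chain of length three.\<close>

lemma exists_idx_3_inner:
  assumes A: "A \<in> Op" and u1: "A u1 \<noteq> 0" and h1: "h1 \<in> D" "h1 (A (A u1)) = 0" "h1 (A (A u2)) \<noteq> 0"
    and h2: "h2 \<in> D" "h2 (A (A u1)) = 0" "h2 (A (A u2)) = 0" "h2 (A z) \<noteq> 0"
  shows "\<exists>B\<in>Op. idx (\<lambda>v. A (B (A v))) = 3"
proof -
  define B where "B v = scl (h1 v) u1 + scl (h2 v) u2" for v
  have B: "B \<in> Op" unfolding B_def using Op_plus[OF rk_in_Op[OF h1(1)] rk_in_Op[OF h2(1)]] by simp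
  have "idx (\<lambda>v. A (B (A v))) = 3"
  proof (rule idx_nilpotent_3)
    show "A (B (A v)) = scl (h1 (A v)) (A u1) + scl (h2 (A v)) (A u2)" for v
      using A unfolding B_def by (simp add: Op_simps)
    show "(\<lambda>v. h1 (A v)) \<in> D" "(\<lambda>v. h2 (A v)) \<in> D" using D_comp h1 h2 A by blast+
  qed (use assms in auto)
  then show ?thesis using B by blast
qed

text \<open>Both kinds of sandwich are called for: if A^2 = 0, every A B A has square zero, and only
  C A C can reach index 3. If A^2 is nonzero, the bound on all A B A makes the range of
  \<open>A\<close> a plane that meets the kernel only in 0, and C A C settles this case according to
  whether \<open>A\<close> is scalar on its range.\<close>

lemma rank_le_one_iff:
  assumes A: "A \<in> Op"
  shows "rank_le_one A \<longleftrightarrow>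
    (\<forall>B\<in>Op. idx (\<lambda>v. A (B (A v))) \<le> 2) \<and> (\<forall>C\<in>Op. idx (\<lambda>v. C (A (C v))) \<le> 2)"
proof
  assume "rank_le_one A"
  then obtain x f where f: "f \<in> D" "A = rk x f" unfolding rank_le_one_def by blast
  have "idx (\<lambda>v. rk x f (B (rk x f v))) \<le> 2" if "B \<in> Op" for B
    using f that by (subst sandwich_rank_one) (auto simp: idx_rk_le_2)
  moreover have "idx (\<lambda>v. C (rk x f (C v))) \<le> 2" if "C \<in> Op" for C
    using f that by (subst rank_one_sandwich) (auto simp: idx_rk_le_2 D_comp)
  ultimately show "(\<forall>B\<in>Op. idx (\<lambda>v. A (B (A v))) \<le> 2) \<and> (\<forall>C\<in>Op. idx (\<lambda>v. C (A (C v))) \<le> 2)"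
    using f by simp
next
  assume *: "(\<forall>B\<in>Op. idx (\<lambda>v. A (B (A v))) \<le> 2) \<and> (\<forall>C\<in>Op. idx (\<lambda>v. C (A (C v))) \<le> 2)"
  have not3: "\<not> (3::enat) \<le> 2" by (simp add: numeral_eq_enat)
  have outer: False if "A u1 \<notin> span {u1}" "A u2 \<notin> span {u1, u2, A u1}" "u1 \<noteq> 0" for u1 u2
    using exists_idx_3_outer[OF A that] * not3 by metis
  have inner: False if "A u1 \<noteq> 0" "h1 \<in> D" "h1 (A (A u1)) = 0" "h1 (A (A u2)) \<noteq> 0"
    "h2 \<in> D" "h2 (A (A u1)) = 0" "h2 (A (A u2)) = 0" "h2 (A z) \<noteq> 0" for u1 u2 h1 h2 z
    using exists_idx_3_inner[OF A that] * not3 by metis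
  show "rank_le_one A"
  proof (rule ccontr)
    assume "\<not> rank_le_one A"
    then obtain u v where u: "A u \<noteq> 0" and v: "A v \<notin> span {A u}" using rank_ge_two[OF A] by blast
    have A_diff: "A (x - scl c y) = A x - scl c (A y)" for x y c using A by (simp add: Op_simps)
    have "\<exists>w. A (A w) \<noteq> 0"
    proof (rule ccontr)
      assume "\<not> ?thesis"
      then have sq: "A (A w) = 0" for w by blast
      have ne: "A u \<notin> span {u}"
      proof
        assume "A u \<in> span {u}"
        then have "u \<in> span {A u}" using u span_one_sym by blast
        then obtain c where "u = scl c (A u)" using span_one by blast
        then have "A u = scl c (A (A u))" using A Op_scale by metis
        then show False using sq u by simp
      qed
      have u0: "u \<noteq> 0" using u A by auto
      \<comment> \<open>Applying \<open>A\<close> to a linear relation kills its terms in the range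
        and leaves one between \<open>A u\<close> and \<open>A v\<close>, which are
        independent.\<close>
      have "A v \<notin> span {u, v, A u}"
      proof
        assume "A v \<in> span {u, v, A u}"
        then obtain k where "A v - scl k v \<in> span {u, A u}"
          using span_insert[of v "{u, A u}"] by (auto simp: insert_commute)
        then obtain p q where eq: "A v - scl k v = scl p u + scl q (A u)" using span_pair by blast
        then have "A (A v - scl k v) = A (scl p u + scl q (A u))" by simp
        then have "- scl k (A v) = scl p (A u)" using A sq by (simp add: Op_simps)
        then have kp: "scl (- k) (A v) = scl p (A u)" by simp
        have "k = 0"
        proof (rule ccontr)
          assume "k \<noteq> 0"
          then have "A v = scl (inverse (- k) * p) (A u)"
            using kp by (metis left_inverse neg_equal_0_iff_equal scale_one scale_scale)
          then show False using v span_one by blast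
        qed
        then have "p = 0" using kp u by auto
        then show False using eq \<open>k = 0\<close> v span_one by auto
      qed
      then show False using outer ne u0 by blast
    qed
    then obtain w where w: "A (A w) \<noteq> 0" by blast
    \<comment> \<open>Range and kernel meet only in 0: a nonzero \<open>A x\<close> in the kernel
      would be the bottom of a Jordan chain of A B A with \<open>A w\<close> in the middle.\<close>
    have injR: "A x \<noteq> 0 \<Longrightarrow> A (A x) \<noteq> 0" for x
    proof
      assume x: "A x \<noteq> 0" "A (A x) = 0"
      obtain h1 where h1: "h1 \<in> D" "h1 (A (A w)) = 1" using w separate[of "{}"] by auto
      obtain z where "A z \<notin> span {A (A w)}"
      proof (rule ccontr)
        assume "\<not> thesis"
        then have all: "A z \<in> span {A (A w)}" for z using that by blast
        then have "A u \<in> span {A v}" if "A v \<noteq> 0" for u v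
          using span_one_sym[OF all[of v] that] all[of u] span_mono[of "{A (A w)}" "span {A v}"]
          by (metis empty_subsetI insert_subset span_span subset_iff)
        then show False using u v by blast
      qed
      then obtain h2 where "h2 \<in> D" "h2 (A (A w)) = 0" "h2 (A z) = 1" using separate1 by blast
      then show False using inner[of x h1 w h2 z] h1 x by auto
    qed
    define p where "p = A (A u)"
    define q where "q = A (A v)"
    have p0: "p \<noteq> 0" using injR u by (simp add: p_def)
    have qp: "q \<notin> span {p}"
    proof
      assume "q \<in> span {p}"
      then obtain c where "q = scl c p" using span_one by blast
      then have "A (A (v - scl c u)) = 0" using A by (simp add: A_diff p_def q_def)
      then have "A (v - scl c u) = 0" using injR by blast
      then have "A v = scl c (A u)" by (simp add: A_diff)
      then show False using v span_one by blast
    qed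
    obtain h1 where h1: "h1 \<in> D" "h1 p = 0" "h1 q = 1" using separate1[OF qp] by blast
    \<comment> \<open>A third independent direction in the range would admit a functional
      \<open>h2\<close> killing \<open>p\<close> and \<open>q\<close> but not the range, and so
      index 3 again. Hence the range is the plane of \<open>p\<close> and \<open>q\<close>.\<close>
    have R: "A z \<in> span {p, q}" for z
    proof (rule ccontr)
      assume "A z \<notin> span {p, q}"
      then obtain h2 where "h2 \<in> D" "h2 p = 0" "h2 q = 0" "h2 (A z) = 1" using separate2 by blast
      then show False using inner[of u h1 v h2 z] h1 u by (auto simp: p_def q_def)
    qed
    have p_img: "\<exists>x'. x = A x'" if x: "x \<in> span {p, q}" for x
    proof -
      obtain a b where "x = scl a p + scl b q" using x span_pair by blast
      then have "x = A (scl a (A u) + scl b (A v))" using A by (simp add: p_def q_def Op_simps)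
      then show ?thesis by blast
    qed
    have ker_R: "x \<in> span {p, q} \<Longrightarrow> A x = 0 \<Longrightarrow> x = 0" for x using p_img injR by metis
    obtain z where z: "z \<notin> span {p, q}" using dim_ge_3 by blast
    obtain a b where "A z = scl a p + scl b q" using R span_pair by metis
    then have Az: "A z = A (scl a (A u) + scl b (A v))" using A by (simp add: p_def q_def Op_simps)
    \<comment> \<open>\<open>z\<close> lies outside the range by dimension 3; subtracting the vector
      of the range with the same image leaves a kernel vector.\<close>
    define e where "e = z - (scl a (A u) + scl b (A v))"
    have "scl a (A u) + scl b (A v) = A (scl a u + scl b v)" using A by (simp add: Op_simps)
    then have "scl a (A u) + scl b (A v) \<in> span {p, q}" using R by simp
    then have e_R: "e \<notin> span {p, q}" using z unfolding e_def
      by (metis diff_add_cancel span_add)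
    have Ae: "A e = 0" using Az A by (simp add: e_def Op_simps)
    show False
    proof (cases "\<exists>x\<in>span {p, q}. A x \<notin> span {x}")
      case True
      then obtain x where x: "x \<in> span {p, q}" "A x \<notin> span {x}" by blast
      have x0: "x \<noteq> 0" using x A by auto
      \<comment> \<open>All values of \<open>A\<close> lie in a plane, but shifting \<open>x\<close>
        by the kernel vector makes \<open>x + e\<close>, \<open>A x\<close> and
        \<open>A (A x)\<close> independent. So \<open>outer\<close> applies with u1 = x + e and u2 =
        A u1.\<close>
      have Axe: "A (x + e) = A x" using A Ae by (simp add: Op_simps)
      have c0: "c = 0" if "scl c (x + e) \<in> span {p, q}" for c
      proof (rule ccontr)
        assume "c \<noteq> 0"
        then have "x + e \<in> span {p, q}" using that by (metis left_inverse scale_one scale_scale span_scale)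
        then show False using x e_R add_notin_span by blast
      qed
      show False
      proof (rule outer)
        show "A (x + e) \<notin> span {x + e}"
        proof
          assume "A (x + e) \<in> span {x + e}"
          then obtain c where c: "A x = scl c (x + e)" using Axe span_one by auto
          then have "c = 0" using c0 R[of x] by simp
          then have "A x = 0" using c by simp
          then show False using ker_R x x0 by blast
        qed
        show "A (A (x + e)) \<notin> span {x + e, A (x + e), A (x + e)}"
        proof
          assume "A (A (x + e)) \<in> span {x + e, A (x + e), A (x + e)}"
          then obtain c d where cd: "A (A x) = scl c (x + e) + scl d (A x)"
            using span_pair Axe by auto
          then have "scl c (x + e) = A (A x) - scl d (A x)" by simp
          then have "c = 0" using c0 R span_diff span_scale by metis
          then have "A (A x - scl d x) = 0" using cd by (simp add: A_diff)
          moreover have "A x - scl d x \<in> span {p, q}" using R x span_diff span_scale by blast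
          ultimately have "A x = scl d x" using ker_R by fastforce
          then show False using x span_one by blast
        qed
        show "x + e \<noteq> 0" using x e_R span_zero add_notin_span by metis
      qed
    next
      case False
      then have eig: "A x \<in> span {x}" if "x \<in> span {p, q}" for x using that by blast
      have pR: "p \<in> span {p, q}" and qR: "q \<in> span {p, q}" by (auto simp: span_base)
      obtain c where c: "A p = scl c p" using eig[OF pR] span_one by blast
      obtain d where d: "A q = scl d q" using eig[OF qR] span_one by blast
      obtain k where "A (p + q) = scl k (p + q)" using eig[OF span_add[OF pR qR]] span_one by blast
      then have "scl c p + scl d q = scl k p + scl k q" using A c d by (simp add: Op_simps scale_right_distrib)
      then have "d = c" using coeffs_unique2[OF p0 qp] by metis
      have "c \<noteq> 0" using ker_R[OF pR] c p0 by auto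
      obtain f3 where f3: "f3 \<in> D" "f3 p = 0" "f3 q = 0" "f3 e = 1" using separate2[OF e_R] by blast
      have "p \<notin> span {q, e}"
      proof
        assume "p \<in> span {q, e}"
        moreover have "p \<notin> span {q}" using qp p0 span_one_sym by blast
        ultimately have "e \<in> span {q, p}" using span_pair_exchange by blast
        then show False using e_R by (simp add: insert_commute)
      qed
      then obtain f1 where f1: "f1 \<in> D" "f1 q = 0" "f1 e = 0" "f1 p = 1" using separate2 by blast
      have "q \<notin> span {p, e}" using qp e_R span_pair_exchange by blast
      then obtain f2 where f2: "f2 \<in> D" "f2 p = 0" "f2 e = 0" "f2 q = 1" using separate2 by blast
      \<comment> \<open>On the span of \<open>p, q, e\<close>, \<open>A\<close> is now
        \<open>c\<close> times the projection onto the plane of \<open>p, q\<close> along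
        \<open>e\<close>. With the cyclic shift p -> q -> e -> p as \<open>C\<close>, C A C becomes
        the chain p -> e -> q -> 0, up to the factor \<open>c\<close>.\<close>
      define C where "C v = scl (f1 v) q + scl (f2 v) e + scl (f3 v) p" for v
      have "C \<in> Op" unfolding C_def
        using Op_plus[OF Op_plus[OF rk_in_Op[OF f1(1)] rk_in_Op[OF f2(1)]] rk_in_Op[OF f3(1)]] by simp
      moreover have "idx (\<lambda>v. C (A (C v))) = 3"
      proof (rule idx_nilpotent_3)
        show "C (A (C v)) = scl (f3 v) (scl c q) + scl (f1 v) (scl c e)" for v
          unfolding C_def using A f1 f2 f3 c d \<open>d = c\<close> Ae by (simp add: Op_simps D_simps mult.commute)
        show "f1 p \<noteq> 0" using f1 by simp
        show "scl c q \<noteq> 0" using \<open>c \<noteq> 0\<close> f2 by auto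
      qed (use f1 f2 f3 \<open>c \<noteq> 0\<close> in \<open>auto simp: D_simps\<close>)
      ultimately show False using * not3 by metis
    qed
  qed
qed

text \<open>Zero and the non-nilpotent rank one operators look alike in all A B A, so the other kind
  of sandwich is used: for nonzero x \<otimes> f, a nilpotent C = y \<otimes> g with f(y) and g(x)
  nonzero makes C A C a nonzero multiple of \<open>C\<close>.\<close>

lemma zero_iff:
  assumes A: "rank_le_one A"
  shows "(\<forall>C\<in>Op. idx (\<lambda>v. C (A (C v))) = 1) \<longleftrightarrow> A = (\<lambda>_. 0)"
proof
  assume *: "\<forall>C\<in>Op. idx (\<lambda>v. C (A (C v))) = 1"
  obtain x f where f: "f \<in> D" "A = rk x f" using A unfolding rank_le_one_def by blast
  show "A = (\<lambda>_. 0)"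
  proof (rule ccontr)
    assume "A \<noteq> (\<lambda>_. 0)"
    then have x: "x \<noteq> 0" and f0: "f \<noteq> (\<lambda>_. 0)" using f rk_eq_zero_iff by auto
    obtain y where y: "f y \<noteq> 0" "y \<notin> span {x}"
    proof -
      obtain y where y: "f y \<noteq> 0" using f0 by auto
      obtain w where w: "w \<notin> span {x}" using exists_notin_span_one by blast
      show thesis
      proof (cases "f w = 0 \<and> y \<in> span {x}")
        case True
        then have "f (w + y) \<noteq> 0" "w + y \<notin> span {x}" using y w f by (auto simp: D_simps span_add_eq2)
        then show thesis using that by blast
      qed (use that y w in blast)
    qed
    have "x \<notin> span {y}" using y x span_one_sym by blast
    then obtain g where g: "g \<in> D" "g y = 0" "g x = 1" using separate1 by blast
    have "idx (\<lambda>v. rk y g (A (rk y g v))) = 2"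
      unfolding f(2) using f g y
      by (subst sandwich_rank_one) (auto simp: idx_rk D_simps)
    then show False using * g by (auto simp del: rk_apply)
  qed
next
  assume "A = (\<lambda>_. 0)"
  then show "\<forall>C\<in>Op. idx (\<lambda>v. C (A (C v))) = 1" using idx_zero by simp
qed

lemma idx_test_flag:
  assumes g: "g \<in> D" "g y = 0" "g \<noteq> (\<lambda>_. 0)" "y \<noteq> 0" and B: "B \<in> Op"
  shows "idx (\<lambda>v. rk y g (B (rk y g v))) = 2 \<longleftrightarrow> g (B y) \<noteq> 0"
  using g B by (subst sandwich_rank_one) (auto simp: idx_rk D_simps)

end

section \<open>Preservers that fix the nilpotent rank one operators up to scalars\<close>

text \<open>The preserver after composition with a semilinear map. Image sandwiches enter through
  polynomial identities, and the index appears on the side of the original operators only: in the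
  hyperplane case \<open>\<psi> T\<close> comes from a transpose of \<phi>(T), for which kernels and
  ranges change places.\<close>

locale normalized_preserver = operator_index scl D Op idx
  for scl :: "'f::field \<Rightarrow> 'v::ab_group_add \<Rightarrow> 'v" and D Op idx +
  fixes \<psi> :: "('v \<Rightarrow> 'v) \<Rightarrow> 'v \<Rightarrow> 'v"
  assumes psi_lin: "T \<in> Op \<Longrightarrow> lin (\<psi> T)"
    and psi_zero: "\<psi> (\<lambda>_. 0) = (\<lambda>_. 0)"
    and psi_flag: "f \<in> D \<Longrightarrow> f \<noteq> (\<lambda>_. 0) \<Longrightarrow> x \<noteq> 0 \<Longrightarrow> f x = 0 \<Longrightarrow>
      \<exists>c. c \<noteq> 0 \<and> \<psi> (rk x f) = rk (scl c x) f"
    and psi_rank_one: "f \<in> D \<Longrightarrow> f \<noteq> (\<lambda>_. 0) \<Longrightarrow> x \<noteq> 0 \<Longrightarrow>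
      \<exists>x' f'. x' \<noteq> 0 \<and> f' \<in> D \<and> f' \<noteq> (\<lambda>_. 0) \<and> \<psi> (rk x f) = rk x' f'"
    and psi_idx_1: "A \<in> Op \<Longrightarrow> B \<in> Op \<Longrightarrow> Z = (\<lambda>v. \<psi> A (\<psi> B (\<psi> A v))) \<Longrightarrow>
      (\<And>v. Z (Z v) = scl c (Z v)) \<Longrightarrow> c \<noteq> 0 \<Longrightarrow> Z \<noteq> scl c \<Longrightarrow> idx (\<lambda>v. A (B (A v))) = 1"
    and psi_idx_2: "A \<in> Op \<Longrightarrow> B \<in> Op \<Longrightarrow> Z = (\<lambda>v. \<psi> A (\<psi> B (\<psi> A v))) \<Longrightarrow>
      (\<And>v. Z (Z v) = 0) \<Longrightarrow> Z w \<noteq> 0 \<Longrightarrow> idx (\<lambda>v. A (B (A v))) = 2"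
    and psi_idx_le_2: "A \<in> Op \<Longrightarrow> B \<in> Op \<Longrightarrow> Z = (\<lambda>v. \<psi> A (\<psi> B (\<psi> A v))) \<Longrightarrow>
      (\<And>v. Z (Z (Z (Z v))) = scl c (Z (Z v))) \<Longrightarrow> c \<noteq> 0 \<Longrightarrow> idx (\<lambda>v. A (B (A v))) \<le> 2"
begin

section \<open>Zero tests that \<psi> inherits from sandwiches with rank one operators\<close>

lemma psi_add: "T \<in> Op \<Longrightarrow> \<psi> T (x + y) = \<psi> T x + \<psi> T y"
  using psi_lin unfolding lin_def by blast

lemma psi_scale: "T \<in> Op \<Longrightarrow> \<psi> T (scl c x) = scl c (\<psi> T x)"
  using psi_lin unfolding lin_def by blast

lemma psi_0: "T \<in> Op \<Longrightarrow> \<psi> T 0 = 0"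
  using psi_lin lin_0 by blast

lemma psi_minus: "T \<in> Op \<Longrightarrow> \<psi> T (- x) = - \<psi> T x"
  using psi_add[of T x "- x"] psi_0 by (simp add: eq_neg_iff_add_eq_0 add.commute)

lemma psi_diff: "T \<in> Op \<Longrightarrow> \<psi> T (x - y) = \<psi> T x - \<psi> T y"
  using psi_add[of T x "- y"] psi_minus[of T y] by simp

lemmas psi_simps = psi_add psi_scale psi_0 psi_minus psi_diff

text \<open>The image sandwich is z \<otimes> k, hence Z^2 = k(z) Z, and the cases of a zero, a
  non-nilpotent and a nilpotent \<open>Z\<close> are decided by \<open>psi_idx_1\<close> and
  \<open>psi_idx_2\<close>. \<open>k\<close> is an arbitrary homogeneous function because it arises
  from functionals composed with values of \<open>\<psi>\<close>, which are not known to stay in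
  \<open>D\<close>.\<close>

lemma psi_sandwich_idx:
  assumes A: "A \<in> Op" "B \<in> Op" and Z: "\<And>v. \<psi> A (\<psi> B (\<psi> A v)) = scl (k v) z"
    and k: "\<And>c v. k (scl c v) = c * k v"
  shows "idx (\<lambda>v. A (B (A v))) = 2 \<longleftrightarrow> k z = 0 \<and> z \<noteq> 0 \<and> k \<noteq> (\<lambda>_. 0)"
proof -
  let ?Z = "\<lambda>v. \<psi> A (\<psi> B (\<psi> A v))"
  have ZZ: "?Z (?Z v) = scl (k z) (?Z v)" for v
    unfolding Z k by (simp add: mult.commute)
  consider "z = 0 \<or> k = (\<lambda>_. 0)" | "k z \<noteq> 0" | "k z = 0" "z \<noteq> 0" "k \<noteq> (\<lambda>_. 0)" by blast
  then show ?thesis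
  proof cases
    case 1
    have "idx (\<lambda>v. A (B (A v))) = 1"
    proof (rule psi_idx_1[OF A refl])
      show "?Z (?Z v) = scl 1 (?Z v)" for v unfolding Z k using 1 by auto
      obtain x :: 'v where "x \<noteq> 0" using exists_nonzero by blast
      moreover have "?Z x = 0" unfolding Z using 1 by auto
      ultimately show "?Z \<noteq> scl 1" by (metis scale_one)
    qed simp
    with 1 show ?thesis by auto
  next
    case 2
    have "idx (\<lambda>v. A (B (A v))) = 1"
    proof (rule psi_idx_1[OF A refl ZZ 2])
      have "?Z = rk z k" unfolding Z by (simp add: rk_def)
      then show "?Z \<noteq> scl (k z)" using rk_neq_scl[OF 2] by metis
    qed
    with 2 show ?thesis by simp
  next
    case 3
    then obtain w where w: "k w \<noteq> 0" by blast
    have "idx (\<lambda>v. A (B (A v))) = 2"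
    proof (rule psi_idx_2[OF A refl])
      show "?Z (?Z v) = 0" for v unfolding ZZ using 3 by simp
      show "?Z w \<noteq> 0" unfolding Z using 3 w by simp
    qed
    with 3 show ?thesis by simp
  qed
qed

text \<open>Sandwiching \<open>T\<close> between copies of y \<otimes> g gives y \<otimes> g times
  the factor g(Ty), and the index tests this factor for zero. Letting \<open>g\<close> vary confines
  \<open>\<psi> T y\<close> to the span of \<open>y\<close> and \<open>T y\<close>, with the
  component along \<open>y\<close> still free.\<close>

lemma flag_test:
  assumes g: "g \<in> D" "g \<noteq> (\<lambda>_. 0)" "y \<noteq> 0" "g y = 0" and T: "T \<in> Op"
  shows "g (T y) = 0 \<longleftrightarrow> g (\<psi> T y) = 0"
proof -
  obtain c where c: "c \<noteq> 0" "\<psi> (rk y g) = rk (scl c y) g" using psi_flag g by blast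
  have "idx (\<lambda>v. rk y g (T (rk y g v))) = 2 \<longleftrightarrow>
      (g y * (c * (c * g (\<psi> T y))) = 0 \<and> y \<noteq> 0 \<and> (\<lambda>v. g v * (c * (c * g (\<psi> T y)))) \<noteq> (\<lambda>_. 0))"
    by (rule psi_sandwich_idx[where A = "rk y g" and B = T])
      (use g T c in \<open>simp_all add: psi_simps D_simps mult_ac\<close>)
  also have "\<dots> \<longleftrightarrow> g (\<psi> T y) \<noteq> 0"
    using g c by (auto simp: fun_eq_iff)
  finally show ?thesis using idx_test_flag[of g y T] g T by blast
qed

text \<open>For x \<otimes> f and its image x' \<otimes> f', \<open>flag_test\<close> compares the
  zeros of f(y) g(x) and f'(y) g(x') over all flags (y, g). A \<open>g\<close> that vanishes at
  \<open>x\<close> but not at \<open>x'\<close> would violate it, so the vectors are parallel, and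
  the kernels of \<open>f\<close> and \<open>f'\<close> can be compared.\<close>

lemma psi_rank_one_proportional:
  assumes f: "f \<in> D" "f \<noteq> (\<lambda>_. 0)" "x \<noteq> 0"
  shows "\<exists>c. c \<noteq> 0 \<and> \<psi> (rk x f) = rk (scl c x) f"
proof (cases "f x = 0")
  case True
  then show ?thesis using psi_flag f by blast
next
  case False
  obtain x' f' where x': "x' \<noteq> 0" "f' \<in> D" "f' \<noteq> (\<lambda>_. 0)" "\<psi> (rk x f) = rk x' f'"
    using psi_rank_one f by blast
  have test: "f y * g x = 0 \<longleftrightarrow> f' y * g x' = 0" if "g \<in> D" "g \<noteq> (\<lambda>_. 0)" "y \<noteq> 0" "g y = 0" for g y
    using flag_test[OF that rk_in_Op[OF f(1)], of x] x' that by (simp add: D_simps)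
  have "x' \<in> span {x}"
  proof (rule ccontr)
    assume *: "x' \<notin> span {x}"
    \<comment> \<open>The position of \<open>y\<close> off the plane allows \<open>g\<close> to
      vanish at \<open>x\<close> and \<open>y\<close> but not at \<open>x'\<close>. If one vector
      has the right value and another the right position, their sum has both.\<close>
    obtain y where y: "f' y \<noteq> 0" "y \<notin> span {x, x'}"
    proof -
      obtain y where y: "f' y \<noteq> 0" using x' by auto
      obtain w where w: "w \<notin> span {x, x'}" using dim_ge_3 by blast
      show thesis
      proof (cases "f' w = 0 \<and> y \<in> span {x, x'}")
        case True
        then have "f' (w + y) \<noteq> 0" "w + y \<notin> span {x, x'}"
          using y w x' by (auto simp: D_simps span_add_eq2)
        then show thesis using that by blast
      qed (use that y w in blast)
    qed
    have "x' \<notin> span {x, y}" using * y span_pair_exchange by blast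
    then obtain g where g: "g \<in> D" "g x = 0" "g y = 0" "g x' = 1" using separate2 by blast
    then show False using test[of g y] y notin_span_nonzero by fastforce
  qed
  then obtain c where c: "c \<noteq> 0" "x' = scl c x" using scale_in_span_one x' by blast
  have "f y = 0 \<Longrightarrow> f' y = 0" for y
  proof (rule ccontr)
    assume y: "f y = 0" "f' y \<noteq> 0"
    have "x \<notin> span {y}" using y False f by (auto simp: span_one D_simps)
    then obtain g where g: "g \<in> D" "g y = 0" "g x = 1" using separate1 by blast
    moreover have "g \<noteq> (\<lambda>_. 0)" using g(3) by (metis zero_neq_one)
    moreover have "y \<noteq> 0" using y x' by auto
    ultimately show False using test[of g y] y c by (simp add: D_simps)
  qed
  then obtain d where d: "f' = (\<lambda>v. d * f v)" using proportional_functionals f x' by blast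
  have "rk x' f' = rk (scl (c * d) x) f" by (simp add: fun_eq_iff c d mult_ac)
  moreover have "d \<noteq> 0" using d x' by auto
  ultimately show ?thesis using c x' by (intro exI[of _ "c * d"]) simp
qed

text \<open>Here \<open>T\<close> is the outer factor: T (x \<otimes> f) T = Tx \<otimes> (f \<circ>
  T), which has index 2 exactly when it is nonzero and nilpotent. Unlike \<open>flag_test\<close>,
  this sees the square of \<open>T\<close>.\<close>

lemma square_test:
  assumes f: "f \<in> D" "f \<noteq> (\<lambda>_. 0)" "x \<noteq> 0" and T: "T \<in> Op"
  shows "f (T (T x)) = 0 \<and> T x \<noteq> 0 \<and> (\<exists>v. f (T v) \<noteq> 0) \<longleftrightarrow>
     f (\<psi> T (\<psi> T x)) = 0 \<and> \<psi> T x \<noteq> 0 \<and> (\<exists>v. f (\<psi> T v) \<noteq> 0)"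
proof -
  obtain c where c: "c \<noteq> 0" "\<psi> (rk x f) = rk (scl c x) f" using psi_rank_one_proportional f by blast
  have "idx (\<lambda>v. T (rk x f (T v))) = 2 \<longleftrightarrow>
      (c * f (\<psi> T (\<psi> T x)) = 0 \<and> \<psi> T x \<noteq> 0 \<and> (\<lambda>v. c * f (\<psi> T v)) \<noteq> (\<lambda>_. 0))"
    by (rule psi_sandwich_idx[where A = T and B = "rk x f"])
      (use f T c in \<open>simp_all add: psi_simps D_simps mult_ac\<close>)
  moreover have "idx (\<lambda>v. T (rk x f (T v))) = 2 \<longleftrightarrow> f (T (T x)) = 0 \<and> T x \<noteq> 0 \<and> (\<exists>v. f (T v) \<noteq> 0)"
    unfolding rank_one_sandwich[OF T] by (subst idx_rk[OF D_comp[OF f(1) T]]) (auto simp: fun_eq_iff)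
  ultimately show ?thesis using c by (auto simp: fun_eq_iff)
qed

text \<open>The operators \<open>1 \<oplus> J \<oplus> 0\<close> with a nilpotent \<open>2 \<times> 2\<close> Jordan block \<open>J\<close>, which are the
  rank two probes for arbitrary operators below.\<close>

lemma psi_rank_two:
  assumes h: "h1 \<in> D" "h2 \<in> D" "h1 u1 = 1" "h1 u2 = 0" "h2 u1 = 0" "h2 u2 = 0" "u2 \<noteq> 0" "h2 z \<noteq> 0"
    and A: "A = (\<lambda>v. scl (h1 v) u1 + scl (h2 v) u2)"
  shows "\<exists>p s. p \<noteq> 0 \<and> s \<noteq> 0 \<and> (\<forall>v. \<psi> A v = scl (p * h1 v) u1 + scl (s * h2 v) u2)"
proof -
  have AOp: "A \<in> Op" unfolding A using Op_plus[OF rk_in_Op[OF h(1)] rk_in_Op[OF h(2)]] by simp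
  \<comment> \<open>\<open>e\<close> completes the Jordan picture of \<open>A\<close>: e -> u2 -> 0
    and u1 -> u1, with \<open>A\<close> zero on the common kernel of \<open>h1\<close> and
    \<open>h2\<close>.\<close>
  define e where "e = scl (inverse (h2 z)) (z - scl (h1 z) u1)"
  have e: "h1 e = 0" "h2 e = 1" using h by (simp_all add: e_def D_simps)
  have u1: "u1 \<noteq> 0" using h by auto
  have e0: "e \<noteq> 0" using e h by auto
  have A_vals: "A u1 = u1" "A u2 = 0" "A e = u2" using h e by (simp_all add: A)
  have AA: "A (A v) = scl (h1 v) u1" for v using h by (simp add: A D_simps)
  have u2_u1: "u2 \<notin> span {u1}" using h by (auto simp: span_one D_simps)
  have u1_u2: "u1 \<notin> span {u2}" using h by (auto simp: span_one D_simps)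
  obtain k where k: "k \<in> D" "k u1 = 0" "k u2 = 1" using separate1[OF u2_u1] by blast
  obtain f0 where f0: "f0 \<in> D" "f0 u2 = 0" "f0 u1 = 1" using separate1[OF u1_u2] by blast
  let ?P = "\<psi> A"
  have P: "?P (x + y) = ?P x + ?P y" "?P (scl c x) = scl c (?P x)" "?P 0 = 0" "?P (x - y) = ?P x - ?P y"
    for x y c using AOp by (simp_all add: psi_simps)
  have fA: "(\<exists>v. f (A v) \<noteq> 0) \<longleftrightarrow> f u1 \<noteq> 0 \<or> f u2 \<noteq> 0" if "f \<in> D" for f
  proof
    assume "\<exists>v. f (A v) \<noteq> 0"
    then show "f u1 \<noteq> 0 \<or> f u2 \<noteq> 0" using that by (auto simp: A D_simps)
  next
    assume "f u1 \<noteq> 0 \<or> f u2 \<noteq> 0"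
    then show "\<exists>v. f (A v) \<noteq> 0" using A_vals by metis
  qed
  have Av: "A v \<noteq> 0 \<longleftrightarrow> h1 v \<noteq> 0 \<or> h2 v \<noteq> 0" for v
    using coeffs_unique2[OF u1 u2_u1, of "h1 v" "h2 v" 0 0] by (auto simp: A)
  \<comment> \<open>Since A^2 e = 0, the test at \<open>e\<close> succeeds for every functional that
    is nonzero on the range of \<open>A\<close>. This forces \<psi>(A)^2 e = 0 and, with that known,
    determines the range of \<psi>(A).\<close>
  have test_e: "f u1 \<noteq> 0 \<or> f u2 \<noteq> 0 \<longleftrightarrow> f (?P (?P e)) = 0 \<and> ?P e \<noteq> 0 \<and> (\<exists>v. f (?P v) \<noteq> 0)"
    if "f \<in> D" "f \<noteq> (\<lambda>_. 0)" for f
    using square_test[OF that e0 AOp] fA[OF that(1)] that A_vals h by simp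
  have f0_ne: "f0 \<noteq> (\<lambda>_. 0)" using f0(3) by (metis zero_neq_one)
  have Pe: "?P e \<noteq> 0" using test_e[OF f0(1) f0_ne] f0 by simp
  have PPe: "?P (?P e) = 0"
  proof (rule ccontr)
    assume "?P (?P e) \<noteq> 0"
    then obtain f where f: "f \<in> D" "f (?P (?P e)) \<noteq> 0" using D_separates by blast
    then have "f \<noteq> (\<lambda>_. 0)" by auto
    then have "f u1 = 0" using test_e f by blast
    moreover have "(\<lambda>x. f x + f0 x) \<in> D" using f f0 D_plus by blast
    moreover have "(\<lambda>x. f x + f0 x) \<noteq> (\<lambda>_. 0)" using f0 \<open>f u1 = 0\<close> by (auto simp: fun_eq_iff intro!: exI[of _ u1])
    ultimately have "f (?P (?P e)) + f0 (?P (?P e)) = 0" using test_e[of "\<lambda>x. f x + f0 x"] f0 by auto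
    moreover have "f0 (?P (?P e)) = 0" using test_e[OF f0(1) f0_ne] f0 by simp
    ultimately show False using f by simp
  qed
  have fP: "(\<exists>v. f (?P v) \<noteq> 0) \<longleftrightarrow> f u1 \<noteq> 0 \<or> f u2 \<noteq> 0" if "f \<in> D" for f
  proof (cases "f = (\<lambda>_. 0)")
    case False
    then show ?thesis using test_e[OF that False] PPe Pe that by simp
  qed simp
  have ran: "?P v \<in> span {u1, u2}" for v
    using fP by (intro in_span_pair_if) blast
  have k_ne: "k \<noteq> (\<lambda>_. 0)" using k by auto
  \<comment> \<open>\<open>k\<close> vanishes at \<open>u1\<close>, so k \<circ> A^2 = 0 and the
    test with \<open>k\<close> can be run over all vectors; it determines the kernel of
    \<psi>(A).\<close>
  have test_k: "h1 x \<noteq> 0 \<or> h2 x \<noteq> 0 \<longleftrightarrow> k (?P (?P x)) = 0 \<and> ?P x \<noteq> 0" if "x \<noteq> 0" for x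
    using square_test[OF k(1) k_ne that AOp] fA[OF k(1)] fP[OF k(1)] k by (simp add: AA D_simps Av)
  have kPP: "k (?P (?P x)) = 0" for x
  proof (rule ccontr)
    assume *: "k (?P (?P x)) \<noteq> 0"
    then have "x \<noteq> 0" using P k by auto
    then have x: "h1 x = 0" "h2 x = 0" using test_k * by blast+
    then have "h2 (x + e) \<noteq> 0" using e h by (simp add: D_simps)
    moreover from this have "x + e \<noteq> 0" using h by auto
    ultimately have "k (?P (?P (x + e))) = 0" using test_k by blast
    then show False using * PPe k by (simp add: P D_simps)
  qed
  have P0_iff: "?P x = 0 \<longleftrightarrow> h1 x = 0 \<and> h2 x = 0" for x
    using test_k[of x] kPP P h by (cases "x = 0") auto
  have Pv: "?P v = scl (h1 v) (?P u1) + scl (h2 v) (?P e)" for v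
  proof -
    have "?P (v - (scl (h1 v) u1 + scl (h2 v) e)) = 0"
      unfolding P0_iff using h e by (simp add: D_simps)
    then show ?thesis by (simp add: P)
  qed
  \<comment> \<open>What remains are the coefficients of \<psi>(A) at \<open>u1\<close> and
    \<open>e\<close>: \<open>q\<close> vanishes by \<psi>(A)^2 e = 0, and \<open>r\<close> because
    \<open>p * r\<close> is the value of \<open>k\<close> at \<psi>(A)^2 u1 while \<open>p\<close>
    is nonzero.\<close>
  obtain p r where pr: "?P u1 = scl p u1 + scl r u2" using ran span_pair by blast
  obtain q s where qs: "?P e = scl q u1 + scl s u2" using ran span_pair by blast
  have Pu2: "?P u2 = 0" using P0_iff h by blast
  have Pu1: "?P u1 \<noteq> 0" using P0_iff h by auto
  have "scl q (?P u1) = 0" using PPe Pu2 by (simp add: qs P)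
  then have "q = 0" using Pu1 by simp
  moreover have "p * r = 0"
    using kPP[of u1] Pu2 k by (simp add: pr P D_simps)
  moreover have "p \<noteq> 0"
  proof
    assume "p = 0"
    then have "?P (?P u1) = 0" using Pu2 by (simp add: pr P)
    then have "f0 (A (A u1)) = 0"
      using square_test[OF f0(1) f0_ne u1 AOp] fP[OF f0(1)] f0 Pu1 by auto
    then show False using A_vals f0 by simp
  qed
  moreover have "s \<noteq> 0" using Pe qs \<open>q = 0\<close> by auto
  ultimately show ?thesis using Pv qs pr
    by (intro exI[of _ p] exI[of _ s]) (simp add: mult.commute)
qed

text \<open>The probe A = u1 \<otimes> h1 + u2 \<otimes> h2 has A^2 = u1 \<otimes> h1. With h1(T u1)
  = 0 the sandwich A T A is nilpotent of index 3; if h1(\<psi>(T) u1) were nonzero, the square of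
  the image sandwich would be a rank one operator that is not nilpotent, and the index would be at
  most 2. This rules out an added multiple of the identity.\<close>

lemma rank_two_test:
  assumes h: "h1 \<in> D" "h2 \<in> D" "h1 u1 = 1" "h1 u2 = 0" "h2 u1 = 0" "h2 u2 = 0" and T: "T \<in> Op"
    and T_test: "h1 (T u1) = 0" "h1 (T u2) \<noteq> 0" "h2 (T u1) \<noteq> 0"
  shows "h1 (\<psi> T u1) = 0"
proof (rule ccontr)
  assume t: "h1 (\<psi> T u1) \<noteq> 0"
  define A where "A = (\<lambda>v. scl (h1 v) u1 + scl (h2 v) u2)"
  have AOp: "A \<in> Op" unfolding A_def using Op_plus[OF rk_in_Op[OF h(1)] rk_in_Op[OF h(2)]] by simp
  have u2: "u2 \<noteq> 0" using T_test T h by auto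
  obtain p s where ps: "p \<noteq> 0" "s \<noteq> 0" "\<And>v. \<psi> A v = scl (p * h1 v) u1 + scl (s * h2 v) u2"
    using psi_rank_two[OF h u2 T_test(3) A_def] by blast
  have AA: "A (A v) = scl (h1 v) u1" for v using h by (simp add: A_def D_simps)
  let ?z = "\<psi> A (\<psi> T u1)"
  let ?k = "\<lambda>v. p * p * h1 (\<psi> T (\<psi> A v))"
  let ?Z = "\<lambda>v. \<psi> A (\<psi> T (\<psi> A v))"
  have PP: "\<psi> A (\<psi> A v) = scl (p * p * h1 v) u1" for v
    unfolding ps using h by (simp add: D_simps mult_ac)
  have ZZ: "?Z (?Z v) = scl (?k v) ?z" for v
    unfolding PP using T AOp by (simp add: psi_simps)
  \<comment> \<open>The trace of the rank one operator Z^2, nonzero under the assumption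
    \<open>t\<close>.\<close>
  have kz: "?k ?z = p * p * (p * p) * (h1 (\<psi> T u1) * h1 (\<psi> T u1))"
    unfolding PP using T h by (simp add: psi_simps D_simps mult_ac)
  have k_scale: "?k (scl c v) = c * ?k v" for c v
    using T AOp h by (simp add: psi_simps D_simps mult_ac)
  have "?Z (?Z (?Z (?Z v))) = scl (?k ?z) (?Z (?Z v))" for v
    unfolding ZZ k_scale by (simp add: mult.commute)
  then have "idx (\<lambda>v. A (T (A v))) \<le> 2"
    using psi_idx_le_2[OF AOp T refl] kz t ps(1) by (metis mult_eq_0_iff)
  moreover obtain z where z: "h2 z \<noteq> 0" using T_test by blast
  have "idx (\<lambda>v. A (T (A v))) = 3"
  proof (rule idx_cube_zero)
    show "lin (\<lambda>v. A (T (A v)))" using AOp T by (rule lin_sandwich)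
    have XX: "A (T (A (A (T (A v))))) = scl (h1 (T (A v)) * h2 (T u1)) u2" for v
      unfolding AA using T AOp h T_test by (simp add: Op_simps) (simp add: A_def)
    have Au2: "A u2 = 0" using h by (simp add: A_def)
    show "A (T (A (A (T (A (A (T (A v)))))))) = 0" for v
      unfolding XX using AOp T Au2 by (simp add: Op_simps)
    have "h1 (T (A (z - scl (h1 z) u1))) = h2 z * h1 (T u2)"
      using h T by (simp add: A_def Op_simps D_simps)
    then show "A (T (A (A (T (A (z - scl (h1 z) u1)))))) \<noteq> 0"
      unfolding XX using z T_test u2 by simp
  qed
  ultimately show False by (simp add: numeral_eq_enat)
qed

text \<open>It suffices that every \<open>f\<close> killing \<open>T x\<close> kills
  \<open>\<psi> T x\<close>. If f(x) = 0, this is \<open>flag_test\<close>; otherwise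
  \<open>f\<close> is normalised to serve as \<open>h1\<close> of a rank two probe with u1 = x.
  Eigenvectors, and among them kernel vectors, are treated separately.\<close>

lemma psi_locally_dependent:
  assumes T: "T \<in> Op" "\<not> rank_le_one T"
  shows "\<psi> T x \<in> span {T x}"
proof -
  have main: "\<psi> T x \<in> span {T x}" if Tx: "T x \<notin> span {x}" for x
  proof -
    have x0: "x \<noteq> 0" using Tx T by auto
    have Tx0: "T x \<noteq> 0" using Tx notin_span_nonzero by blast
    have test: "f (\<psi> T x) = 0" if f: "f \<in> D" "f (T x) = 0" "f (T w) \<noteq> 0" for f w
    proof (cases "f x = 0")
      case True
      have "f \<noteq> (\<lambda>_. 0)" using f by auto
      then show ?thesis using flag_test[of f x T] f T True x0 by blast
    next
      case False
      let ?h = "\<lambda>v. (1 / f x) * f v"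
      \<comment> \<open>Projection onto the kernel of \<open>f\<close> along \<open>x\<close>. As
        f(T x) = 0, it leaves the values of f \<circ> T unchanged, so the vector \<open>u\<close>
        for the probe can be found in that kernel.\<close>
      let ?pr = "\<lambda>w. w - scl (f w / f x) x"
      have pr: "f (?pr v) = 0" "f (T (?pr v)) = f (T v)" for v
        using False f T by (simp_all add: D_simps Op_simps)
      have pr': "v \<in> span {x, T x}" if "?pr v \<in> span {x, T x}" for v
      proof -
        have "scl (f v / f x) x \<in> span {x, T x}" by (simp add: span_scale span_base)
        then have "?pr v + scl (f v / f x) x \<in> span {x, T x}" using that span_add by blast
        then show ?thesis by simp
      qed
      obtain y where y: "y \<notin> span {x, T x}" using dim_ge_3 by blast
      obtain u where u: "f u = 0" "f (T u) \<noteq> 0" "u \<notin> span {x, T x}"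
      proof (cases "?pr w \<in> span {x, T x} \<and> f (T (?pr y)) = 0")
        case True
        have "?pr w + ?pr y \<notin> span {x, T x}" using True y pr' add_notin_span by blast
        moreover have "f (?pr w + ?pr y) = 0" by (simp only: D_add[OF f(1)] pr) simp
        moreover have "f (T (?pr w + ?pr y)) \<noteq> 0"
          using True pr f T by (simp only: D_add[OF f(1)] Op_add[OF T(1)]) simp
        ultimately show thesis using that by blast
      next
        case False
        then show thesis using that[of "?pr w"] that[of "?pr y"] pr f y pr' by metis
      qed
      have "T x \<notin> span {x, u}" using u Tx span_pair_exchange by blast
      then obtain h2 where h2: "h2 \<in> D" "h2 x = 0" "h2 u = 0" "h2 (T x) = 1" using separate2 by blast
      have "?h (\<psi> T x) = 0"
        by (rule rank_two_test[of ?h h2 x u T])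
          (use f h2 T u False D_cmult[OF f(1), of "1 / f x"] in simp_all)
      then show ?thesis using False by simp
    qed
    obtain v where v: "T v \<notin> span {T x}"
    proof -
      obtain u v where "T u \<noteq> 0" "T v \<notin> span {T u}" using rank_ge_two[OF T] by blast
      then show thesis using that span_one_sym Tx0 span_mono span_span
        by (metis empty_subsetI insert_subset subset_iff)
    qed
    then obtain g where g: "g \<in> D" "g (T x) = 0" "g (T v) = 1" using separate1 by blast
    show ?thesis
    proof (rule in_span_one_if)
      fix f assume f: "f \<in> D" "f (T x) = 0"
      show "f (\<psi> T x) = 0"
      proof (cases "\<exists>w. f (T w) \<noteq> 0")
        \<comment> \<open>A functional that vanishes on the whole range of \<open>T\<close> is the
          difference of f + g and \<open>g\<close>, to both of which \<open>test\<close>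
          applies.\<close>
        case False
        then have "f (\<psi> T x) + g (\<psi> T x) = 0"
          using f g by (intro test[of "\<lambda>x. f x + g x" v] D_plus) auto
        moreover have "g (\<psi> T x) = 0" using g by (intro test[of g v]) auto
        ultimately show ?thesis by simp
      qed (use f test in blast)
    qed
  qed
  have eig: "\<psi> T x \<in> span {x}" if Tx: "T x \<in> span {x}" for x
  proof (rule in_span_one_if)
    fix f assume f: "f \<in> D" "f x = 0"
    then have "f (T x) = 0" using Tx by (auto simp: span_one D_simps)
    then show "f (\<psi> T x) = 0"
      using flag_test[of f x T] f T psi_0[OF T(1)] by (cases "x = 0 \<or> f = (\<lambda>_. 0)") auto
  qed
  have ne: "\<psi> T x \<in> span {T x}" if Tx: "T x \<noteq> 0" for x
  proof (cases "T x \<in> span {x}")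
    case True
    then have "x \<in> span {T x}" using Tx span_one_sym by blast
    then show ?thesis using eig[OF True] span_mono span_span
      by (metis empty_subsetI insert_subset subset_iff)
  qed (use main in blast)
  show ?thesis
  proof (cases "T x = 0")
    case True
    obtain v where v: "T v \<notin> span {x}"
    proof -
      obtain u v where uv: "T u \<noteq> 0" "T v \<notin> span {T u}" using rank_ge_two[OF T] by blast
      show thesis
      proof (cases "T u \<in> span {x}")
        case True
        then have "x \<in> span {T u}" using uv span_one_sym by blast
        then have "T v \<notin> span {x}" using uv span_mono span_span
          by (metis empty_subsetI insert_subset subset_iff)
        then show thesis using that by blast
      qed (use that in blast)
    qed
    have Tv0: "T v \<noteq> 0" using v notin_span_nonzero by blast
    \<comment> \<open>\<open>\<psi> T x\<close> is the difference of two vectors on the line of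
      \<open>T v\<close>. It also lies on the line of \<open>x\<close>, and \<open>v\<close> was
      chosen to make these lines distinct.\<close>
    have "\<psi> T (x + v) \<in> span {T v}" using ne[of "x + v"] Tv0 True T by (simp add: Op_simps)
    moreover have "\<psi> T v \<in> span {T v}" using ne Tv0 by blast
    ultimately have "\<psi> T (x + v) - \<psi> T v \<in> span {T v}" using span_diff by blast
    then have "\<psi> T x \<in> span {T v}" using T by (simp add: psi_simps)
    moreover have "\<psi> T x \<in> span {x}" using eig True span_zero by metis
    moreover have "T v \<in> span {x}" if "\<psi> T x \<noteq> 0"
    proof -
      have "T v \<in> span {\<psi> T x}" using that calculation(1) span_one_sym by blast
      then show ?thesis using calculation(2) span_mono span_span
        by (metis empty_subsetI insert_subset subset_iff)
    qed
    ultimately have "\<psi> T x = 0" using v by blast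
    then show ?thesis by (simp add: span_zero)
  qed (use ne in blast)
qed

text \<open>In rank at least two, linear maps that are dependent at each vector are proportional, by
  comparison at \<open>x\<close>, \<open>y\<close> and \<open>x + y\<close>. A zero factor would
  contradict \<open>square_test\<close> on the data of \<open>rank_ge_two_isotropic\<close>.\<close>

theorem psi_proportional:
  assumes T: "T \<in> Op"
  shows "\<exists>a. a \<noteq> 0 \<and> (\<forall>x. \<psi> T x = scl a (T x))"
proof (cases "rank_le_one T")
  case True
  then obtain x f where f: "f \<in> D" "T = rk x f" unfolding rank_le_one_def by blast
  show ?thesis
  proof (cases "x = 0 \<or> f = (\<lambda>_. 0)")
    case True
    then have "T = (\<lambda>_. 0)" using f rk_eq_zero_iff by blast
    then show ?thesis using psi_zero by (intro exI[of _ 1]) auto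
  next
    case False
    then obtain c where "c \<noteq> 0" "\<psi> T = rk (scl c x) f" using psi_rank_one_proportional f by blast
    then show ?thesis using f by (intro exI[of _ c]) (auto simp: mult.commute)
  qed
next
  case False
  obtain u v where u: "T u \<noteq> 0" and v: "T v \<notin> span {T u}" using rank_ge_two[OF T False] by blast
  have dep: "\<exists>c. \<psi> T x = scl c (T x)" for x using psi_locally_dependent[OF T False] span_one by blast
  obtain a where a: "\<psi> T u = scl a (T u)" using dep by blast
  have same: "b = c" if "\<psi> T x = scl b (T x)" "\<psi> T y = scl c (T y)" "T x \<noteq> 0" "T y \<notin> span {T x}" for x y b c
  proof -
    obtain d where "\<psi> T (x + y) = scl d (T (x + y))" using dep by blast
    then have "scl b (T x) + scl c (T y) = scl d (T x) + scl d (T y)"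
      using that T by (simp add: psi_simps Op_simps scale_right_distrib)
    then show ?thesis using coeffs_unique2 that by metis
  qed
  have *: "\<psi> T x = scl a (T x)" for x
  proof -
    obtain b where b: "\<psi> T x = scl b (T x)" using dep by blast
    consider "T x = 0" | "T x \<notin> span {T u}" | "T x \<noteq> 0" "T x \<in> span {T u}" by blast
    then show ?thesis
    proof cases
      case 1 then show ?thesis using b by simp
    next
      case 2 then show ?thesis using same[OF a b u] b by simp
    next
      case 3
      obtain c where c: "\<psi> T v = scl c (T v)" using dep by blast
      have "T u \<in> span {T x}" using 3 span_one_sym by blast
      then have "T v \<notin> span {T x}" using v 3 span_mono span_span
        by (metis empty_subsetI insert_subset subset_iff)
      then have "b = c" using same[OF b c] 3 by blast
      moreover have "a = c" using same[OF a c u v] by blast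
      ultimately show ?thesis using b by simp
    qed
  qed
  moreover have "a \<noteq> 0"
  proof
    assume "a = 0"
    then have 0: "\<psi> T x = 0" for x using * by simp
    obtain h u w where h: "h \<in> D" "h (T w) \<noteq> 0" "T u \<noteq> 0" "h (T (T u)) = 0"
      using rank_ge_two_isotropic[OF T False] by blast
    have "h \<noteq> (\<lambda>_. 0)" "u \<noteq> 0" using h T by auto
    then show False using square_test[OF h(1) _ _ T] h 0 by blast
  qed
  ultimately show ?thesis by blast
qed

end

section \<open>Points, hyperplanes and adjacency\<close>

text \<open>The counterpart of \<open>in_span_pair_if\<close> for functionals: when neither kernel
  contains the other, \<open>t\<close> and \<open>s\<close> act as a basis dual to \<open>a\<close>
  and \<open>b\<close> and yield the coefficients.\<close>

lemma (in operator_system) in_span_pair_functionals: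
  assumes D: "a \<in> D" "b \<in> D" "w \<in> D" and ker: "\<And>v. a v = 0 \<Longrightarrow> b v = 0 \<Longrightarrow> w v = 0"
  shows "\<exists>p q. w = (\<lambda>v. p * a v + q * b v)"
proof (cases "(\<forall>v. a v = 0 \<longrightarrow> b v = 0) \<or> (\<forall>v. b v = 0 \<longrightarrow> a v = 0)")
  case True
  then consider c where "w = (\<lambda>v. c * a v)" | c where "w = (\<lambda>v. c * b v)"
    using proportional_functionals[OF D(1,3)] proportional_functionals[OF D(2,3)] ker by blast
  then show ?thesis
  proof cases
    case 1
    then show ?thesis by (intro exI[of _ c] exI[of _ 0]) simp
  next
    case 2
    then show ?thesis by (intro exI[of _ 0] exI[of _ c]) simp
  qed
next
  case False
  then obtain s t where s: "a s = 0" "b s \<noteq> 0" and t: "b t = 0" "a t \<noteq> 0" by blast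
  have "w v = w t / a t * a v + w s / b s * b v" for v
  proof -
    have "w (v - scl (b v / b s) s - scl (a v / a t) t) = 0"
      using s t D by (intro ker) (simp_all add: D_simps)
    then show ?thesis using D by (simp add: D_simps algebra_simps)
  qed
  then show ?thesis by blast
qed

context operator_system
begin

section \<open>Projective points, hyperplanes and incident pairs of them\<close>

definition vpar :: "'v \<Rightarrow> 'v \<Rightarrow> bool" where
  "vpar a b \<longleftrightarrow> (\<exists>c. c \<noteq> 0 \<and> b = scl c a)"

definition fpar :: "('v \<Rightarrow> 'f) \<Rightarrow> ('v \<Rightarrow> 'f) \<Rightarrow> bool" where
  "fpar f g \<longleftrightarrow> (\<exists>c. c \<noteq> 0 \<and> g = (\<lambda>x. c * f x))"

definition flag :: "'v \<Rightarrow> ('v \<Rightarrow> 'f) \<Rightarrow> bool" where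
  "flag y g \<longleftrightarrow> y \<noteq> 0 \<and> g \<in> D \<and> g \<noteq> (\<lambda>_. 0) \<and> g y = 0"

definition rank_one :: "('v \<Rightarrow> 'v) set" where
  "rank_one = {rk y g | y g. y \<noteq> 0 \<and> g \<in> D \<and> g \<noteq> (\<lambda>_. 0)}"

definition nilpotent_rank_one :: "('v \<Rightarrow> 'v) set" where
  "nilpotent_rank_one = {rk y g | y g. flag y g}"

lemma vpar_refl [simp]: "vpar a a"
  unfolding vpar_def by (intro exI[of _ 1]) simp

lemma vpar_sym: "vpar a b \<Longrightarrow> vpar b a"
proof -
  assume "vpar a b"
  then obtain c where "c \<noteq> 0" "b = scl c a" unfolding vpar_def by blast
  then show ?thesis unfolding vpar_def by (intro exI[of _ "inverse c"]) simp
qed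

lemma vpar_trans: "vpar a b \<Longrightarrow> vpar b c \<Longrightarrow> vpar a c"
  unfolding vpar_def by (metis no_zero_divisors scale_scale)

lemma vpar_iff: "b \<noteq> 0 \<Longrightarrow> vpar a b \<longleftrightarrow> b \<in> span {a}"
  unfolding vpar_def by (auto simp: span_one)

lemma fpar_refl [simp]: "fpar a a"
  unfolding fpar_def by (intro exI[of _ 1]) simp

lemma fpar_sym: "fpar a b \<Longrightarrow> fpar b a"
proof -
  assume "fpar a b"
  then obtain c where "c \<noteq> 0" "b = (\<lambda>x. c * a x)" unfolding fpar_def by blast
  then show ?thesis unfolding fpar_def by (intro exI[of _ "inverse c"]) (simp add: mult.assoc[symmetric])
qed

lemma fpar_trans: "fpar a b \<Longrightarrow> fpar b c \<Longrightarrow> fpar a c"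
proof -
  assume "fpar a b" "fpar b c"
  then obtain p q where "p \<noteq> 0" "b = (\<lambda>x. p * a x)" "q \<noteq> 0" "c = (\<lambda>x. q * b x)"
    unfolding fpar_def by blast
  then show ?thesis unfolding fpar_def by (intro exI[of _ "q * p"]) (simp add: mult.assoc)
qed

lemma fpar_if_kernel:
  assumes "f \<in> D" "g \<in> D" "g \<noteq> (\<lambda>_. 0)" "\<And>x. f x = 0 \<Longrightarrow> g x = 0"
  shows "fpar f g"
proof -
  obtain c where c: "g = (\<lambda>x. c * f x)" using proportional_functionals assms by blast
  then have "c \<noteq> 0" using assms by auto
  then show ?thesis using c unfolding fpar_def by blast
qed

lemma vpar_if_kernel:
  assumes "y \<noteq> 0" "\<And>f. f \<in> D \<Longrightarrow> f x = 0 \<Longrightarrow> f y = 0"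
  shows "vpar x y"
  using in_span_one_if assms vpar_iff by blast

lemma not_vparD: "\<not> vpar x y \<Longrightarrow> y \<noteq> 0 \<Longrightarrow> \<exists>f. f \<in> D \<and> f x = 0 \<and> f y \<noteq> 0"
  by (metis vpar_if_kernel)

lemma not_fparD: "\<not> fpar f g \<Longrightarrow> f \<in> D \<Longrightarrow> g \<in> D \<Longrightarrow> g \<noteq> (\<lambda>_. 0) \<Longrightarrow> \<exists>x. f x = 0 \<and> g x \<noteq> 0"
  by (metis fpar_if_kernel)

lemma vpar_zero_iff: "f \<in> D \<Longrightarrow> vpar x y \<Longrightarrow> f y = 0 \<longleftrightarrow> f x = 0"
  unfolding vpar_def by (auto simp: D_scale)

lemma fpar_zero_iff: "fpar f g \<Longrightarrow> g x = 0 \<longleftrightarrow> f x = 0"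
  unfolding fpar_def by auto

lemma flagD: "flag y g \<Longrightarrow> y \<noteq> 0" "flag y g \<Longrightarrow> g \<in> D" "flag y g \<Longrightarrow> g \<noteq> (\<lambda>_. 0)" "flag y g \<Longrightarrow> g y = 0"
  by (auto simp: flag_def)

lemma rank_one_iff: "A \<in> rank_one \<longleftrightarrow> rank_le_one A \<and> A \<noteq> (\<lambda>_. 0)"
proof
  assume "A \<in> rank_one"
  then obtain y g where "y \<noteq> 0" "g \<in> D" "g \<noteq> (\<lambda>_. 0)" "A = rk y g" unfolding rank_one_def by blast
  then show "rank_le_one A \<and> A \<noteq> (\<lambda>_. 0)"
    using rk_eq_zero_iff[of y g] unfolding rank_le_one_def by metis
next
  assume *: "rank_le_one A \<and> A \<noteq> (\<lambda>_. 0)"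
  then obtain x f where f: "f \<in> D" "A = rk x f" unfolding rank_le_one_def by blast
  then have "x \<noteq> 0" "f \<noteq> (\<lambda>_. 0)" using * rk_eq_zero_iff[of x f] by blast+
  then show "A \<in> rank_one" using f unfolding rank_one_def by blast
qed

lemma rk_in_rank_one: "y \<noteq> 0 \<Longrightarrow> g \<in> D \<Longrightarrow> g \<noteq> (\<lambda>_. 0) \<Longrightarrow> rk y g \<in> rank_one"
  unfolding rank_one_def by blast

lemma rk_eq_rk:
  assumes "rk x f = rk x' f'" "x \<noteq> 0" "f \<noteq> (\<lambda>_. 0)"
  shows "vpar x' x \<and> fpar f' f"
proof
  have eq: "scl (f v) x = scl (f' v) x'" for v using fun_cong[OF assms(1)] by simp
  obtain v where v: "f v \<noteq> 0" using assms by blast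
  have "x = scl (inverse (f v)) (scl (f v) x)" using v by simp
  also have "\<dots> = scl (inverse (f v) * f' v) x'" by (simp add: eq)
  finally show p: "vpar x' x" using assms vpar_iff span_one by blast
  then obtain c where c: "c \<noteq> 0" "x = scl c x'" unfolding vpar_def by blast
  have x': "x' \<noteq> 0" using c assms by auto
  have "scl (f v * c) x' = scl (f' v) x'" for v using eq[of v] unfolding c by simp
  then have "f v * c = f' v" for v using x' by simp
  then have "f = (\<lambda>x. inverse c * f' x)" using c by (auto simp: field_simps fun_eq_iff)
  then show "fpar f' f" using c unfolding fpar_def by (intro exI[of _ "inverse c"]) auto
qed

text \<open>The right side is written in the terms of \<open>rank_le_one_iff\<close> and
  \<open>all_sandwiches_idx_1_iff\<close>, so that invariance under the preserver can be read
  off.\<close>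

lemma nilpotent_rank_one_iff:
  "A \<in> nilpotent_rank_one \<longleftrightarrow> rank_le_one A \<and> \<not> (\<exists>x f. f \<in> D \<and> A = rk x f \<and> (f x \<noteq> 0 \<or> x = 0))"
proof
  assume "A \<in> nilpotent_rank_one"
  then obtain y g where A: "A = rk y g" and g: "flag y g" unfolding nilpotent_rank_one_def by blast
  have "f x = 0 \<and> x \<noteq> 0" if "f \<in> D" "A = rk x f" for x f
  proof -
    have *: "vpar x y" "fpar f g" using rk_eq_rk[of y g x f] that A g by (auto simp: flag_def)
    then have "f x = 0" using g that vpar_zero_iff[of f x y] fpar_zero_iff[of f g y] by (auto simp: flag_def)
    then show ?thesis using * g unfolding vpar_def flag_def by auto
  qed
  then show "rank_le_one A \<and> \<not> (\<exists>x f. f \<in> D \<and> A = rk x f \<and> (f x \<noteq> 0 \<or> x = 0))"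
    using A g unfolding rank_le_one_def flag_def by blast
next
  assume *: "rank_le_one A \<and> \<not> (\<exists>x f. f \<in> D \<and> A = rk x f \<and> (f x \<noteq> 0 \<or> x = 0))"
  then obtain x f where f: "f \<in> D" "A = rk x f" unfolding rank_le_one_def by blast
  then have x: "f x = 0" "x \<noteq> 0" using * by blast+
  have "f \<noteq> (\<lambda>_. 0)"
  proof
    assume "f = (\<lambda>_. 0)"
    then have "A = rk 0 f" using f by (auto simp: rk_def)
    then show False using * f by blast
  qed
  then show "A \<in> nilpotent_rank_one" using f x unfolding nilpotent_rank_one_def flag_def by blast
qed

text \<open>A nonzero functional that kills \<open>y\<close> and some \<open>a\<close> off the
  kernel of \<open>g\<close> exists by dimension 3: a point lies on more than one
  hyperplane.\<close>

lemma exists_nonparallel_functional: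
  assumes "flag y g" shows "\<exists>g'. flag y g' \<and> \<not> fpar g g'"
proof -
  obtain a where a: "g a \<noteq> 0" using assms by (auto simp: flag_def)
  obtain b where "b \<notin> span {y, a}" using dim_ge_3 by blast
  then obtain g' where g': "g' \<in> D" "g' y = 0" "g' a = 0" "g' b = 1" using separate2 by blast
  then have "flag y g'" using assms by (auto simp: flag_def fun_eq_iff intro!: exI[of _ b])
  moreover have "\<not> fpar g g'" using fpar_zero_iff g' a by blast
  ultimately show ?thesis by blast
qed

lemma exists_nonparallel_vector:
  assumes "flag y g" shows "\<exists>y'. flag y' g \<and> \<not> vpar y y'"
proof -
  obtain a where a: "g a \<noteq> 0" using assms by (auto simp: flag_def)
  obtain b where b: "b \<notin> span {y, a}" using dim_ge_3 by blast
  define y' where "y' = b - scl (g b / g a) a"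
  have "y' \<notin> span {y}"
  proof
    assume "y' \<in> span {y}"
    then have "y' + scl (g b / g a) a \<in> span {y, a}"
      using span_pair_mono span_add span_scale span_base by (metis insertCI)
    then show False using b by (simp add: y'_def)
  qed
  moreover from this have "y' \<noteq> 0" using notin_span_nonzero by blast
  moreover have "g y' = 0" using assms a by (simp add: y'_def D_simps flag_def)
  ultimately show ?thesis using assms vpar_iff unfolding flag_def by blast
qed

lemma exists_flag_functional: "y \<noteq> 0 \<Longrightarrow> \<exists>g. flag y g"
proof -
  assume y: "y \<noteq> 0"
  obtain b where "b \<notin> span {y}" using exists_notin_span_one by blast
  then obtain g where "g \<in> D" "g y = 0" "g b = 1" using separate1 by blast
  then show ?thesis using y by (auto simp: flag_def fun_eq_iff intro!: exI[of _ g] exI[of _ b])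
qed

lemma exists_flag_vector: "g \<in> D \<Longrightarrow> g \<noteq> (\<lambda>_. 0) \<Longrightarrow> \<exists>y. flag y g"
proof -
  assume g: "g \<in> D" "g \<noteq> (\<lambda>_. 0)"
  then obtain a where a: "g a \<noteq> 0" by blast
  obtain b where b: "b \<notin> span {a}" using exists_notin_span_one by blast
  have "b - scl (g b / g a) a \<noteq> 0" using b span_one by fastforce
  moreover have "g (b - scl (g b / g a) a) = 0" using a g by (simp add: D_simps)
  ultimately show ?thesis using g unfolding flag_def by blast
qed

end

text \<open>Akin to the fact that a group is not the union of two proper subgroups. It turns "any
  two share a point or a hyperplane" into "all share a point or all share a hyperplane".\<close>

lemma union_of_equivalences:
  assumes "\<And>a b. a \<in> A \<Longrightarrow> b \<in> A \<Longrightarrow> E a b \<or> F a b"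
    and "\<And>a b. E a b \<Longrightarrow> E b a" "\<And>a b c. E a b \<Longrightarrow> E b c \<Longrightarrow> E a c"
    and "\<And>a b. F a b \<Longrightarrow> F b a" "\<And>a b c. F a b \<Longrightarrow> F b c \<Longrightarrow> F a c"
  shows "(\<forall>a\<in>A. \<forall>b\<in>A. E a b) \<or> (\<forall>a\<in>A. \<forall>b\<in>A. F a b)"
proof (rule ccontr)
  assume "\<not> ?thesis"
  then obtain a b c d where *: "a \<in> A" "b \<in> A" "c \<in> A" "d \<in> A" "\<not> E a b" "\<not> F c d" by blast
  then have "F a b" "E c d" using assms(1) by blast+
  show False
  proof (cases "E a c")
    case True
    then have "E a d" using \<open>E c d\<close> assms by blast
    then have "F b c" "F b d" using True * assms by blast+
    then show False using * assms by blast
  next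
    case False
    then have "F a c" using * assms by blast
    have "\<not> F a d" using \<open>F a c\<close> * assms by blast
    then have "E a d" using * assms by blast
    then show False using False \<open>E c d\<close> assms by blast
  qed
qed

locale sandwich_preserver = operator_index scl D Op idx
  for scl :: "'f::field \<Rightarrow> 'v::ab_group_add \<Rightarrow> 'v" and D Op idx +
  fixes \<phi> :: "('v \<Rightarrow> 'v) \<Rightarrow> 'v \<Rightarrow> 'v"
  assumes phi_onto: "\<phi> ` Op = Op"
    and phi_idx: "A \<in> Op \<Longrightarrow> B \<in> Op \<Longrightarrow>
      idx (\<lambda>v. \<phi> A (\<phi> B (\<phi> A v))) = idx (\<lambda>v. A (B (A v)))"
begin

section \<open>Classes and relations of operators that the preserver respects\<close>

lemma phi_Op [simp]: "A \<in> Op \<Longrightarrow> \<phi> A \<in> Op"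
  using phi_onto by blast

lemma all_Op: "(\<forall>B\<in>Op. Q B) \<longleftrightarrow> (\<forall>B\<in>Op. Q (\<phi> B))"
proof -
  have "(\<forall>B\<in>\<phi> ` Op. Q B) \<longleftrightarrow> (\<forall>B\<in>Op. Q (\<phi> B))" by simp
  then show ?thesis by (simp add: phi_onto)
qed

lemma all_inner_iff: "A \<in> Op \<Longrightarrow>
  (\<forall>B\<in>Op. P (idx (\<lambda>v. \<phi> A (B (\<phi> A v))))) \<longleftrightarrow> (\<forall>B\<in>Op. P (idx (\<lambda>v. A (B (A v)))))"
  by (subst all_Op) (simp add: phi_idx)

lemma all_outer_iff: "A \<in> Op \<Longrightarrow>
  (\<forall>C\<in>Op. P (idx (\<lambda>v. C (\<phi> A (C v))))) \<longleftrightarrow> (\<forall>C\<in>Op. P (idx (\<lambda>v. C (A (C v)))))"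
  by (subst all_Op) (simp add: phi_idx)

lemma phi_rank_le_one: "A \<in> Op \<Longrightarrow> rank_le_one (\<phi> A) \<longleftrightarrow> rank_le_one A"
  using all_inner_iff[of A "\<lambda>n. n \<le> 2"] all_outer_iff[of A "\<lambda>n. n \<le> 2"]
  by (simp add: rank_le_one_iff)

lemma rank_le_one_Op: "rank_le_one A \<Longrightarrow> A \<in> Op"
  unfolding rank_le_one_def by auto

lemma phi_eq_zero_iff: "A \<in> Op \<Longrightarrow> \<phi> A = (\<lambda>_. 0) \<longleftrightarrow> A = (\<lambda>_. 0)"
proof -
  assume A: "A \<in> Op"
  have 0: "rank_le_one (\<lambda>_. 0)" unfolding rank_le_one_def using D_zero
    by (intro exI[of _ 0] exI[of _ "\<lambda>_. 0"]) (simp add: rk_def)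
  show ?thesis
    using zero_iff[of A] zero_iff[of "\<phi> A"] phi_rank_le_one[OF A] all_outer_iff[OF A, of "\<lambda>n. n = 1"] 0
    by metis
qed

lemma phi_rank_one: "A \<in> Op \<Longrightarrow> \<phi> A \<in> rank_one \<longleftrightarrow> A \<in> rank_one"
  by (simp add: rank_one_iff phi_rank_le_one phi_eq_zero_iff)

lemma phi_nilpotent_rank_one: "A \<in> Op \<Longrightarrow> \<phi> A \<in> nilpotent_rank_one \<longleftrightarrow> A \<in> nilpotent_rank_one"
  using all_sandwiches_idx_1_iff[of A] all_sandwiches_idx_1_iff[of "\<phi> A"]
    phi_rank_le_one[of A] all_inner_iff[of A "\<lambda>n. n = 1"]
  by (simp add: nilpotent_rank_one_iff)

lemma rank_one_Op: "A \<in> rank_one \<Longrightarrow> A \<in> Op"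
  by (simp add: rank_one_iff rank_le_one_Op)

lemma nilpotent_rank_one_Op: "A \<in> nilpotent_rank_one \<Longrightarrow> A \<in> Op"
  by (simp add: nilpotent_rank_one_iff rank_le_one_Op)

lemma phi_onto_rank_one: "B \<in> rank_one \<Longrightarrow> \<exists>A\<in>rank_one. B = \<phi> A"
  using phi_onto phi_rank_one rank_one_Op by (metis imageE)

lemma phi_onto_nilpotent: "B \<in> nilpotent_rank_one \<Longrightarrow> \<exists>A\<in>nilpotent_rank_one. B = \<phi> A"
  using phi_onto phi_nilpotent_rank_one nilpotent_rank_one_Op by (metis imageE)

text \<open>On a flag y \<otimes> g this means g(By) = 0. It is phrased through the index so that
  the preserver respects it by its very definition.\<close>

definition perp :: "('v \<Rightarrow> 'v) \<Rightarrow> ('v \<Rightarrow> 'v) \<Rightarrow> bool" where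
  "perp N B \<longleftrightarrow> idx (\<lambda>v. N (B (N v))) \<noteq> 2"

definition par :: "('v \<Rightarrow> 'v) \<Rightarrow> ('v \<Rightarrow> 'v) \<Rightarrow> bool" where
  "par N N' \<longleftrightarrow> (\<forall>B\<in>rank_one. perp N B \<longleftrightarrow> perp N' B)"

text \<open>Asks for a third flag on the "line" joining two flags, in terms of perpendicular sets.
  For flags that are not parallel it amounts to a common point or a common hyperplane, the third
  flag arising by adding the two entries that differ.\<close>

definition adj :: "('v \<Rightarrow> 'v) \<Rightarrow> ('v \<Rightarrow> 'v) \<Rightarrow> bool" where
  "adj N N' \<longleftrightarrow> (\<exists>M\<in>nilpotent_rank_one. \<not> par M N \<and> \<not> par M N'
     \<and> (\<forall>B\<in>rank_one. perp N B \<longrightarrow> perp N' B \<longrightarrow> perp M B))"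

lemma perp_flag: "flag y g \<Longrightarrow> B \<in> Op \<Longrightarrow> perp (rk y g) B \<longleftrightarrow> g (B y) = 0"
  unfolding perp_def using idx_test_flag[of g y B] by (auto simp: flag_def simp del: rk_apply)

lemma perp_flag_rk: "flag y g \<Longrightarrow> f \<in> D \<Longrightarrow> perp (rk y g) (rk x f) \<longleftrightarrow> g x = 0 \<or> f y = 0"
  by (auto simp: perp_flag flag_def D_scale)

lemma phi_perp: "N \<in> Op \<Longrightarrow> B \<in> Op \<Longrightarrow> perp (\<phi> N) (\<phi> B) \<longleftrightarrow> perp N B"
  by (simp add: perp_def phi_idx)

lemma phi_par: "N \<in> Op \<Longrightarrow> N' \<in> Op \<Longrightarrow> par (\<phi> N) (\<phi> N') \<longleftrightarrow> par N N'"
proof -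
  assume N: "N \<in> Op" "N' \<in> Op"
  have "par (\<phi> N) (\<phi> N') \<longleftrightarrow> (\<forall>B\<in>rank_one. perp (\<phi> N) (\<phi> B) \<longleftrightarrow> perp (\<phi> N') (\<phi> B))"
    unfolding par_def using phi_onto_rank_one phi_rank_one rank_one_Op by metis
  then show ?thesis unfolding par_def using phi_perp N rank_one_Op by auto
qed

lemma phi_adj: "N \<in> Op \<Longrightarrow> N' \<in> Op \<Longrightarrow> adj (\<phi> N) (\<phi> N') \<longleftrightarrow> adj N N'"
proof -
  assume N: "N \<in> Op" "N' \<in> Op"
  have *: "(\<forall>B\<in>rank_one. perp (\<phi> N) B \<longrightarrow> perp (\<phi> N') B \<longrightarrow> perp (\<phi> M) B)
     \<longleftrightarrow> (\<forall>B\<in>rank_one. perp N B \<longrightarrow> perp N' B \<longrightarrow> perp M B)" if "M \<in> nilpotent_rank_one" for M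
  proof -
    have "(\<forall>B\<in>rank_one. perp (\<phi> N) B \<longrightarrow> perp (\<phi> N') B \<longrightarrow> perp (\<phi> M) B)
     \<longleftrightarrow> (\<forall>B\<in>rank_one. perp (\<phi> N) (\<phi> B) \<longrightarrow> perp (\<phi> N') (\<phi> B) \<longrightarrow> perp (\<phi> M) (\<phi> B))"
      using phi_onto_rank_one phi_rank_one rank_one_Op by metis
    then show ?thesis using phi_perp N that rank_one_Op nilpotent_rank_one_Op by auto
  qed
  have "\<phi> ` nilpotent_rank_one = nilpotent_rank_one"
    using phi_onto_nilpotent phi_nilpotent_rank_one nilpotent_rank_one_Op by blast
  then have "(\<exists>M\<in>nilpotent_rank_one. Q M) \<longleftrightarrow> (\<exists>M\<in>nilpotent_rank_one. Q (\<phi> M))" for Q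
    by (metis (mono_tags, lifting) image_iff)
  then have "adj (\<phi> N) (\<phi> N') \<longleftrightarrow> (\<exists>M\<in>nilpotent_rank_one. \<not> par (\<phi> M) (\<phi> N) \<and> \<not> par (\<phi> M) (\<phi> N')
     \<and> (\<forall>B\<in>rank_one. perp (\<phi> N) B \<longrightarrow> perp (\<phi> N') B \<longrightarrow> perp (\<phi> M) B))"
    unfolding adj_def .
  then show ?thesis unfolding adj_def using * phi_par N nilpotent_rank_one_Op by auto
qed

lemma par_iff:
  assumes g: "flag y g" "flag y' g'"
  shows "par (rk y g) (rk y' g') \<longleftrightarrow> vpar y y' \<and> fpar g g'"
proof
  assume "vpar y y' \<and> fpar g g'"
  then show "par (rk y g) (rk y' g')"
    unfolding par_def rank_one_def using perp_flag_rk g vpar_zero_iff fpar_zero_iff by auto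
next
  assume p: "par (rk y g) (rk y' g')"
  have *: "g x = 0 \<or> f y = 0 \<longleftrightarrow> g' x = 0 \<or> f y' = 0" if "x \<noteq> 0" "f \<in> D" "f \<noteq> (\<lambda>_. 0)" for x f
    using p that perp_flag_rk[OF g(1)] perp_flag_rk[OF g(2)] rk_in_rank_one unfolding par_def by metis
  have "vpar y y'"
  proof (rule vpar_if_kernel)
    fix f assume f: "f \<in> D" "f y = 0"
    obtain x where "g' x \<noteq> 0" using g by (auto simp: flag_def)
    moreover from this have "x \<noteq> 0" using g by (auto simp: flag_def)
    ultimately show "f y' = 0" using *[of x f] f g by (cases "f = (\<lambda>_. 0)") (auto simp: flag_def)
  qed (use g in \<open>simp add: flag_def\<close>)
  moreover have "fpar g g'"
  proof (rule fpar_if_kernel)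
    fix x assume x: "g x = 0"
    obtain f where f: "f \<in> D" "f y' \<noteq> 0" using D_separates g by (auto simp: flag_def)
    then have "f \<noteq> (\<lambda>_. 0)" by auto
    then show "g' x = 0" using *[of x f] f g x by (cases "x = 0") (auto simp: flag_def)
  qed (use g in \<open>simp_all add: flag_def\<close>)
  ultimately show "vpar y y' \<and> fpar g g'" by blast
qed

text \<open>An operator x \<otimes> f with g(x) = 0 and f(y') = 0 is perpendicular to both flags.
  Perpendicularity to the third flag (z, h) then makes \<open>h\<close> parallel to \<open>g\<close>
  or \<open>z\<close> parallel to \<open>y'\<close>. Exchanging the roles gives a second
  alternative, and each of the four combinations is excluded.\<close>

lemma adjD:
  assumes g: "flag y g" "flag y' g'" and a: "adj (rk y g) (rk y' g')"
  shows "vpar y y' \<or> fpar g g'"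
proof (rule ccontr)
  assume n: "\<not> ?thesis"
  obtain z h where h: "flag z h" "\<not> par (rk z h) (rk y g)" "\<not> par (rk z h) (rk y' g')"
    and *: "\<And>B. B \<in> rank_one \<Longrightarrow> perp (rk y g) B \<Longrightarrow> perp (rk y' g') B \<Longrightarrow> perp (rk z h) B"
    using a unfolding adj_def nilpotent_rank_one_def by auto
  have test: "h x = 0 \<or> f z = 0" if "f \<in> D" "g x = 0 \<or> f y = 0" "g' x = 0 \<or> f y' = 0" for x f
  proof (cases "x = 0 \<or> f = (\<lambda>_. 0)")
    case True
    then show ?thesis using h by (auto simp: flag_def)
  next
    case False
    then have "rk x f \<in> rank_one" using that rk_in_rank_one by blast
    then show ?thesis using *[of "rk x f"] perp_flag_rk that g h by blast
  qed
  have "fpar g h \<or> vpar y' z"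
  proof (rule disjCI)
    assume "\<not> vpar y' z"
    then obtain f where f: "f \<in> D" "f y' = 0" "f z \<noteq> 0" using not_vparD flagD(1)[OF h(1)] by metis
    then show "fpar g h" using test[of f] h g by (intro fpar_if_kernel) (auto simp: flag_def)
  qed
  moreover have "fpar g' h \<or> vpar y z"
  proof (rule disjCI)
    assume "\<not> vpar y z"
    then obtain f where f: "f \<in> D" "f y = 0" "f z \<noteq> 0" using not_vparD flagD(1)[OF h(1)] by metis
    then show "fpar g' h" using test[of f] h g by (intro fpar_if_kernel) (auto simp: flag_def)
  qed
  moreover have "\<not> (fpar g h \<and> vpar y z)" "\<not> (fpar g' h \<and> vpar y' z)"
    using h par_iff g fpar_sym vpar_sym by blast+
  ultimately show False using n fpar_sym fpar_trans vpar_sym vpar_trans by blast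
qed

lemma adjI_vector:
  assumes g: "flag y g" "flag y' g'" and n: "\<not> par (rk y g) (rk y' g')" and p: "vpar y y'"
  shows "adj (rk y g) (rk y' g')"
proof -
  have np: "\<not> fpar g g'" using n p par_iff g by blast
  let ?h = "\<lambda>x. g x + g' x"
  have g'y: "g' y = 0" using g p vpar_zero_iff[of g' y y'] by (auto simp: flag_def)
  have nz: "g \<noteq> (\<lambda>_. 0)" "g' \<noteq> (\<lambda>_. 0)" using g by (auto simp: flag_def)
  obtain a where a: "g a = 0" "g' a \<noteq> 0" using not_fparD[OF np] g flagD by metis
  obtain b where b: "g' b = 0" "g b \<noteq> 0" using not_fparD[of g' g] np fpar_sym g flagD by metis
  have h: "flag y ?h" using g g'y a D_plus[of g g'] by (auto simp: flag_def fun_eq_iff intro!: exI[of _ a])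
  have "\<not> fpar ?h g" "\<not> fpar ?h g'"
    using fpar_zero_iff[of ?h g a] fpar_zero_iff[of ?h g' b] a b by auto
  then have "\<not> par (rk y ?h) (rk y g)" "\<not> par (rk y ?h) (rk y' g')" using par_iff[OF h] g by auto
  moreover have "rk y ?h \<in> nilpotent_rank_one" using h unfolding nilpotent_rank_one_def by blast
  moreover have "perp (rk y ?h) B" if B1: "B \<in> rank_one" "perp (rk y g) B" "perp (rk y' g') B" for B
  proof -
    obtain x f where B: "B = rk x f" "f \<in> D" using B1 unfolding rank_one_def by blast
    then show ?thesis using B1 perp_flag_rk[OF h B(2)] perp_flag_rk[OF g(1) B(2)]
      perp_flag_rk[OF g(2) B(2)] vpar_zero_iff[OF B(2) p] by auto
  qed
  ultimately show ?thesis unfolding adj_def by blast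
qed

lemma adjI_functional:
  assumes g: "flag y g" "flag y' g'" and n: "\<not> par (rk y g) (rk y' g')" and p: "fpar g g'"
  shows "adj (rk y g) (rk y' g')"
proof -
  have np: "\<not> vpar y y'" using n p par_iff g by blast
  let ?z = "y + y'"
  have gy': "g y' = 0" using g p fpar_zero_iff[of g g' y'] by (auto simp: flag_def)
  obtain a where a: "a \<in> D" "a y = 0" "a y' \<noteq> 0" using not_vparD[OF np] g flagD by metis
  obtain b where b: "b \<in> D" "b y' = 0" "b y \<noteq> 0" using not_vparD[of y' y] np vpar_sym g flagD by metis
  have "?z \<noteq> 0" using a D_add[of a y y'] by auto
  then have h: "flag ?z g" using g gy' by (auto simp: flag_def D_simps)
  have "\<not> vpar ?z y" "\<not> vpar ?z y'"
    using vpar_zero_iff[of a ?z y] vpar_zero_iff[of b ?z y'] a b by (auto simp: D_simps)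
  then have "\<not> par (rk ?z g) (rk y g)" "\<not> par (rk ?z g) (rk y' g')" using par_iff[OF h] g by auto
  moreover have "rk ?z g \<in> nilpotent_rank_one" using h unfolding nilpotent_rank_one_def by blast
  moreover have "perp (rk ?z g) B" if B1: "B \<in> rank_one" "perp (rk y g) B" "perp (rk y' g') B" for B
  proof -
    obtain x f where B: "B = rk x f" "f \<in> D" using B1 unfolding rank_one_def by blast
    then show ?thesis using B1 perp_flag_rk[OF h B(2)] perp_flag_rk[OF g(1) B(2)]
      perp_flag_rk[OF g(2) B(2)] fpar_zero_iff[OF p] by (auto simp: D_simps)
  qed
  ultimately show ?thesis unfolding adj_def by blast
qed

text \<open>Flags with a common point are pairwise parallel or adjacent, so by
  \<open>union_of_equivalences\<close> their images all share a point or all share a hyperplane;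
  likewise for flags with a common hyperplane. Nonadjacent flags couple these two choices along each
  flag, and since any two points lie in a common hyperplane, the choice is global.\<close>

lemma exists_flag_maps:
  obtains zz hh where "\<And>y g. flag y g \<Longrightarrow> flag (zz y g) (hh y g) \<and> \<phi> (rk y g) = rk (zz y g) (hh y g)"
    and "(\<forall>y g g'. flag y g \<longrightarrow> flag y g' \<longrightarrow> vpar (zz y g) (zz y g'))
        \<and> (\<forall>g y y'. flag y g \<longrightarrow> flag y' g \<longrightarrow> fpar (hh y g) (hh y' g))
      \<or> (\<forall>y g g'. flag y g \<longrightarrow> flag y g' \<longrightarrow> fpar (hh y g) (hh y g'))
        \<and> (\<forall>g y y'. flag y g \<longrightarrow> flag y' g \<longrightarrow> vpar (zz y g) (zz y' g))"
proof -
  have "\<exists>z h. flag y g \<longrightarrow> flag z h \<and> \<phi> (rk y g) = rk z h" for y g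
  proof (cases "flag y g")
    case True
    then have "rk y g \<in> nilpotent_rank_one" unfolding nilpotent_rank_one_def by blast
    then have "\<phi> (rk y g) \<in> nilpotent_rank_one" using phi_nilpotent_rank_one nilpotent_rank_one_Op by blast
    then show ?thesis unfolding nilpotent_rank_one_def by blast
  qed auto
  then obtain zz hh where zh: "\<And>y g. flag y g \<Longrightarrow> flag (zz y g) (hh y g) \<and> \<phi> (rk y g) = rk (zz y g) (hh y g)"
    by metis
  have ops: "rk y g \<in> Op" if "flag y g" for y g using that flagD rk_in_Op by blast
  have close: "vpar (zz y g) (zz y' g') \<or> fpar (hh y g) (hh y' g')"
    if "flag y g" "flag y' g'" "vpar y y' \<or> fpar g g'" for y g y' g'
  proof (cases "par (rk y g) (rk y' g')")
    case True
    then show ?thesis using zh that phi_par ops par_iff by metis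
  next
    case False
    then have "adj (rk y g) (rk y' g')" using adjI_vector adjI_functional that by blast
    then have "adj (\<phi> (rk y g)) (\<phi> (rk y' g'))" using phi_adj ops that by blast
    then show ?thesis using adjD zh that by metis
  qed
  have far: "\<not> vpar (zz y g) (zz y' g') \<and> \<not> fpar (hh y g) (hh y' g')"
    if fl: "flag y g" "flag y' g'" and n: "\<not> vpar y y'" "\<not> fpar g g'" for y g y' g'
  proof -
    have "\<not> par (rk y g) (rk y' g')" "\<not> adj (rk y g) (rk y' g')" using par_iff adjD fl n by blast+
    then have "\<not> par (rk (zz y g) (hh y g)) (rk (zz y' g') (hh y' g'))"
        "\<not> adj (rk (zz y g) (hh y g)) (rk (zz y' g') (hh y' g'))"
      using phi_par phi_adj ops fl zh by metis+
    then show ?thesis using adjI_vector adjI_functional zh fl by blast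
  qed
  define P where "P y \<longleftrightarrow> (\<forall>g g'. flag y g \<longrightarrow> flag y g' \<longrightarrow> vpar (zz y g) (zz y g'))" for y
  define P2 where "P2 y \<longleftrightarrow> (\<forall>g g'. flag y g \<longrightarrow> flag y g' \<longrightarrow> fpar (hh y g) (hh y g'))" for y
  define Q where "Q g \<longleftrightarrow> (\<forall>y y'. flag y g \<longrightarrow> flag y' g \<longrightarrow> fpar (hh y g) (hh y' g))" for g
  define Q2 where "Q2 g \<longleftrightarrow> (\<forall>y y'. flag y g \<longrightarrow> flag y' g \<longrightarrow> vpar (zz y g) (zz y' g))" for g
  have PP2: "P y \<or> P2 y" for y
  proof -
    have "(\<forall>g\<in>{g. flag y g}. \<forall>g'\<in>{g. flag y g}. vpar (zz y g) (zz y g'))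
      \<or> (\<forall>g\<in>{g. flag y g}. \<forall>g'\<in>{g. flag y g}. fpar (hh y g) (hh y g'))"
    proof (rule union_of_equivalences)
      show "vpar (zz y a) (zz y b) \<or> fpar (hh y a) (hh y b)"
        if "a \<in> {g. flag y g}" "b \<in> {g. flag y g}" for a b using close[of y a y b] that by simp
    qed (erule vpar_sym, erule (1) vpar_trans, erule fpar_sym, erule (1) fpar_trans)
    then show ?thesis unfolding P_def P2_def by blast
  qed
  have QQ2: "Q g \<or> Q2 g" for g
  proof -
    have "(\<forall>y\<in>{y. flag y g}. \<forall>y'\<in>{y. flag y g}. vpar (zz y g) (zz y' g))
      \<or> (\<forall>y\<in>{y. flag y g}. \<forall>y'\<in>{y. flag y g}. fpar (hh y g) (hh y' g))"
    proof (rule union_of_equivalences)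
      show "vpar (zz a g) (zz b g) \<or> fpar (hh a g) (hh b g)"
        if "a \<in> {y. flag y g}" "b \<in> {y. flag y g}" for a b using close[of a g b g] that by simp
    qed (erule vpar_sym, erule (1) vpar_trans, erule fpar_sym, erule (1) fpar_trans)
    then show ?thesis unfolding Q_def Q2_def by blast
  qed
  have PQ: "P y \<longleftrightarrow> Q g" if fl: "flag y g" for y g
  proof -
    obtain g' where g': "flag y g'" "\<not> fpar g g'" using exists_nonparallel_functional fl by blast
    obtain y' where y': "flag y' g" "\<not> vpar y y'" using exists_nonparallel_vector fl by blast
    \<comment> \<open>The flags (y', g) and (y, g') differ in both entries, but each shares one with
      (y, g). Mixed behaviour at \<open>y\<close> and \<open>g\<close> would make their images share
      an entry.\<close>
    have *: "\<not> vpar (zz y' g) (zz y g')" "\<not> fpar (hh y' g) (hh y g')"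
      using far[OF y'(1) g'(1)] y'(2) g'(2) vpar_sym by blast+
    have "\<not> (P y \<and> Q2 g)"
      unfolding P_def Q2_def using * fl g' y' vpar_trans by blast
    moreover have "\<not> (P2 y \<and> Q g)"
      unfolding P2_def Q_def using * fl g' y' fpar_trans by blast
    ultimately show ?thesis using PP2 QQ2 by blast
  qed
  have conn: "P y'" if "P y" "y \<noteq> 0" "y' \<noteq> 0" for y y'
  proof -
    obtain w where "w \<notin> span {y, y'}" using dim_ge_3 by blast
    then obtain k where k: "k \<in> D" "k y = 0" "k y' = 0" "k w = 1" using separate2 by blast
    have "k \<noteq> (\<lambda>_. 0)" using k(4) by (metis zero_neq_one)
    then have "flag y k" "flag y' k" using k that by (auto simp: flag_def)
    then show ?thesis using PQ that by blast
  qed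
  have "(\<forall>y. P y) \<and> (\<forall>g. Q g) \<or> (\<forall>y. P2 y) \<and> (\<forall>g. Q2 g)"
  proof (cases "\<exists>y. y \<noteq> 0 \<and> P y")
    case True
    then have "P y" if "y \<noteq> 0" for y using conn that by blast
    then have P: "P y" for y by (cases "y = 0") (auto simp: P_def flag_def)
    have "Q g" for g
    proof (cases "\<exists>y. flag y g")
      case True then show ?thesis using P PQ by blast
    qed (auto simp: Q_def)
    then show ?thesis using P by blast
  next
    case False
    then have P2: "P2 y" for y using PP2 by (cases "y = 0") (auto simp: P2_def flag_def)
    have "Q2 g" for g
    proof (cases "\<exists>y. flag y g")
      case True then show ?thesis using False PQ QQ2 flagD by blast
    qed (auto simp: Q2_def)
    then show ?thesis using P2 by blast
  qed
  then show thesis using that[of zz hh] zh unfolding P_def P2_def Q_def Q2_def by blast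
qed

end

section \<open>Semilinear form of a preserver\<close>

lemma field_automorphism_facts:
  assumes "field_automorphism \<theta>"
  shows "\<theta> (x + y) = \<theta> x + \<theta> y" "\<theta> (x * y) = \<theta> x * \<theta> y" "\<theta> 1 = 1" "\<theta> 0 = 0"
    "\<theta> x = 0 \<longleftrightarrow> x = 0" "\<theta> (inv_into UNIV \<theta> x) = x" "inv_into UNIV \<theta> (\<theta> x) = x" "inv_into UNIV \<theta> x = 0 \<longleftrightarrow> x = 0"
proof -
  have bij: "bij \<theta>" and add: "\<And>x y. \<theta> (x + y) = \<theta> x + \<theta> y"
    using assms by (auto simp: field_automorphism_def)
  show "\<theta> (x + y) = \<theta> x + \<theta> y" "\<theta> (x * y) = \<theta> x * \<theta> y" "\<theta> 1 = 1"
    using assms by (auto simp: field_automorphism_def)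
  show 0: "\<theta> 0 = 0" using add[of 0 0] by (metis add_0 add_cancel_right_right)
  show "\<theta> x = 0 \<longleftrightarrow> x = 0" using 0 bij by (metis bij_def injD)
  show i: "\<theta> (inv_into UNIV \<theta> x) = x" "inv_into UNIV \<theta> (\<theta> x) = x" for x
    using bij by (simp_all add: bij_is_surj surj_f_inv_f bij_is_inj)
  show "inv_into UNIV \<theta> x = 0 \<longleftrightarrow> x = 0" using 0 i by metis
qed

lemma field_automorphism_inv:
  assumes "field_automorphism \<theta>" shows "field_automorphism (inv_into UNIV \<theta>)"
proof -
  note F = field_automorphism_facts[OF assms]
  have "inv_into UNIV \<theta> (x + y) = inv_into UNIV \<theta> x + inv_into UNIV \<theta> y" "inv_into UNIV \<theta> (x * y) = inv_into UNIV \<theta> x * inv_into UNIV \<theta> y" for x y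
    using F(1)[of "inv_into UNIV \<theta> x" "inv_into UNIV \<theta> y"] F(2)[of "inv_into UNIV \<theta> x" "inv_into UNIV \<theta> y"] F(6,7) by metis+
  moreover have "inv_into UNIV \<theta> 1 = 1" using F(3,7) by metis
  moreover have "bij (inv_into UNIV \<theta>)" using assms by (simp add: field_automorphism_def bij_imp_bij_inv)
  ultimately show ?thesis unfolding field_automorphism_def by blast
qed

text \<open>Serves points to points and points to hyperplanes alike: \<open>pr w g\<close> pairs an
  image vector \<open>w\<close> with the image of the hyperplane of \<open>g\<close>, by evaluating
  a functional at a vector in one order or the other. The last conjunct holds because y \<mapsto> pr
  (S y) g and \<theta> \<circ> g are semilinear with the same kernel.\<close>

lemma (in operator_system) semilinear_representation:
  fixes s2 :: "'f \<Rightarrow> 'w::ab_group_add \<Rightarrow> 'w" and \<sigma> :: "'v \<Rightarrow> 'w" and pr :: "'w \<Rightarrow> ('v \<Rightarrow> 'f) \<Rightarrow> 'f"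
  assumes vs: "vector_space s2"
    and pr_add: "\<And>g a b. g \<in> D \<Longrightarrow> g \<noteq> (\<lambda>_. 0) \<Longrightarrow> pr (a + b) g = pr a g + pr b g"
    and pr_scale: "\<And>g c a. g \<in> D \<Longrightarrow> g \<noteq> (\<lambda>_. 0) \<Longrightarrow> pr (s2 c a) g = c * pr a g"
    and nonzero: "\<And>y. y \<noteq> 0 \<Longrightarrow> \<sigma> y \<noteq> 0"
    and inc: "\<And>y g. y \<noteq> 0 \<Longrightarrow> g \<in> D \<Longrightarrow> g \<noteq> (\<lambda>_. 0) \<Longrightarrow> g y = 0 \<longleftrightarrow> pr (\<sigma> y) g = 0"
    and sp: "\<And>x y z. x \<noteq> 0 \<Longrightarrow> y \<noteq> 0 \<Longrightarrow> z \<noteq> 0 \<Longrightarrow>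
      (\<And>g. g \<in> D \<Longrightarrow> g \<noteq> (\<lambda>_. 0) \<Longrightarrow> pr (\<sigma> x) g = 0 \<Longrightarrow> pr (\<sigma> y) g = 0 \<Longrightarrow> pr (\<sigma> z) g = 0) \<Longrightarrow>
      \<exists>p q. \<sigma> z = s2 p (\<sigma> x) + s2 q (\<sigma> y)"
    and onto: "\<And>x y w p q. x \<noteq> 0 \<Longrightarrow> y \<noteq> 0 \<Longrightarrow> w \<noteq> 0 \<Longrightarrow> w = s2 p (\<sigma> x) + s2 q (\<sigma> y) \<Longrightarrow>
      \<exists>z c. z \<noteq> 0 \<and> w = s2 c (\<sigma> z)"
  shows "\<exists>S \<theta>. (\<forall>x y. S (x + y) = S x + S y) \<and> (\<forall>c x. S (scl c x) = s2 (\<theta> c) (S x))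
    \<and> (\<forall>x. x \<noteq> 0 \<longrightarrow> S x \<noteq> 0 \<and> (\<exists>c. c \<noteq> 0 \<and> S x = s2 c (\<sigma> x))) \<and> field_automorphism \<theta>
    \<and> (\<forall>g\<in>D. g \<noteq> (\<lambda>_. 0) \<longrightarrow> (\<exists>c. c \<noteq> 0 \<and> (\<forall>y. pr (S y) g = c * \<theta> (g y))))"
proof -
  interpret W: vector_space s2 by (rule vs)
  interpret collineation scl s2 \<sigma>
  proof (unfold_locales, goal_cases)
    case (1 x)
    then show ?case by (rule nonzero)
  next
    case (2 x y z)
    show ?case
    proof
      assume z: "z \<in> span {x, y}"
      have "pr (\<sigma> z) g = 0" if "g \<in> D" "g \<noteq> (\<lambda>_. 0)" "pr (\<sigma> x) g = 0" "pr (\<sigma> y) g = 0" for g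
      proof -
        have "g x = 0" "g y = 0" using inc that 2 by blast+
        then have "g z = 0" using D_kills_span[OF that(1) _ z] by blast
        then show ?thesis using inc that 2 by blast
      qed
      then show "\<sigma> z \<in> W.span {\<sigma> x, \<sigma> y}" using sp[OF 2] W.span_pair by blast
    next
      assume "\<sigma> z \<in> W.span {\<sigma> x, \<sigma> y}"
      then obtain p q where pq: "\<sigma> z = s2 p (\<sigma> x) + s2 q (\<sigma> y)" using W.span_pair by blast
      show "z \<in> span {x, y}"
      proof (rule in_span_pair_if)
        fix g assume g: "g \<in> D" "g x = 0" "g y = 0"
        show "g z = 0"
        proof (cases "g = (\<lambda>_. 0)")
          case False
          then have "pr (\<sigma> z) g = 0" using g inc 2 by (simp add: pq pr_add pr_scale)
          then show ?thesis using inc g False 2 by blast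
        qed simp
      qed
    qed
  next
    case (3 x y w)
    then obtain p q where "w = s2 p (\<sigma> x) + s2 q (\<sigma> y)" using W.span_pair by blast
    then obtain z c where "z \<noteq> 0" "w = s2 c (\<sigma> z)" using onto 3 by blast
    then show ?case using W.span_one by blast
  next
    case (4 x y)
    then show ?case by (rule dim_ge_3)
  qed
  obtain S \<theta> where S: "\<And>x y. S (x + y) = S x + S y" "\<And>c x. S (scl c x) = s2 (\<theta> c) (S x)"
    "\<And>x. x \<noteq> 0 \<Longrightarrow> S x \<noteq> 0" "\<And>x. x \<noteq> 0 \<Longrightarrow> S x \<in> W.span {\<sigma> x}" and aut: "field_automorphism \<theta>"
    using fundamental_theorem by blast
  note F = field_automorphism_facts[OF aut]
  have S_\<sigma>: "\<exists>c. c \<noteq> 0 \<and> S x = s2 c (\<sigma> x)" if "x \<noteq> 0" for x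
    using W.scale_in_span_one S(3,4) that by blast
  have "\<exists>c. c \<noteq> 0 \<and> (\<forall>y. pr (S y) g = c * \<theta> (g y))" if g: "g \<in> D" "g \<noteq> (\<lambda>_. 0)" for g
  proof -
    obtain y0 where y0: "g y0 \<noteq> 0" using g by blast
    have pr0: "pr 0 g = 0" using pr_scale[OF g, of 0 0] by simp
    have ker: "pr (S y) g = 0 \<longleftrightarrow> g y = 0" for y
    proof (cases "y = 0")
      case True
      have "S 0 = 0" using S(1)[of 0 0] by simp
      then show ?thesis using True pr0 g by simp
    next
      case False
      then obtain c where "c \<noteq> 0" "S y = s2 c (\<sigma> y)" using S_\<sigma> by blast
      then show ?thesis using inc[OF False g] pr_scale[OF g] by simp
    qed
    \<comment> \<open>Normalised to g(y1) = 1, so that y - g(y) y1 lies in the kernel of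
      \<open>g\<close> and \<open>pr (S y1) g\<close> is the constant sought.\<close>
    define y1 where "y1 = scl (1 / g y0) y0"
    have y1: "g y1 = 1" using y0 g by (simp add: y1_def D_scale)
    have "pr (S y) g = pr (S y1) g * \<theta> (g y)" for y
    proof -
      have "pr (S (y - scl (g y) y1)) g = 0" unfolding ker using y1 g by (simp add: D_simps)
      moreover have "S y = S (y - scl (g y) y1) + s2 (\<theta> (g y)) (S y1)"
        using S(1)[of "y - scl (g y) y1" "scl (g y) y1"] S(2) by simp
      ultimately show ?thesis using pr_add[OF g] pr_scale[OF g] by (metis add_0 mult.commute)
    qed
    moreover have "pr (S y1) g \<noteq> 0" unfolding ker using y1 by simp
    ultimately show ?thesis by blast
  qed
  then have "\<forall>g\<in>D. g \<noteq> (\<lambda>_. 0) \<longrightarrow> (\<exists>c. c \<noteq> 0 \<and> (\<forall>y. pr (S y) g = c * \<theta> (g y)))" by blast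
  moreover have "\<forall>x. x \<noteq> 0 \<longrightarrow> S x \<noteq> 0 \<and> (\<exists>c. c \<noteq> 0 \<and> S x = s2 c (\<sigma> x))" using S(3) S_\<sigma> by blast
  moreover have "\<forall>x y. S (x + y) = S x + S y" "\<forall>c x. S (scl c x) = s2 (\<theta> c) (S x)"
    using S(1,2) by blast+
  ultimately show ?thesis using aut by (intro exI[of _ S] exI[of _ \<theta>] conjI)
qed

context operator_system
begin

text \<open>Besides the shape of \<phi> it records that conjugation by \<open>S\<close> and
  \<open>\<theta>\<close> carries \<open>D\<close> into \<open>D\<close> in both directions. When
  \<open>D\<close> consists of the bounded functionals, this is the form in which continuity is
  retained and from which boundedness of \<open>S\<close> is recovered.\<close>

definition point_form :: "(('v \<Rightarrow> 'v) \<Rightarrow> 'v \<Rightarrow> 'v) \<Rightarrow> ('v \<Rightarrow> 'v) \<Rightarrow> ('f \<Rightarrow> 'f) \<Rightarrow> bool" where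
  "point_form \<phi> S \<theta> \<longleftrightarrow> field_automorphism \<theta> \<and> bij S \<and> (\<forall>x y. S (x + y) = S x + S y)
    \<and> (\<forall>c x. S (scl c x) = scl (\<theta> c) (S x))
    \<and> (\<forall>f\<in>D. (\<lambda>z. \<theta> (f (inv_into UNIV S z))) \<in> D) \<and> (\<forall>f\<in>D. (\<lambda>x. inv_into UNIV \<theta> (f (S x))) \<in> D)
    \<and> (\<forall>T\<in>Op. \<exists>a. a \<noteq> 0 \<and> (\<forall>x. \<phi> T (S x) = scl a (S (T x))))"

text \<open>\<open>S\<close> sends vectors to functionals, \<open>A\<close> sends functionals back
  to vectors, and the two are adjoint up to \<open>\<theta>\<close>; so \<phi>(T) is conjugate under
  \<open>A\<close> to a multiple of the transpose of \<open>T\<close>.\<close>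

definition hyperplane_form ::
    "(('v \<Rightarrow> 'v) \<Rightarrow> 'v \<Rightarrow> 'v) \<Rightarrow> ('v \<Rightarrow> 'v \<Rightarrow> 'f) \<Rightarrow> (('v \<Rightarrow> 'f) \<Rightarrow> 'v) \<Rightarrow> ('f \<Rightarrow> 'f) \<Rightarrow> bool" where
  "hyperplane_form \<phi> S A \<theta> \<longleftrightarrow> field_automorphism \<theta> \<and> bij_betw S UNIV D \<and> bij_betw A D UNIV
    \<and> (\<forall>x. \<forall>f\<in>D. S x (A f) = \<theta> (f x))
    \<and> (\<forall>T\<in>Op. \<exists>a. a \<noteq> 0 \<and> (\<forall>f\<in>D. \<phi> T (A f) = scl a (A (\<lambda>x. f (T x)))))"

end

context sandwich_preserver
begin

lemma flag_maps_incidence: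
  assumes zh: "\<And>y g. flag y g \<Longrightarrow> flag (zz y g) (hh y g) \<and> \<phi> (rk y g) = rk (zz y g) (hh y g)"
    and fl: "flag x g" "flag y f"
  shows "hh x g (zz y f) = 0 \<or> hh y f (zz x g) = 0 \<longleftrightarrow> g y = 0 \<or> f x = 0"
proof -
  have "perp (rk (zz x g) (hh x g)) (rk (zz y f) (hh y f)) \<longleftrightarrow> perp (rk x g) (rk y f)"
    using phi_perp[of "rk x g" "rk y f"] zh fl flagD rk_in_Op by metis
  then show ?thesis using perp_flag_rk zh fl flagD by metis
qed

lemma flag_maps_onto:
  assumes zh: "\<And>y g. flag y g \<Longrightarrow> flag (zz y g) (hh y g) \<and> \<phi> (rk y g) = rk (zz y g) (hh y g)"
    and fl: "flag w h"
  shows "\<exists>y g. flag y g \<and> vpar (zz y g) w \<and> fpar (hh y g) h"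
proof -
  have "rk w h \<in> nilpotent_rank_one" using fl unfolding nilpotent_rank_one_def by blast
  then obtain A where "A \<in> nilpotent_rank_one" "rk w h = \<phi> A" using phi_onto_nilpotent by blast
  then obtain y g where y: "flag y g" "rk w h = \<phi> (rk y g)" unfolding nilpotent_rank_one_def by blast
  then have "rk w h = rk (zz y g) (hh y g)" using zh by simp
  then show ?thesis using rk_eq_rk[OF _ flagD(1,3)[OF fl]] y by blast
qed

text \<open>A nonincident pair (y, g) does not come from a nilpotent operator itself. Its
  nonincidence is witnessed by two flags (x, g) and (y, f) that are not perpendicular.\<close>

lemma flag_maps_nonincident:
  assumes g: "g \<in> D" "g y \<noteq> 0"
  shows "\<exists>x f. flag x g \<and> flag y f \<and> f x \<noteq> 0"
proof -
  have g0: "g \<noteq> (\<lambda>_. 0)" and y0: "y \<noteq> 0" using g by auto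
  obtain x where x: "flag x g" using exists_flag_vector g g0 by blast
  have "x \<notin> span {y}"
  proof
    assume "x \<in> span {y}"
    then have "vpar y x" using x vpar_iff by (auto simp: flag_def)
    then show False using vpar_zero_iff[OF g(1)] x g by (auto simp: flag_def)
  qed
  then obtain f where f: "f \<in> D" "f y = 0" "f x = 1" using separate1 by blast
  then have "f \<noteq> (\<lambda>_. 0)" by (metis zero_neq_one)
  then show ?thesis using f x y0 by (intro exI[of _ x] exI[of _ f]) (auto simp: flag_def)
qed

text \<open>Images of points and of hyperplanes depend, up to scalars, only on the point and on the
  hyperplane, so \<open>\<sigma>\<close> and \<open>\<tau>\<close> respect incidence and
  \<open>\<sigma>\<close> is a collineation. Conjugation by the resulting \<open>S\<close> gives a
  map \<open>\<psi>\<close> that fixes nilpotent rank one operators up to scalars.\<close>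

lemma point_case:
  assumes zh: "\<And>y g. flag y g \<Longrightarrow> flag (zz y g) (hh y g) \<and> \<phi> (rk y g) = rk (zz y g) (hh y g)"
    and z_const: "\<And>y g g'. flag y g \<Longrightarrow> flag y g' \<Longrightarrow> vpar (zz y g) (zz y g')"
    and h_const: "\<And>g y y'. flag y g \<Longrightarrow> flag y' g \<Longrightarrow> fpar (hh y g) (hh y' g)"
  shows "\<exists>S \<theta>. point_form \<phi> S \<theta>"
proof -
  define \<sigma> where "\<sigma> y = zz y (SOME g. flag y g)" for y
  define \<tau> where "\<tau> g = hh (SOME y. flag y g) g" for g
  have \<sigma>: "vpar (\<sigma> y) (zz y g)" if "flag y g" for y g
    unfolding \<sigma>_def by (rule z_const[OF someI[of "flag y", OF that] that])
  have \<tau>: "fpar (\<tau> g) (hh y g)" if "flag y g" for y g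
    unfolding \<tau>_def by (rule h_const[OF someI[of "\<lambda>y. flag y g", OF that] that])
  have \<sigma>0: "\<sigma> y \<noteq> 0" if "y \<noteq> 0" for y
  proof -
    obtain g where "flag y g" using exists_flag_functional \<open>y \<noteq> 0\<close> by blast
    then show ?thesis using \<sigma> zh flagD(1) unfolding vpar_def by fastforce
  qed
  have \<tau>D: "\<tau> g \<in> D" "\<tau> g \<noteq> (\<lambda>_. 0)" if g: "g \<in> D" "g \<noteq> (\<lambda>_. 0)" for g
  proof -
    obtain y where y: "flag y g" using exists_flag_vector g by blast
    then have "flag ((\<lambda>y. zz y g) (SOME y. flag y g)) (\<tau> g)"
      unfolding \<tau>_def using zh[OF someI[of "\<lambda>y. flag y g", OF y]] by simp
    then show "\<tau> g \<in> D" "\<tau> g \<noteq> (\<lambda>_. 0)" using flagD by blast+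
  qed
  have inc: "g y = 0 \<longleftrightarrow> \<tau> g (\<sigma> y) = 0" if y: "y \<noteq> 0" and g: "g \<in> D" "g \<noteq> (\<lambda>_. 0)" for y g
  proof
    assume "g y = 0"
    then have fl: "flag y g" using y g by (simp add: flag_def)
    then have "hh y g (zz y g) = 0" using zh flagD by blast
    then show "\<tau> g (\<sigma> y) = 0"
      using fpar_zero_iff[OF \<tau>[OF fl]] vpar_zero_iff[OF \<tau>D(1)[OF g] \<sigma>[OF fl]] by simp
  next
    assume *: "\<tau> g (\<sigma> y) = 0"
    show "g y = 0"
    proof (rule ccontr)
      assume gy: "g y \<noteq> 0"
      then obtain x f where xf: "flag x g" "flag y f" "f x \<noteq> 0" using flag_maps_nonincident g by blast
      then have "hh x g (zz y f) \<noteq> 0" using flag_maps_incidence[OF zh xf(1,2)] gy by blast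
      then show False
        using * fpar_zero_iff[OF \<tau>[OF xf(1)]] vpar_zero_iff[OF \<tau>D(1)[OF g] \<sigma>[OF xf(2)]] by simp
    qed
  qed
  have \<sigma>_onto: "\<exists>z c. z \<noteq> 0 \<and> w = scl c (\<sigma> z)" if w: "w \<noteq> 0" for w
  proof -
    obtain h where "flag w h" using exists_flag_functional w by blast
    then obtain y g where "flag y g" "vpar (zz y g) w" using flag_maps_onto[OF zh] by blast
    then have "vpar (\<sigma> y) w" "y \<noteq> 0" using \<sigma> vpar_trans flagD by blast+
    then show ?thesis unfolding vpar_def by blast
  qed
  have \<tau>_onto: "\<exists>g. g \<in> D \<and> g \<noteq> (\<lambda>_. 0) \<and> fpar (\<tau> g) h" if h: "h \<in> D" "h \<noteq> (\<lambda>_. 0)" for h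
  proof -
    obtain w where "flag w h" using exists_flag_vector h by blast
    then obtain y g where "flag y g" "fpar (hh y g) h" using flag_maps_onto[OF zh] by blast
    then have "fpar (\<tau> g) h" "g \<in> D" "g \<noteq> (\<lambda>_. 0)" using \<tau> fpar_trans flagD by blast+
    then show ?thesis by blast
  qed
  have sp: "\<exists>p q. \<sigma> z = scl p (\<sigma> x) + scl q (\<sigma> y)"
    if *: "\<And>g. g \<in> D \<Longrightarrow> g \<noteq> (\<lambda>_. 0) \<Longrightarrow> \<tau> g (\<sigma> x) = 0 \<Longrightarrow> \<tau> g (\<sigma> y) = 0 \<Longrightarrow> \<tau> g (\<sigma> z) = 0" for x y z
  proof -
    have "\<sigma> z \<in> span {\<sigma> x, \<sigma> y}"
    proof (rule in_span_pair_if)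
      fix h assume h: "h \<in> D" "h (\<sigma> x) = 0" "h (\<sigma> y) = 0"
      show "h (\<sigma> z) = 0"
      proof (cases "h = (\<lambda>_. 0)")
        case False
        then obtain g where "g \<in> D" "g \<noteq> (\<lambda>_. 0)" "fpar (\<tau> g) h" using \<tau>_onto h by blast
        then show ?thesis using *[of g] fpar_zero_iff[of "\<tau> g" h] h by blast
      qed simp
    qed
    then show ?thesis using span_pair by blast
  qed
  let ?C = "\<lambda>S \<theta>. (\<forall>x y. S (x + y) = S x + S y) \<and> (\<forall>c x. S (scl c x) = scl (\<theta> c) (S x))
    \<and> (\<forall>x. x \<noteq> 0 \<longrightarrow> S x \<noteq> 0 \<and> (\<exists>c. c \<noteq> 0 \<and> S x = scl c (\<sigma> x))) \<and> field_automorphism \<theta>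
    \<and> (\<forall>g\<in>D. g \<noteq> (\<lambda>_. 0) \<longrightarrow> (\<exists>c. c \<noteq> 0 \<and> (\<forall>y. \<tau> g (S y) = c * \<theta> (g y))))"
  have "\<exists>S \<theta>. ?C S \<theta>"
    by (rule semilinear_representation[where pr = "\<lambda>w g. \<tau> g w" and \<sigma> = \<sigma>,
          OF vector_space_axioms D_add[OF \<tau>D(1)] D_scale[OF \<tau>D(1)] \<sigma>0 inc sp \<sigma>_onto])
  then obtain S \<theta> where H: "?C S \<theta>" by (elim exE)
  note S_add = H[THEN conjunct1, rule_format]
    and S_scale = H[THEN conjunct2, THEN conjunct1, rule_format]
    and S = H[THEN conjunct2, THEN conjunct2, THEN conjunct1, rule_format]
    and aut = H[THEN conjunct2, THEN conjunct2, THEN conjunct2, THEN conjunct1]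
    and S_\<tau> = H[THEN conjunct2, THEN conjunct2, THEN conjunct2, THEN conjunct2, rule_format]
  note F = field_automorphism_facts[OF aut]
  note Fi = field_automorphism_facts[OF field_automorphism_inv[OF aut]]
  have S0: "S 0 = 0" using S_add[of 0 0] by simp
  have S_diff: "S (x - y) = S x - S y" for x y using S_add[of "x - y" y] by simp
  have injS: "inj S"
  proof (rule injI)
    fix x y assume "S x = S y"
    then have "S (x - y) = 0" by (simp add: S_diff)
    then show "x = y" using S[of "x - y"] by auto
  qed
  have "\<exists>x. w = S x" for w
  proof (cases "w = 0")
    case False
    then obtain z c where z: "z \<noteq> 0" "w = scl c (\<sigma> z)" using \<sigma>_onto by blast
    then obtain d where "d \<noteq> 0" "S z = scl d (\<sigma> z)" using S by blast
    then have "w = S (scl (inv_into UNIV \<theta> (c / d)) z)" using z by (simp add: S_scale F)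
    then show ?thesis by blast
  qed (use S0 in metis)
  then have surjS: "surj S" by (auto simp: surj_def)
  define Si where "Si = inv_into UNIV S"
  have Si [simp]: "S (Si x) = x" "Si (S x) = x" for x
    using injS surjS by (simp_all add: Si_def surj_f_inv_f)
  have Si_add: "Si (x + y) = Si x + Si y" for x y using S_add Si by metis
  have Si_scale: "Si (scl c x) = scl (inv_into UNIV \<theta> c) (Si x)" for c x
    using S_scale[of "inv_into UNIV \<theta> c" "Si x"] Si F by metis
  have Si0: "Si 0 = 0" using S0 Si by metis
  \<comment> \<open>For nonzero \<open>g\<close> the functional \<theta> \<circ> g \<circ> S^-1 is a
    multiple of \<open>\<tau> g\<close>, which lies in \<open>D\<close>.\<close>
  have B_in: "(\<lambda>z. \<theta> (g (Si z))) \<in> D" if g: "g \<in> D" for g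
  proof (cases "g = (\<lambda>_. 0)")
    case True
    then show ?thesis using D_zero by (simp add: F(4))
  next
    case False
    then obtain c where c: "c \<noteq> 0" "\<And>y. \<tau> g (S y) = c * \<theta> (g y)" using S_\<tau> g by blast
    have "\<theta> (g (Si z)) = 1 / c * \<tau> g z" for z using c(2)[of "Si z"] c(1) by simp
    then show ?thesis using D_cmult[OF \<tau>D(1)[OF g False], of "1 / c"] by presburger
  qed
  have B_out: "(\<lambda>x. inv_into UNIV \<theta> (h (S x))) \<in> D" if h: "h \<in> D" for h
  proof (cases "h = (\<lambda>_. 0)")
    case True
    then show ?thesis using D_zero by (simp add: Fi(4))
  next
    case False
    then obtain g where g: "g \<in> D" "g \<noteq> (\<lambda>_. 0)" "fpar (\<tau> g) h" using \<tau>_onto h by blast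
    then obtain c where c: "\<And>y. \<tau> g (S y) = c * \<theta> (g y)" using S_\<tau> by blast
    obtain d where d: "h = (\<lambda>x. d * \<tau> g x)" using g unfolding fpar_def by blast
    have "inv_into UNIV \<theta> (h (S x)) = inv_into UNIV \<theta> (d * c) * g x" for x by (simp add: d c Fi(2) F(7) mult.assoc[symmetric])
    then show ?thesis using D_cmult[OF g(1)] by presburger
  qed
  define \<psi> where "\<psi> T = (\<lambda>x. Si (\<phi> T (S x)))" for T
  have transport: "\<phi> A (\<phi> B (\<phi> A w)) = S (\<psi> A (\<psi> B (\<psi> A (Si w))))" for A B w
    by (simp add: \<psi>_def)
  interpret normalized_preserver scl D Op idx \<psi>
  proof (unfold_locales, goal_cases)
    case (1 T)
    then show ?case unfolding lin_def \<psi>_def using phi_Op[OF 1]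
      by (simp add: S_add Si_add S_scale Si_scale Op_simps F)
  next
    case 2
    have "\<phi> (\<lambda>_. 0) = (\<lambda>_. 0)" using phi_eq_zero_iff zero_in_Op by blast
    then show ?case by (simp add: \<psi>_def Si0)
  next
    case (3 f x)
    then have fl: "flag x f" by (simp add: flag_def)
    then have e: "\<phi> (rk x f) = rk (zz x f) (hh x f)" using zh by blast
    obtain p where p: "p \<noteq> 0" "zz x f = scl p (\<sigma> x)" using \<sigma>[OF fl] unfolding vpar_def by blast
    obtain q where q: "q \<noteq> 0" "S x = scl q (\<sigma> x)" using S 3 by blast
    obtain r where r: "r \<noteq> 0" "hh x f = (\<lambda>v. r * \<tau> f v)" using \<tau>[OF fl] unfolding fpar_def by blast
    obtain s where s: "s \<noteq> 0" "\<And>y. \<tau> f (S y) = s * \<theta> (f y)" using S_\<tau> 3 by blast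
    have sx: "\<sigma> x = scl (1 / q) (S x)" using q by simp
    have "\<phi> (rk x f) (S y) = scl ((p * (1 / q) * r * s) * \<theta> (f y)) (S x)" for y
      by (simp add: e p(2) sx r(2) s(2) mult_ac)
    then have "\<psi> (rk x f) = rk (scl (inv_into UNIV \<theta> (p * (1 / q) * r * s)) x) f"
      by (intro ext) (simp only: \<psi>_def Si_scale Fi(2) F(7) Si rk_apply scale_scale mult.commute)
    moreover have "inv_into UNIV \<theta> (p * (1 / q) * r * s) \<noteq> 0" using p q r s F(8) by simp
    ultimately show ?case by blast
  next
    case (4 f x)
    then have "rk x f \<in> rank_one" using rk_in_rank_one by blast
    then have "\<phi> (rk x f) \<in> rank_one" using phi_rank_one rank_one_Op by blast
    then obtain z h where z: "z \<noteq> 0" "h \<in> D" "h \<noteq> (\<lambda>_. 0)" "\<phi> (rk x f) = rk z h"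
      unfolding rank_one_def by blast
    obtain v where "h v \<noteq> 0" using z by blast
    then have "inv_into UNIV \<theta> (h (S (Si v))) \<noteq> 0" using F(8) by simp
    then have "(\<lambda>x. inv_into UNIV \<theta> (h (S x))) \<noteq> (\<lambda>_. 0)" by metis
    moreover have "Si z \<noteq> 0" using z Si S0 by metis
    moreover have "\<psi> (rk x f) = rk (Si z) (\<lambda>x. inv_into UNIV \<theta> (h (S x)))"
      by (rule ext) (simp add: \<psi>_def z(4) Si_scale)
    ultimately show ?case using B_out z by blast
  next
    case (5 A B Z c)
    \<comment> \<open>An identity for \<open>Z\<close> with factor \<open>c\<close> becomes one for
      the image sandwich with factor \<open>\<theta> c\<close>, since \<open>S\<close> is
      semilinear.\<close>
    have Y: "\<phi> A (\<phi> B (\<phi> A w)) = S (Z (Si w))" for w unfolding transport 5 ..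
    have "idx (\<lambda>v. \<phi> A (\<phi> B (\<phi> A v))) = 1"
    proof (rule idx_idempotent[of _ "\<theta> c"])
      show "lin (\<lambda>v. \<phi> A (\<phi> B (\<phi> A v)))" using 5 by (simp add: lin_sandwich)
      show "(\<lambda>v. \<phi> A (\<phi> B (\<phi> A v))) \<noteq> scl (\<theta> c)"
      proof
        assume *: "(\<lambda>v. \<phi> A (\<phi> B (\<phi> A v))) = scl (\<theta> c)"
        have "Z v = scl c v" for v
          using fun_cong[OF *, of "S v"] unfolding Y by (metis S_scale Si)
        then show False using 5 by blast
      qed
    qed (use 5 F in \<open>simp_all add: Y S_scale\<close>)
    then show ?case using phi_idx 5 by simp
  next
    case (6 A B Z w)
    have Y: "\<phi> A (\<phi> B (\<phi> A w)) = S (Z (Si w))" for w unfolding transport 6 ..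
    have "idx (\<lambda>v. \<phi> A (\<phi> B (\<phi> A v))) = 2"
    proof (rule idx_square_zero[of _ "S w"])
      show "lin (\<lambda>v. \<phi> A (\<phi> B (\<phi> A v)))" using 6 by (simp add: lin_sandwich)
    qed (use 6 S S0 in \<open>simp_all add: Y\<close>)
    then show ?case using phi_idx 6 by simp
  next
    case (7 A B Z c)
    have Y: "\<phi> A (\<phi> B (\<phi> A w)) = S (Z (Si w))" for w unfolding transport 7 ..
    have "idx (\<lambda>v. \<phi> A (\<phi> B (\<phi> A v))) \<le> 2"
    proof (rule idx_le_2[of _ "\<theta> c"])
      show "lin (\<lambda>v. \<phi> A (\<phi> B (\<phi> A v)))" using 7 by (simp add: lin_sandwich)
    qed (use 7 F in \<open>simp_all add: Y S_scale\<close>)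
    then show ?case using phi_idx 7 by simp
  qed
  have main: "\<exists>a. a \<noteq> 0 \<and> (\<forall>x. \<phi> T (S x) = scl a (S (T x)))" if T: "T \<in> Op" for T
  proof -
    obtain a where a: "a \<noteq> 0" "\<And>x. \<psi> T x = scl a (T x)" using psi_proportional[OF T] by blast
    have "\<phi> T (S x) = scl (\<theta> a) (S (T x))" for x
      using arg_cong[OF a(2), of S x] by (simp add: \<psi>_def S_scale)
    then show ?thesis using a F by blast
  qed
  have "bij S" using injS surjS by (simp add: bij_def)
  then show ?thesis
    using S_add S_scale aut B_in[unfolded Si_def] B_out main unfolding point_form_def
    by (intro exI[of _ S] exI[of _ \<theta>] conjI allI ballI)
qed

text \<open>Dual to \<open>point_case\<close>: \<open>\<sigma>\<close> takes vectors to functionals,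
  inside the vector space of all functions with pointwise operations. \<open>A\<close> is
  constructed as the map adjoint to \<open>S\<close>, and its bijectivity comes from the points
  \<tau>(g) exhausting all points.\<close>

lemma hyperplane_case:
  assumes zh: "\<And>y g. flag y g \<Longrightarrow> flag (zz y g) (hh y g) \<and> \<phi> (rk y g) = rk (zz y g) (hh y g)"
    and h_const: "\<And>y g g'. flag y g \<Longrightarrow> flag y g' \<Longrightarrow> fpar (hh y g) (hh y g')"
    and z_const: "\<And>g y y'. flag y g \<Longrightarrow> flag y' g \<Longrightarrow> vpar (zz y g) (zz y' g)"
  shows "\<exists>S A \<theta>. hyperplane_form \<phi> S A \<theta>"
proof -
  define fscl :: "'f \<Rightarrow> ('v \<Rightarrow> 'f) \<Rightarrow> 'v \<Rightarrow> 'f" where "fscl c f = (\<lambda>x. c * f x)" for c f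
  have vs: "vector_space fscl"
    by unfold_locales (auto simp: fscl_def fun_eq_iff algebra_simps)
  define \<sigma> where "\<sigma> y = hh y (SOME g. flag y g)" for y
  define \<tau> where "\<tau> g = zz (SOME y. flag y g) g" for g
  have \<sigma>: "fpar (\<sigma> y) (hh y g)" if "flag y g" for y g
    unfolding \<sigma>_def by (rule h_const[OF someI[of "flag y", OF that] that])
  have \<tau>: "vpar (\<tau> g) (zz y g)" if "flag y g" for y g
    unfolding \<tau>_def by (rule z_const[OF someI[of "\<lambda>y. flag y g", OF that] that])
  have \<sigma>D: "\<sigma> y \<in> D" "\<sigma> y \<noteq> (\<lambda>_. 0)" if y: "y \<noteq> 0" for y
  proof -
    obtain g where g: "flag y g" using exists_flag_functional y by blast
    then have "flag (zz y (SOME g. flag y g)) (\<sigma> y)"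
      unfolding \<sigma>_def using zh[OF someI[of "flag y", OF g]] by simp
    then show "\<sigma> y \<in> D" "\<sigma> y \<noteq> (\<lambda>_. 0)" using flagD by blast+
  qed
  have inc: "g y = 0 \<longleftrightarrow> \<sigma> y (\<tau> g) = 0" if y: "y \<noteq> 0" and g: "g \<in> D" "g \<noteq> (\<lambda>_. 0)" for y g
  proof
    assume "g y = 0"
    then have fl: "flag y g" using y g by (simp add: flag_def)
    then have "hh y g (zz y g) = 0" using zh flagD by blast
    then show "\<sigma> y (\<tau> g) = 0"
      using fpar_zero_iff[OF \<sigma>[OF fl]] vpar_zero_iff[OF \<sigma>D(1)[OF y] \<tau>[OF fl]] by simp
  next
    assume *: "\<sigma> y (\<tau> g) = 0"
    show "g y = 0"
    proof (rule ccontr)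
      assume gy: "g y \<noteq> 0"
      then obtain x f where xf: "flag x g" "flag y f" "f x \<noteq> 0" using flag_maps_nonincident g by blast
      then have "hh y f (zz x g) \<noteq> 0" using flag_maps_incidence[OF zh xf(1,2)] gy by blast
      then show False
        using * fpar_zero_iff[OF \<sigma>[OF xf(2)]] vpar_zero_iff[OF \<sigma>D(1)[OF y] \<tau>[OF xf(1)]] by simp
    qed
  qed
  have \<tau>_onto: "\<exists>g. g \<in> D \<and> g \<noteq> (\<lambda>_. 0) \<and> vpar (\<tau> g) w" if w: "w \<noteq> 0" for w
  proof -
    obtain h where "flag w h" using exists_flag_functional w by blast
    then obtain y g where "flag y g" "vpar (zz y g) w" using flag_maps_onto[OF zh] by blast
    then have "vpar (\<tau> g) w" "g \<in> D" "g \<noteq> (\<lambda>_. 0)" using \<tau> vpar_trans flagD by blast+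
    then show ?thesis by blast
  qed
  have \<sigma>_onto: "\<exists>z c. z \<noteq> 0 \<and> h = fscl c (\<sigma> z)" if h: "h \<in> D" "h \<noteq> (\<lambda>_. 0)" for h
  proof -
    obtain w where "flag w h" using exists_flag_vector h by blast
    then obtain y g where "flag y g" "fpar (hh y g) h" using flag_maps_onto[OF zh] by blast
    then have "fpar (\<sigma> y) h" "y \<noteq> 0" using \<sigma> fpar_trans flagD by blast+
    then show ?thesis unfolding fpar_def fscl_def by blast
  qed
  have sp: "\<exists>p q. \<sigma> z = fscl p (\<sigma> x) + fscl q (\<sigma> y)"
    if nz: "x \<noteq> 0" "y \<noteq> 0" "z \<noteq> 0"
      and *: "\<And>g. g \<in> D \<Longrightarrow> g \<noteq> (\<lambda>_. 0) \<Longrightarrow> \<sigma> x (\<tau> g) = 0 \<Longrightarrow> \<sigma> y (\<tau> g) = 0 \<Longrightarrow> \<sigma> z (\<tau> g) = 0" for x y z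
  proof -
    have "\<sigma> z v = 0" if "\<sigma> x v = 0" "\<sigma> y v = 0" for v
    proof (cases "v = 0")
      case True
      then show ?thesis using \<sigma>D nz by simp
    next
      case False
      then obtain g where "g \<in> D" "g \<noteq> (\<lambda>_. 0)" "vpar (\<tau> g) v" using \<tau>_onto by blast
      then show ?thesis using *[of g] vpar_zero_iff \<sigma>D nz that by blast
    qed
    then show ?thesis using in_span_pair_functionals[of "\<sigma> x" "\<sigma> y" "\<sigma> z"] \<sigma>D nz
      unfolding fscl_def plus_fun_def by blast
  qed
  have onto2: "\<exists>z c. z \<noteq> 0 \<and> w = fscl c (\<sigma> z)"
    if "x \<noteq> 0" "y \<noteq> 0" "w \<noteq> 0" "w = fscl p (\<sigma> x) + fscl q (\<sigma> y)" for x y w p q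
  proof -
    have "w \<in> D" unfolding that(4) fscl_def plus_fun_def using D_comb \<sigma>D that by blast
    then show ?thesis using \<sigma>_onto that by (simp add: zero_fun_def)
  qed
  have \<sigma>0: "\<sigma> y \<noteq> 0" if "y \<noteq> 0" for y using \<sigma>D(2)[OF that] by (simp add: zero_fun_def)
  have pr: "(a + b) (\<tau> g) = a (\<tau> g) + b (\<tau> g)" "fscl c a (\<tau> g) = c * a (\<tau> g)" for a b c g
    by (simp_all add: fscl_def)
  let ?C = "\<lambda>S \<theta>. (\<forall>x y. S (x + y) = S x + S y) \<and> (\<forall>c x. S (scl c x) = fscl (\<theta> c) (S x))
    \<and> (\<forall>x. x \<noteq> 0 \<longrightarrow> S x \<noteq> 0 \<and> (\<exists>c. c \<noteq> 0 \<and> S x = fscl c (\<sigma> x))) \<and> field_automorphism \<theta>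
    \<and> (\<forall>g\<in>D. g \<noteq> (\<lambda>_. 0) \<longrightarrow> (\<exists>c. c \<noteq> 0 \<and> (\<forall>y. S y (\<tau> g) = c * \<theta> (g y))))"
  have "\<exists>S \<theta>. ?C S \<theta>"
    by (rule semilinear_representation[where pr = "\<lambda>w g. w (\<tau> g)" and \<sigma> = \<sigma>, OF vs pr \<sigma>0 inc sp onto2])
  then obtain S \<theta> where H: "?C S \<theta>" by (elim exE)
  note S_add' = H[THEN conjunct1, rule_format]
    and S_scale' = H[THEN conjunct2, THEN conjunct1, rule_format]
    and S = H[THEN conjunct2, THEN conjunct2, THEN conjunct1, rule_format]
    and aut = H[THEN conjunct2, THEN conjunct2, THEN conjunct2, THEN conjunct1]
    and S_\<tau> = H[THEN conjunct2, THEN conjunct2, THEN conjunct2, THEN conjunct2, rule_format]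
  have S_add: "S (x + y) v = S x v + S y v" for x y v by (simp add: S_add')
  have S_scale: "S (scl c x) v = \<theta> c * S x v" for c x v by (simp add: S_scale' fscl_def)
  note F = field_automorphism_facts[OF aut]
  note Fi = field_automorphism_facts[OF field_automorphism_inv[OF aut]]
  have S0: "S 0 = (\<lambda>_. 0)" using S_add'[of 0 0] by (simp add: zero_fun_def)
  have SD: "S x \<in> D" for x
  proof (cases "x = 0")
    case False
    then obtain c where "S x = (\<lambda>v. c * \<sigma> x v)" using S unfolding fscl_def by blast
    then show ?thesis using D_cmult \<sigma>D False by simp
  qed (simp add: S0 D_zero)
  have injS: "inj S"
  proof (rule injI)
    fix x y assume "S x = S y"
    then have "S (x - y) = 0" using S_add'[of "x - y" y] by simp
    then show "x = y" using S[of "x - y"] by auto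
  qed
  have surjS: "\<exists>x. h = S x" if h: "h \<in> D" for h
  proof (cases "h = (\<lambda>_. 0)")
    case False
    then obtain z c where z: "z \<noteq> 0" "h = fscl c (\<sigma> z)" using \<sigma>_onto h by blast
    then obtain d where d: "d \<noteq> 0" "S z = fscl d (\<sigma> z)" using S by blast
    have "h v = S (scl (inv_into UNIV \<theta> (c / d)) z) v" for v
      using z d by (simp add: S_scale F) (simp add: fscl_def)
    then show ?thesis by blast
  qed (use S0 in metis)
  \<comment> \<open>The functionals \<open>S x\<close> exhaust \<open>D\<close> and therefore
    separate vectors, so equations between vectors can be checked under all
    \<open>S x\<close>.\<close>
  have S_eq: "u = v" if "\<And>x. S x u = S x v" for u v
  proof (rule ccontr)
    assume "u \<noteq> v"
    then obtain f where "f \<in> D" "f (u - v) \<noteq> 0" using D_separates[of "u - v"] by auto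
    moreover obtain x where "f = S x" using surjS \<open>f \<in> D\<close> by blast
    ultimately show False using D_diff[of f u v] that[of x] by simp
  qed
  have ex_A: "\<exists>v. \<forall>x. S x v = \<theta> (f x)" if f: "f \<in> D" for f
  proof (cases "f = (\<lambda>_. 0)")
    case True
    then show ?thesis using F SD by (intro exI[of _ 0]) simp
  next
    case False
    then obtain c where c: "c \<noteq> 0" "\<And>y. S y (\<tau> f) = c * \<theta> (f y)" using S_\<tau> f by blast
    then show ?thesis using D_scale[OF SD] by (intro exI[of _ "scl (1 / c) (\<tau> f)"]) simp
  qed
  define A where "A f = (SOME v. \<forall>x. S x v = \<theta> (f x))" for f
  have A: "S x (A f) = \<theta> (f x)" if "f \<in> D" for x f
    using someI_ex[OF ex_A[OF that]] unfolding A_def by blast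
  have A_unique: "A f = v" if "f \<in> D" "\<And>x. S x v = \<theta> (f x)" for f v
    using A that by (intro S_eq) simp
  have bijA: "bij_betw A D UNIV"
  proof -
    have "inj_on A D"
    proof (rule inj_onI)
      fix f g assume fg: "f \<in> D" "g \<in> D" "A f = A g"
      then have "\<theta> (f x) = \<theta> (g x)" for x using A by metis
      then show "f = g" using F(7) by (metis ext)
    qed
    moreover have "\<exists>f\<in>D. v = A f" for v
    proof (cases "v = 0")
      case True
      have "A (\<lambda>_. 0) = 0" using SD D_0 F(4) by (intro A_unique D_zero) simp
      then show ?thesis using True D_zero by metis
    next
      case False
      then obtain g where g: "g \<in> D" "g \<noteq> (\<lambda>_. 0)" "vpar (\<tau> g) v" using \<tau>_onto by blast
      obtain k where k: "v = scl k (\<tau> g)" using g unfolding vpar_def by blast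
      obtain c where c: "\<And>y. S y (\<tau> g) = c * \<theta> (g y)" using S_\<tau> g by blast
      have "A (\<lambda>x. inv_into UNIV \<theta> (k * c) * g x) = v"
        using g SD c by (intro A_unique D_cmult) (simp_all add: k D_scale F)
      then show ?thesis using D_cmult[OF g(1)] by metis
    qed
    ultimately show ?thesis unfolding bij_betw_def by auto
  qed
  define Si where "Si = inv_into UNIV S"
  have Si_S: "Si (S x) = x" for x using injS by (simp add: Si_def)
  have S_Si: "S (Si h) = h" if "h \<in> D" for h using surjS[OF that] Si_S by auto
  \<comment> \<open>The transpose of \<phi>(T), acting on functionals, pulled back along
    \<open>S\<close>.\<close>
  define \<psi> where "\<psi> T = (\<lambda>x. Si (\<lambda>v. S x (\<phi> T v)))" for T
  have S_psi: "S (\<psi> T x) = (\<lambda>v. S x (\<phi> T v))" if "T \<in> Op" for T x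
    unfolding \<psi>_def using D_comp[OF SD phi_Op[OF that]] by (rule S_Si)
  have S_inject: "S x = S y \<Longrightarrow> x = y" for x y using injS by (simp add: inj_def)
  \<comment> \<open>Transposition reverses products, and A B A is its own reversal; this is why
    sandwiches survive the passage to the dual.\<close>
  have transport: "S (\<psi> A (\<psi> B (\<psi> A x))) w = S x (\<phi> A (\<phi> B (\<phi> A w)))" if "A \<in> Op" "B \<in> Op" for A B x w
    using that by (simp add: S_psi)
  interpret normalized_preserver scl D Op idx \<psi>
  proof (unfold_locales, goal_cases)
    case (1 T)
    have "\<psi> T (x + y) = \<psi> T x + \<psi> T y" "\<psi> T (scl c x) = scl c (\<psi> T x)" for x y c
      using 1 by (auto intro!: S_inject ext simp: S_add S_scale S_psi)
    then show ?case unfolding lin_def by blast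
  next
    case 2
    have "\<phi> (\<lambda>_. 0) = (\<lambda>_. 0)" using phi_eq_zero_iff zero_in_Op by blast
    then have "S (\<psi> (\<lambda>_. 0) x) = S 0" for x using zero_in_Op SD by (simp add: S_psi S0)
    then show ?case using S_inject by blast
  next
    case (3 f x)
    then have fl: "flag x f" by (simp add: flag_def)
    then have e: "\<phi> (rk x f) = rk (zz x f) (hh x f)" using zh by blast
    obtain p where p: "p \<noteq> 0" "zz x f = scl p (\<tau> f)" using \<tau>[OF fl] unfolding vpar_def by blast
    obtain q where q: "q \<noteq> 0" "S x = (\<lambda>v. q * \<sigma> x v)" using S 3 unfolding fscl_def by blast
    obtain r where r: "r \<noteq> 0" "hh x f = (\<lambda>v. r * \<sigma> x v)" using \<sigma>[OF fl] unfolding fpar_def by blast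
    obtain s where s: "s \<noteq> 0" "\<And>y. S y (\<tau> f) = s * \<theta> (f y)" using S_\<tau> 3 by blast
    have sx: "\<sigma> x v = 1 / q * S x v" for v using q by simp
    have "\<psi> (rk x f) y = rk (scl (inv_into UNIV \<theta> (p * (1 / q) * r * s)) x) f y" for y
      using 3 by (intro S_inject ext)
        (simp add: S_psi e p(2) r(2) sx s(2) D_scale[OF SD] S_scale F mult_ac)
    moreover have "inv_into UNIV \<theta> (p * (1 / q) * r * s) \<noteq> 0" using p q r s F(8) by simp
    ultimately show ?case by blast
  next
    case (4 f x)
    then have "rk x f \<in> rank_one" using rk_in_rank_one by blast
    then have "\<phi> (rk x f) \<in> rank_one" using phi_rank_one rank_one_Op by blast
    then obtain z h where z: "z \<noteq> 0" "h \<in> D" "h \<noteq> (\<lambda>_. 0)" "\<phi> (rk x f) = rk z h"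
      unfolding rank_one_def by blast
    obtain f' where f': "f' \<in> D" "z = A f'" using bijA unfolding bij_betw_def by auto
    obtain x' where x': "h = S x'" using surjS z by blast
    have "x' \<noteq> 0" using x' z S0 by auto
    moreover have "f' \<noteq> (\<lambda>_. 0)"
    proof
      assume "f' = (\<lambda>_. 0)"
      then have "A f' = 0" using SD D_0 F(4) D_zero by (intro A_unique) simp_all
      then show False using z f' by simp
    qed
    moreover have "\<psi> (rk x f) y = rk x' f' y" for y
      using 4 by (intro S_inject ext) (simp add: S_psi z(4) x' f' A D_scale[OF SD] S_scale mult.commute)
    ultimately show ?case using f' by blast
  next
    case (5 A B Z c)
    have Y: "S x (\<phi> A (\<phi> B (\<phi> A w))) = S (Z x) w" for x w using transport 5 by simp
    have "idx (\<lambda>v. \<phi> A (\<phi> B (\<phi> A v))) = 1"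
    proof (rule idx_idempotent[of _ "\<theta> c"])
      show "lin (\<lambda>v. \<phi> A (\<phi> B (\<phi> A v)))" using 5 by (simp add: lin_sandwich)
      show "(\<lambda>v. \<phi> A (\<phi> B (\<phi> A v))) \<noteq> scl (\<theta> c)"
      proof
        assume *: "(\<lambda>v. \<phi> A (\<phi> B (\<phi> A v))) = scl (\<theta> c)"
        have "S (Z x) = S (scl c x)" for x
          by (rule ext) (simp add: Y[symmetric] fun_cong[OF *] S_scale D_scale[OF SD])
        then show False using 5 S_inject by blast
      qed
      show "\<phi> A (\<phi> B (\<phi> A (\<phi> A (\<phi> B (\<phi> A v))))) = scl (\<theta> c) (\<phi> A (\<phi> B (\<phi> A v)))" for v
        by (rule S_eq) (simp add: Y D_scale[OF SD] 5(4) S_scale)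
    qed (use 5 F in simp)
    then show ?case using phi_idx 5 by simp
  next
    case (6 A B Z w)
    have Y: "S x (\<phi> A (\<phi> B (\<phi> A w))) = S (Z x) w" for x w using transport 6 by simp
    have "S (Z w) \<noteq> (\<lambda>_. 0)" using S[OF 6(5)] by (simp add: zero_fun_def)
    then obtain v where v: "S (Z w) v \<noteq> 0" by blast
    have "idx (\<lambda>v. \<phi> A (\<phi> B (\<phi> A v))) = 2"
    proof (rule idx_square_zero[of _ v])
      show "lin (\<lambda>v. \<phi> A (\<phi> B (\<phi> A v)))" using 6 by (simp add: lin_sandwich)
      show "\<phi> A (\<phi> B (\<phi> A (\<phi> A (\<phi> B (\<phi> A v))))) = 0" for v
        by (rule S_eq) (simp add: Y 6(4) S0 SD)
      show "\<phi> A (\<phi> B (\<phi> A v)) \<noteq> 0" using v Y[of w v] D_0[OF SD] by metis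
    qed
    then show ?case using phi_idx 6 by simp
  next
    case (7 A B Z c)
    have Y: "S x (\<phi> A (\<phi> B (\<phi> A w))) = S (Z x) w" for x w using transport 7 by simp
    have "idx (\<lambda>v. \<phi> A (\<phi> B (\<phi> A v))) \<le> 2"
    proof (rule idx_le_2[of _ "\<theta> c"])
      show "lin (\<lambda>v. \<phi> A (\<phi> B (\<phi> A v)))" using 7 by (simp add: lin_sandwich)
      let ?Y = "\<lambda>v. \<phi> A (\<phi> B (\<phi> A v))"
      show "?Y (?Y (?Y (?Y v))) = scl (\<theta> c) (?Y (?Y v))" for v
        by (rule S_eq) (simp add: Y D_scale[OF SD] 7(4) S_scale)
    qed (use 7 F in simp)
    then show ?case using phi_idx 7 by simp
  qed
  have main: "\<exists>a. a \<noteq> 0 \<and> (\<forall>f\<in>D. \<phi> T (A f) = scl a (A (\<lambda>x. f (T x))))" if T: "T \<in> Op" for T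
  proof -
    obtain a where a: "a \<noteq> 0" "\<And>x. \<psi> T x = scl a (T x)" using psi_proportional[OF T] by blast
    have "\<phi> T (A f) = scl (\<theta> a) (A (\<lambda>x. f (T x)))" if f: "f \<in> D" for f
    proof (rule S_eq)
      fix x
      have "S x (\<phi> T (A f)) = S (scl a (T x)) (A f)" using S_psi[OF T] a(2) by metis
      then show "S x (\<phi> T (A f)) = S x (scl (\<theta> a) (A (\<lambda>x. f (T x))))"
        using f D_comp[OF f T] by (simp add: S_scale A D_scale[OF SD])
    qed
    then show ?thesis using a F by blast
  qed
  have "bij_betw S UNIV D" using injS surjS SD unfolding bij_betw_def by auto
  then show ?thesis using aut bijA A main unfolding hyperplane_form_def
    by (intro exI[of _ S] exI[of _ A] exI[of _ \<theta>] conjI allI ballI)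
qed

theorem preserver_form: "(\<exists>S \<theta>. point_form \<phi> S \<theta>) \<or> (\<exists>S A \<theta>. hyperplane_form \<phi> S A \<theta>)"
proof -
  obtain zz hh where zh: "\<And>y g. flag y g \<Longrightarrow> flag (zz y g) (hh y g) \<and> \<phi> (rk y g) = rk (zz y g) (hh y g)"
    and cases: "(\<forall>y g g'. flag y g \<longrightarrow> flag y g' \<longrightarrow> vpar (zz y g) (zz y g'))
        \<and> (\<forall>g y y'. flag y g \<longrightarrow> flag y' g \<longrightarrow> fpar (hh y g) (hh y' g))
      \<or> (\<forall>y g g'. flag y g \<longrightarrow> flag y g' \<longrightarrow> fpar (hh y g) (hh y g'))
        \<and> (\<forall>g y y'. flag y g \<longrightarrow> flag y' g \<longrightarrow> vpar (zz y g) (zz y' g))"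
    using exists_flag_maps by blast
  from cases show ?thesis
  proof (elim disjE conjE)
    assume "\<forall>y g g'. flag y g \<longrightarrow> flag y g' \<longrightarrow> vpar (zz y g) (zz y g')"
      "\<forall>g y y'. flag y g \<longrightarrow> flag y' g \<longrightarrow> fpar (hh y g) (hh y' g)"
    then show ?thesis by (intro disjI1 point_case[OF zh]) blast+
  next
    assume "\<forall>y g g'. flag y g \<longrightarrow> flag y g' \<longrightarrow> fpar (hh y g) (hh y g')"
      "\<forall>g y y'. flag y g \<longrightarrow> flag y' g \<longrightarrow> vpar (zz y g) (zz y' g)"
    then show ?thesis by (intro disjI2 hyperplane_case[OF zh]) blast+
  qed
qed

end

section \<open>Index functions and uniform boundedness\<close>

text \<open>Ascent for plain functions, since the abstract preserver acts on functions and not on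
  the type of bounded maps; \<open>range_index\<close> plays the same part for descent.\<close>

definition kernel_index :: "('v::zero \<Rightarrow> 'v) \<Rightarrow> enat" where
  "kernel_index f = Inf {enat n | n. {x. (f ^^ n) x = 0} = {x. (f ^^ (n + 1)) x = 0}}"

definition range_index :: "('v \<Rightarrow> 'v) \<Rightarrow> enat" where
  "range_index f = Inf {enat n | n. range (f ^^ n) = range (f ^^ (n + 1))}"

lemma Inf_enat_eqI:
  assumes "P k" "\<And>j. j < k \<Longrightarrow> \<not> P j"
  shows "Inf {enat n | n. P n} = enat k"
proof (rule antisym)
  show "Inf {enat n | n. P n} \<le> enat k" using assms by (intro Inf_lower) blast
  show "enat k \<le> Inf {enat n | n. P n}" using assms by (intro Inf_greatest) (force simp: not_less[symmetric])
qed

lemma Inf_enat_leI: "P k \<Longrightarrow> Inf {enat n | n. P n} \<le> enat k"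
  by (intro Inf_lower) blast

lemma Inf_enat_eq_small:
  "\<not> P 0 \<Longrightarrow> P 1 \<Longrightarrow> Inf {enat n | n. P n} = enat 1"
  "\<not> P 0 \<Longrightarrow> \<not> P 1 \<Longrightarrow> P 2 \<Longrightarrow> Inf {enat n | n. P n} = enat 2"
  "\<not> P 0 \<Longrightarrow> \<not> P 1 \<Longrightarrow> \<not> P 2 \<Longrightarrow> P 3 \<Longrightarrow> Inf {enat n | n. P n} = enat 3"
proof -
  have less3: "(j::nat) < 3 \<Longrightarrow> j = 0 \<or> j = 1 \<or> j = 2" for j by auto
  show "\<not> P 0 \<Longrightarrow> P 1 \<Longrightarrow> Inf {enat n | n. P n} = enat 1"
    by (rule Inf_enat_eqI) auto
  show "\<not> P 0 \<Longrightarrow> \<not> P 1 \<Longrightarrow> P 2 \<Longrightarrow> Inf {enat n | n. P n} = enat 2"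
    by (rule Inf_enat_eqI) (auto simp: less_2_cases_iff)
  show "\<not> P 0 \<Longrightarrow> \<not> P 1 \<Longrightarrow> \<not> P 2 \<Longrightarrow> P 3 \<Longrightarrow> Inf {enat n | n. P n} = enat 3"
    by (rule Inf_enat_eqI) (auto dest!: less3)
qed

context operator_system
begin

lemma lin_diff: "lin X \<Longrightarrow> X (x - y) = X x - X y"
  unfolding lin_def by (metis add_diff_cancel diff_add_cancel)

text \<open>If X^2 = cX and X is not \<open>c\<close>, some Xv - cv is a nonzero kernel vector, so
  the index is not 0. In the last clause X^3 x = 0 gives c X^2 x = X^4 x = 0.\<close>

lemma operator_index_kernel_index: "operator_index scl D Op kernel_index"
proof (unfold_locales, goal_cases)
  case (1 X c)
  obtain v where v: "X v \<noteq> scl c v" using 1 by auto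
  have "X (X v - scl c v) = 0" using lin_diff[OF 1(1)] 1(1,2) by (simp add: lin_def)
  moreover have "X v - scl c v \<noteq> 0" using v by simp
  ultimately have "X v - scl c v \<in> {x. (X ^^ (0 + 1)) x = 0}" "X v - scl c v \<notin> {x. (X ^^ 0) x = 0}"
    by simp_all
  then have "{x. (X ^^ 0) x = 0} \<noteq> {x. (X ^^ (0 + 1)) x = 0}" by blast
  moreover have "{x. (X ^^ 1) x = 0} = {x. (X ^^ (1 + 1)) x = 0}" using 1 by simp
  ultimately have "kernel_index X = enat 1"
    unfolding kernel_index_def by (intro Inf_enat_eq_small)
  then show ?case by (simp add: one_enat_def)
next
  case (2 X w)
  have "X 0 = 0" using lin_0[OF 2(1)] .
  moreover from this have "w \<noteq> 0" using 2(3) by metis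
  moreover have "X (X w) = 0" by (rule 2(2))
  ultimately have "X w \<in> {x. (X ^^ (0 + 1)) x = 0}" "X w \<notin> {x. (X ^^ 0) x = 0}"
    "w \<in> {x. (X ^^ (1 + 1)) x = 0}" "w \<notin> {x. (X ^^ 1) x = 0}" using 2 by auto
  then have "{x. (X ^^ 0) x = 0} \<noteq> {x. (X ^^ (0 + 1)) x = 0}" "{x. (X ^^ 1) x = 0} \<noteq> {x. (X ^^ (1 + 1)) x = 0}"
    by blast+
  moreover have "{x. (X ^^ 2) x = 0} = {x. (X ^^ (2 + 1)) x = 0}"
    using 2 lin_0[OF 2(1)] by (simp add: numeral_eq_Suc)
  ultimately have "kernel_index X = enat 2"
    unfolding kernel_index_def by (intro Inf_enat_eq_small)
  then show ?case by (simp add: numeral_eq_enat)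
next
  case (3 X w)
  have "X 0 = 0" using lin_0[OF 3(1)] by auto
  then have "X (X w) \<in> {x. (X ^^ (0 + 1)) x = 0}" "X (X w) \<notin> {x. (X ^^ 0) x = 0}"
    "X w \<in> {x. (X ^^ (1 + 1)) x = 0}" "X w \<notin> {x. (X ^^ 1) x = 0}"
    "w \<in> {x. (X ^^ (2 + 1)) x = 0}" "w \<notin> {x. (X ^^ 2) x = 0}" using 3 by (auto simp: numeral_eq_Suc)
  then have "{x. (X ^^ 0) x = 0} \<noteq> {x. (X ^^ (0 + 1)) x = 0}" "{x. (X ^^ 1) x = 0} \<noteq> {x. (X ^^ (1 + 1)) x = 0}"
    "{x. (X ^^ 2) x = 0} \<noteq> {x. (X ^^ (2 + 1)) x = 0}"
    by blast+
  moreover have "{x. (X ^^ 3) x = 0} = {x. (X ^^ (3 + 1)) x = 0}"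
    using 3 \<open>X 0 = 0\<close> by (simp add: numeral_eq_Suc)
  ultimately have "kernel_index X = enat 3"
    unfolding kernel_index_def by (intro Inf_enat_eq_small)
  then show ?case by (simp add: numeral_eq_enat)
next
  case (4 X c)
  have "X 0 = 0" using lin_0[OF 4(1)] .
  then have "X (X x) = 0 \<longleftrightarrow> X (X (X x)) = 0" for x
    using 4(2)[of x] 4(3) by (metis scale_eq_0_iff)
  then have "{x. (X ^^ 2) x = 0} = {x. (X ^^ (2 + 1)) x = 0}" by (simp add: numeral_eq_Suc)
  then have "kernel_index X \<le> enat 2" unfolding kernel_index_def by (intro Inf_enat_leI)
  then show ?case by (simp add: numeral_eq_enat)
qed

text \<open>If X^2 = cX and \<open>X\<close> is onto, then X = c, so the index is not 0 otherwise.
  In the last clause X^2 v = X^4 (v / c), so X^2 and X^3 have the same range.\<close>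

lemma operator_index_range_index: "operator_index scl D Op range_index"
proof (unfold_locales, goal_cases)
  case (1 X c)
  have "range (X ^^ 0) \<noteq> range (X ^^ (0 + 1))"
  proof
    assume "range (X ^^ 0) = range (X ^^ (0 + 1))"
    then have "surj X" by simp
    then have "X w = scl c w" for w using 1(2) by (metis surjD)
    then show False using 1 by auto
  qed
  moreover have "range (X ^^ 1) = range (X ^^ (1 + 1))"
  proof -
    have "X v = X (X (scl (1 / c) v))" for v using 1 by (simp add: lin_def)
    then show ?thesis by auto
  qed
  ultimately have "range_index X = enat 1"
    unfolding range_index_def by (intro Inf_enat_eq_small)
  then show ?case by (simp add: one_enat_def)
next
  case (2 X w)
  have X0: "X 0 = 0" using lin_0[OF 2(1)] by auto
  have "w \<in> range (X ^^ 0)" "w \<notin> range (X ^^ (0 + 1))" "X w \<in> range (X ^^ 1)" "X w \<notin> range (X ^^ (1 + 1))"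
    using 2 by auto
  then have "range (X ^^ 0) \<noteq> range (X ^^ (0 + 1))" "range (X ^^ 1) \<noteq> range (X ^^ (1 + 1))" by blast+
  moreover have "range (X ^^ 2) = range (X ^^ (2 + 1))" using 2 X0 by (simp add: numeral_eq_Suc o_def)
  ultimately have "range_index X = enat 2"
    unfolding range_index_def by (intro Inf_enat_eq_small)
  then show ?case by (simp add: numeral_eq_enat)
next
  case (3 X w)
  have X0: "X 0 = 0" using lin_0[OF 3(1)] by auto
  have "w \<notin> range (X ^^ (0 + 1))"
  proof
    assume "w \<in> range (X ^^ (0 + 1))"
    then obtain u where "w = X u" by auto
    then show False using 3 by simp
  qed
  moreover have "X w \<notin> range (X ^^ (1 + 1))"
  proof
    assume "X w \<in> range (X ^^ (1 + 1))"
    then obtain u where "X w = X (X u)" by auto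
    then have "X (X w) = 0" using 3(2)[of u] by simp
    then show False using 3 by simp
  qed
  moreover have "X (X w) \<notin> range (X ^^ (2 + 1))" using 3 by (auto simp: numeral_eq_Suc)
  moreover have "w \<in> range (X ^^ 0)" "X w \<in> range (X ^^ 1)" "X (X w) \<in> range (X ^^ 2)" by (auto simp: numeral_eq_Suc)
  ultimately have "range (X ^^ 0) \<noteq> range (X ^^ (0 + 1))" "range (X ^^ 1) \<noteq> range (X ^^ (1 + 1))"
     "range (X ^^ 2) \<noteq> range (X ^^ (2 + 1))" by blast+
  moreover have "range (X ^^ 3) = range (X ^^ (3 + 1))" using 3 X0 by (simp add: numeral_eq_Suc o_def)
  ultimately have "range_index X = enat 3"
    unfolding range_index_def by (intro Inf_enat_eq_small)
  then show ?case by (simp add: numeral_eq_enat)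
next
  case (4 X c)
  have "X (X v) = X (X (X (X (scl (1 / c) v))))" for v
    using 4 by (simp add: lin_def)
  then have "range (X ^^ 2) = range (X ^^ (2 + 1))" by (auto simp: numeral_eq_Suc)
  then have "range_index X \<le> enat 2" unfolding range_index_def by (intro Inf_enat_leI)
  then show ?case by (simp add: numeral_eq_enat)
qed

end

text \<open>Hahn-Banach, with Zorn's lemma applied to linear relations below the norm instead of
  partial functionals: a subspace of pairs (x, r) with r \<le> norm x is automatically
  single-valued, as (0, r) and (0, -r) give r = 0.\<close>

lemma exists_real_norming_functional:
  fixes x0 :: "'a::real_normed_vector"
  shows "\<exists>u::'a \<Rightarrow> real. (\<forall>x y. u (x + y) = u x + u y) \<and> (\<forall>t x. u (t *\<^sub>R x) = t * u x)
    \<and> (\<forall>x. u x \<le> norm x) \<and> u x0 = norm x0"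
proof -
  let ?A = "{G :: ('a \<times> real) set. subspace G \<and> (x0, norm x0) \<in> G \<and> (\<forall>(x, r) \<in> G. r \<le> norm x)}"
  have "\<exists>M\<in>?A. \<forall>X\<in>?A. M \<subseteq> X \<longrightarrow> X = M"
  proof (rule subset_Zorn)
    fix C assume C: "subset.chain ?A C"
    show "\<exists>U\<in>?A. \<forall>X\<in>C. X \<subseteq> U"
    proof (cases "C = {}")
      case True
      have "r \<le> norm x" if xr: "(x, r) \<in> span {(x0, norm x0)}" for x r
      proof -
        obtain k where "(x, r) = k *\<^sub>R (x0, norm x0)" using xr by (auto simp: span_singleton)
        then show ?thesis by (simp add: mult_right_mono)
      qed
      then have "span {(x0, norm x0)} \<in> ?A" by (auto simp: span_base)
      then show ?thesis using True by blast
    next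
      case False
      have CA: "C \<subseteq> ?A" and tot: "\<And>X Y. X \<in> C \<Longrightarrow> Y \<in> C \<Longrightarrow> X \<subseteq> Y \<or> Y \<subseteq> X"
        using C by (auto simp: subset.chain_def)
      have "subspace (\<Union>C)"
      proof (rule subspaceI)
        show "0 \<in> \<Union>C" using False CA subspace_0 by blast
        show "x + y \<in> \<Union>C" if xy: "x \<in> \<Union>C" "y \<in> \<Union>C" for x y
        proof -
          obtain X Y where "X \<in> C" "Y \<in> C" "x \<in> X" "y \<in> Y" using xy by blast
          then have "\<exists>Z\<in>C. x \<in> Z \<and> y \<in> Z" using tot by blast
          then show ?thesis using CA subspace_add by blast
        qed
        show "c *\<^sub>R x \<in> \<Union>C" if "x \<in> \<Union>C" for c x using that CA subspace_scale by blast
      qed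
      then have "\<Union>C \<in> ?A" using False CA by blast
      then show ?thesis by blast
    qed
  qed
  then obtain G where GA: "G \<in> ?A" and maximal: "\<forall>X\<in>?A. G \<subseteq> X \<longrightarrow> X = G" by (elim bexE)
  from GA have G: "subspace G" "(x0, norm x0) \<in> G" "\<And>x r. (x, r) \<in> G \<Longrightarrow> r \<le> norm x" by auto
  have "\<exists>r. (x1, r) \<in> G" for x1
  proof -
    \<comment> \<open>The one-dimensional extension step: every lower bound for the value at
      \<open>x1\<close> lies below every upper bound, so the supremum of the lower bounds is
      admissible.\<close>
    have bound: "r - norm (y - x1) \<le> norm (y' + x1) - r'" if "(y, r) \<in> G" "(y', r') \<in> G" for y r y' r'
    proof -
      have "(y + y', r + r') \<in> G" using subspace_add[OF G(1) that] by simp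
      then have "r + r' \<le> norm (y + y')" by (rule G(3))
      also have "\<dots> = norm ((y - x1) + (y' + x1))" by simp
      also have "\<dots> \<le> norm (y - x1) + norm (y' + x1)" by (rule norm_triangle_ineq)
      finally show ?thesis by simp
    qed
    define B where "B = (\<lambda>(y, r). r - norm (y - x1)) ` G"
    define a where "a = Sup B"
    have "B \<noteq> {}" using G(2) unfolding B_def by blast
    have "bdd_above B" unfolding B_def
      using bound[OF _ G(2)] by (intro bdd_aboveI[of _ "norm (x0 + x1) - norm x0"]) auto
    have lower: "r - norm (y - x1) \<le> a" if "(y, r) \<in> G" for y r
      unfolding a_def by (rule cSup_upper[OF _ \<open>bdd_above B\<close>]) (use that in \<open>force simp: B_def\<close>)
    have upper: "a \<le> norm (y + x1) - r" if "(y, r) \<in> G" for y r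
      unfolding a_def by (rule cSup_least[OF \<open>B \<noteq> {}\<close>]) (use bound that in \<open>auto simp: B_def\<close>)
    define G' where "G' = {(y + t *\<^sub>R x1, r + t * a) | y r t. (y, r) \<in> G}"
    have le: "r + t * a \<le> norm (y + t *\<^sub>R x1)" if yr: "(y, r) \<in> G" for y r t
    proof (cases t "0::real" rule: linorder_cases)
      case greater
      have "(inverse t *\<^sub>R y, inverse t * r) \<in> G" using subspace_scale[OF G(1) yr, of "inverse t"] by simp
      then have "t * (inverse t * r + a) \<le> t * norm (inverse t *\<^sub>R y + x1)"
        using upper greater by (intro mult_left_mono) force+
      also have "\<dots> = norm (t *\<^sub>R (inverse t *\<^sub>R y + x1))" using greater by simp
      finally show ?thesis using greater by (simp add: scaleR_right_distrib distrib_left mult.assoc[symmetric])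
    next
      case less
      have "(inverse (- t) *\<^sub>R y, inverse (- t) * r) \<in> G"
        using subspace_scale[OF G(1) yr, of "inverse (- t)"] by simp
      then have "(- t) * (inverse (- t) * r - a) \<le> (- t) * norm (inverse (- t) *\<^sub>R y - x1)"
        using lower less by (intro mult_left_mono) force+
      also have "\<dots> = norm ((- t) *\<^sub>R (inverse (- t) *\<^sub>R y - x1))"
        using less by simp
      finally show ?thesis using less by (simp add: scaleR_right_diff_distrib right_diff_distrib mult.assoc[symmetric])
    qed (use G(3)[OF yr] in simp)
    have "subspace G'"
    proof (rule subspaceI)
      show "0 \<in> G'" unfolding G'_def using subspace_0[OF G(1)]
        by (intro CollectI exI[of _ "0::'a"] exI[of _ "0::real"]) (simp add: zero_prod_def)
      show "p + q \<in> G'" if pq: "p \<in> G'" "q \<in> G'" for p q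
      proof -
        obtain y r t y' r' t' where *: "p = (y + t *\<^sub>R x1, r + t * a)" "q = (y' + t' *\<^sub>R x1, r' + t' * a)"
          "(y, r) \<in> G" "(y', r') \<in> G" using pq unfolding G'_def by blast
        have "p + q = ((y + y') + (t + t') *\<^sub>R x1, (r + r') + (t + t') * a)"
          unfolding * by (simp add: algebra_simps)
        moreover have "(y + y', r + r') \<in> G" using subspace_add[OF G(1) *(3,4)] by simp
        ultimately show ?thesis unfolding G'_def by blast
      qed
      show "c *\<^sub>R p \<in> G'" if p: "p \<in> G'" for c p
      proof -
        obtain y r t where *: "p = (y + t *\<^sub>R x1, r + t * a)" "(y, r) \<in> G" using p unfolding G'_def by blast
        have "c *\<^sub>R p = (c *\<^sub>R y + (c * t) *\<^sub>R x1, c * r + (c * t) * a)"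
          unfolding * by (simp add: algebra_simps)
        moreover have "(c *\<^sub>R y, c * r) \<in> G" using subspace_scale[OF G(1) *(2), of c] by simp
        ultimately show ?thesis unfolding G'_def by blast
      qed
    qed
    moreover have sub: "G \<subseteq> G'"
    proof
      fix p assume "p \<in> G"
      then show "p \<in> G'" unfolding G'_def
        by (intro CollectI exI[of _ "fst p"] exI[of _ "snd p"] exI[of _ "0::real"]) simp
    qed
    moreover have "\<forall>(x, r) \<in> G'. r \<le> norm x" unfolding G'_def using le by auto
    moreover have "(x0, norm x0) \<in> G'" using sub G(2) by (rule subsetD)
    ultimately have "G' \<in> ?A" by (intro CollectI conjI)
    then have "G' = G" using maximal sub by simp
    moreover have "(x1, a) \<in> G'" unfolding G'_def using subspace_0[OF G(1)]
      by (intro CollectI exI[of _ "0::'a"] exI[of _ "0::real"] exI[of _ "1::real"]) (simp add: zero_prod_def)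
    ultimately show ?thesis by blast
  qed
  then obtain u where u: "\<And>x. (x, u x) \<in> G" by metis
  have unique: "r = s" if "(x, r) \<in> G" "(x, s) \<in> G" for x r s
    using G(3)[of 0 "r - s"] G(3)[of 0 "s - r"] subspace_diff[OF G(1) that] subspace_diff[OF G(1) that(2,1)] by simp
  have "u (x + y) = u x + u y" for x y
    using unique[OF u, of "x + y"] subspace_add[OF G(1) u[of x] u[of y]] by simp
  moreover have "u (t *\<^sub>R x) = t * u x" for t x
    using unique[OF u, of "t *\<^sub>R x"] subspace_scale[OF G(1) u[of x], of t] by simp
  moreover have "u x \<le> norm x" for x using G(3) u by blast
  moreover have "u x0 = norm x0" using unique[OF u G(2)] .
  ultimately show ?thesis by blast
qed

text \<open>A gliding hump: were the family not uniformly bounded, one could choose \<open>\<xi>\<^sub>n\<close> so small that the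
  earlier seminorms \<open>p i\<^sub>k\<close> do not feel it, but \<open>p i\<^sub>n \<xi>\<^sub>n\<close> exceeds everything accumulated so far.\<close>

lemma uniform_boundedness:
  fixes p :: "'i \<Rightarrow> 'a::banach \<Rightarrow> real" and U :: "'a set"
  assumes U: "subspace U" "closed U"
    and tri: "\<And>i x y. i \<in> I \<Longrightarrow> x \<in> U \<Longrightarrow> y \<in> U \<Longrightarrow> p i (x + y) \<le> p i x + p i y"
    and hom: "\<And>i x r. i \<in> I \<Longrightarrow> x \<in> U \<Longrightarrow> p i (r *\<^sub>R x) = \<bar>r\<bar> * p i x"
    and bnd: "\<And>i x. i \<in> I \<Longrightarrow> x \<in> U \<Longrightarrow> p i x \<le> K i * norm x"
    and ptw: "\<And>x. x \<in> U \<Longrightarrow> \<exists>M. \<forall>i\<in>I. p i x \<le> M"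
  shows "\<exists>C. \<forall>i\<in>I. \<forall>x\<in>U. p i x \<le> C * norm x"
proof (rule ccontr)
  assume no: "\<not> ?thesis"
  have big: "\<exists>i\<in>I. \<exists>\<xi>\<in>U. norm \<xi> \<le> \<delta> \<and> R < p i \<xi>" if \<delta>: "\<delta> > 0" "R > 0" for \<delta> R
  proof -
    obtain i x where ix: "i \<in> I" "x \<in> U" "p i x > R / \<delta> * norm x" using no by (meson not_le)
    have "x \<noteq> 0" using bnd[OF ix(1,2)] ix(3) by auto
    let ?\<xi> = "(\<delta> / norm x) *\<^sub>R x"
    have "?\<xi> \<in> U" using U ix subspace_scale by blast
    moreover have "norm ?\<xi> \<le> \<delta>" using \<open>x \<noteq> 0\<close> \<delta> by simp
    moreover have "p i ?\<xi> = \<delta> / norm x * p i x" using hom ix \<delta> by simp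
    moreover have "\<delta> / norm x * p i x > R" using ix(3) \<open>x \<noteq> 0\<close> \<delta> by (simp add: field_simps)
    ultimately show ?thesis using ix(1) by force
  qed
  \<comment> \<open>Each state is a pair of an index and a vector. The factor 1 plus the sum of the
    |K| makes later vectors small for the seminorms chosen earlier; the 2 outweighs the tail of the
    series, whose contribution is at most 1.\<close>
  define P where "P g n z \<longleftrightarrow> fst z \<in> I \<and> snd z \<in> U \<and>
      norm (snd z) * (1 + (\<Sum>k<n. \<bar>K (fst (g k))\<bar>)) \<le> (1/2) ^ n \<and>
      real n + 2 + p (fst z) (- (\<Sum>k<n. snd (g k))) \<le> p (fst z) (snd z)"
    for g :: "nat \<Rightarrow> 'i \<times> 'a" and n z
  have "\<exists>g. \<forall>n. P g n (g n)"
  proof (rule dependent_wellorder_choice)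
    fix r :: "'i \<times> 'a" and f g :: "nat \<Rightarrow> 'i \<times> 'a" and n :: nat
    assume "\<And>y. y < n \<Longrightarrow> f y = g y"
    then have "(\<Sum>k<n. \<bar>K (fst (f k))\<bar>) = (\<Sum>k<n. \<bar>K (fst (g k))\<bar>)" "(\<Sum>k<n. snd (f k)) = (\<Sum>k<n. snd (g k))"
      by auto
    then show "P f n r = P g n r" unfolding P_def by simp
  next
    fix n :: nat and g :: "nat \<Rightarrow> 'i \<times> 'a"
    assume prev: "\<And>y. y < n \<Longrightarrow> P g y (g y)"
    let ?s = "- (\<Sum>k<n. snd (g k))" and ?L = "1 + (\<Sum>k<n. \<bar>K (fst (g k))\<bar>)"
    have s: "?s \<in> U" using prev U unfolding P_def by (intro subspace_neg subspace_sum) auto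
    \<comment> \<open>Pointwise boundedness at the partial sum so far provides the level that the
      next seminorm value has to exceed, whichever index is chosen.\<close>
    then obtain M where M: "\<And>i. i \<in> I \<Longrightarrow> p i ?s \<le> M" using ptw by blast
    have L: "?L \<ge> 1" by (simp add: sum_nonneg)
    then have "?L > 0" by linarith
    then have "(1/2) ^ n / ?L > 0" "real n + 2 + \<bar>M\<bar> > 0" by (auto intro!: divide_pos_pos simp del: sum.lessThan_Suc)
    then obtain i \<xi> where i: "i \<in> I" "\<xi> \<in> U" "norm \<xi> \<le> (1/2) ^ n / ?L" "real n + 2 + \<bar>M\<bar> < p i \<xi>"
      using big by blast
    have "norm \<xi> * ?L \<le> (1/2) ^ n" using i(3) L by (simp add: le_divide_eq)
    then show "\<exists>r. P g n r" unfolding P_def using i M[OF i(1)]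
      by (intro exI[of _ "(i, \<xi>)"]) auto
  qed
  then obtain g where g: "\<And>n. P g n (g n)" by blast
  define i where "i n = fst (g n)" for n
  define \<xi> where "\<xi> n = snd (g n)" for n
  have I: "i n \<in> I" and \<xi>U: "\<xi> n \<in> U" and small: "norm (\<xi> n) * (1 + (\<Sum>k<n. \<bar>K (i k)\<bar>)) \<le> (1/2) ^ n"
    and large: "real n + 2 + p (i n) (- (\<Sum>k<n. \<xi> k)) \<le> p (i n) (\<xi> n)" for n
    using g[of n] by (simp_all add: P_def i_def \<xi>_def)
  have S0: "0 \<le> (\<Sum>k<n. \<bar>K (i k)\<bar>)" for n by (simp add: sum_nonneg)
  have norm_\<xi>: "norm (\<xi> n) \<le> (1/2) ^ n" for n
  proof -
    have "norm (\<xi> n) * 1 \<le> norm (\<xi> n) * (1 + (\<Sum>k<n. \<bar>K (i k)\<bar>))" using S0 by (intro mult_left_mono) auto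
    then show ?thesis using small[of n] by simp
  qed
  have half: "summable (\<lambda>n. (1/2::real) ^ n)" by (simp add: summable_geometric)
  have sum_norm: "summable (\<lambda>n. norm (\<xi> n))"
    by (rule summable_comparison_test'[OF half]) (use norm_\<xi> in simp)
  then have sum_\<xi>: "summable \<xi>" by (rule summable_norm_cancel)
  define x where "x = suminf \<xi>"
  have partial: "(\<Sum>k<n. \<xi> k) \<in> U" for n using U \<xi>U by (intro subspace_sum) auto
  have tail_U: "(\<Sum>k. \<xi> (k + n)) \<in> U" for n
  proof -
    have "(\<lambda>m. \<Sum>k<m. \<xi> (k + n)) \<longlonglongrightarrow> (\<Sum>k. \<xi> (k + n))"
      using sum_\<xi> by (intro summable_LIMSEQ) (simp add: summable_iff_shift)
    moreover have "(\<Sum>k<m. \<xi> (k + n)) \<in> U" for m using U \<xi>U by (intro subspace_sum) auto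
    ultimately show ?thesis using closed_sequentially[OF U(2), of "\<lambda>m. \<Sum>k<m. \<xi> (k + n)"] by blast
  qed
  have xU: "x \<in> U" using tail_U[of 0] by (simp add: x_def)
  have "real n \<le> p (i n) x" for n
  proof -
    let ?t = "\<Sum>k. \<xi> (k + Suc n)" and ?s = "\<Sum>k<n. \<xi> k"
    have x_split: "x = ?s + \<xi> n + ?t"
      using suminf_split_initial_segment[OF sum_\<xi>, of "Suc n"] by (simp add: x_def)
    have tail_term: "\<bar>K (i n)\<bar> * norm (\<xi> (k + Suc n)) \<le> (1/2) ^ (k + Suc n)" for k
    proof -
      have "\<bar>K (i n)\<bar> \<le> (\<Sum>j<k + Suc n. \<bar>K (i j)\<bar>)"
        by (rule member_le_sum) auto
      then have "\<bar>K (i n)\<bar> * norm (\<xi> (k + Suc n)) \<le> (1 + (\<Sum>j<k + Suc n. \<bar>K (i j)\<bar>)) * norm (\<xi> (k + Suc n))"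
        by (intro mult_right_mono) auto
      then show ?thesis using small[of "k + Suc n"] by (simp add: mult.commute)
    qed
    have st: "summable (\<lambda>k. norm (\<xi> (k + Suc n)))" by (rule summable_ignore_initial_segment[OF sum_norm])
    have sh: "summable (\<lambda>k. (1/2::real) ^ (k + Suc n))" by (rule summable_ignore_initial_segment[OF half])
    have "p (i n) (- ?t) \<le> \<bar>K (i n)\<bar> * norm ?t"
    proof -
      have "p (i n) (- ?t) \<le> K (i n) * norm (- ?t)" using bnd[OF I] tail_U U subspace_neg by blast
      also have "\<dots> \<le> \<bar>K (i n)\<bar> * norm ?t" by (auto intro: mult_right_mono)
      finally show ?thesis .
    qed
    also have "\<dots> \<le> \<bar>K (i n)\<bar> * (\<Sum>k. norm (\<xi> (k + Suc n)))"
      by (intro mult_left_mono summable_norm st) auto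
    also have "\<dots> = (\<Sum>k. \<bar>K (i n)\<bar> * norm (\<xi> (k + Suc n)))" using st by (rule suminf_mult[symmetric])
    also have "\<dots> \<le> (\<Sum>k. (1/2::real) ^ (k + Suc n))"
      by (intro suminf_le tail_term sh summable_mult st)
    also have "\<dots> = (\<Sum>k. (1/2) ^ Suc n * (1/2::real) ^ k)" by (simp only: power_add mult.commute)
    also have "\<dots> = (1/2) ^ Suc n * (\<Sum>k. (1/2::real) ^ k)" by (rule suminf_mult[OF half])
    also have "\<dots> \<le> 1" by (simp add: suminf_geometric power_le_one)
    finally have t: "p (i n) (- ?t) \<le> 1" .
    have e: "\<xi> n = x + (- ?s) + (- ?t)" using x_split by simp
    have sU: "- ?s \<in> U" using partial U subspace_neg by blast
    have tU: "- ?t \<in> U" using tail_U U subspace_neg by blast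
    have "p (i n) (\<xi> n) \<le> p (i n) (x + (- ?s)) + p (i n) (- ?t)"
      unfolding e by (rule tri[OF I subspace_add[OF U(1) xU sU] tU])
    also have "p (i n) (x + (- ?s)) \<le> p (i n) x + p (i n) (- ?s)" by (rule tri[OF I xU sU])
    finally have "p (i n) (\<xi> n) \<le> p (i n) x + p (i n) (- ?s) + p (i n) (- ?t)" by simp
    then show ?thesis using t large[of n] by simp
  qed
  moreover obtain M where "\<And>i. i \<in> I \<Longrightarrow> p i x \<le> M" using ptw xU by blast
  ultimately have "real n \<le> M" for n using I order_trans by blast
  then show False by (metis not_le reals_Archimedean2)
qed

section \<open>Functionals and automorphisms of the scalar field\<close>

lemma to_complex_0 [simp]: "to_complex (0 :: 'f::real_or_complex) = 0"
  using cmod_to_complex[of "0::'f"] by simp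

lemma to_complex_1 [simp]: "to_complex (1 :: 'f::real_or_complex) = 1"
proof -
  have "to_complex (1::'f) * to_complex (1::'f) = to_complex (1::'f)"
    using to_complex_mult[of "1::'f" 1] by simp
  moreover have "to_complex (1::'f) \<noteq> 0" using cmod_to_complex[of "1::'f"] by auto
  ultimately show ?thesis by simp
qed

lemma to_complex_minus: "to_complex (- x :: 'f::real_or_complex) = - to_complex x"
  using to_complex_add[of x "- x"] by (simp add: eq_neg_iff_add_eq_0 add.commute)

lemma to_complex_diff: "to_complex (x - y :: 'f::real_or_complex) = to_complex x - to_complex y"
  using to_complex_add[of x "- y"] by (simp add: to_complex_minus)

lemma to_complex_of_real [simp]: "to_complex (of_real r :: 'f::real_or_complex) = of_real r"
  unfolding of_real_def to_complex_scaleR by simp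

lemma to_complex_eq_iff: "to_complex x = to_complex y \<longleftrightarrow> (x :: 'f::real_or_complex) = y"
proof
  assume "to_complex x = to_complex y"
  then have "cmod (to_complex (x - y)) = 0" by (simp add: to_complex_diff)
  then have "norm (x - y) = 0" by (simp only: cmod_to_complex)
  then show "x = y" by simp
qed simp

lemma real_or_complex_cases:
  obtains (real) "\<And>c::'f::real_or_complex. \<exists>r. c = of_real r"
  | (complex) j :: "'f::real_or_complex" where "to_complex j = \<i>" "\<And>c::'f::real_or_complex. \<exists>a b. c = of_real a + of_real b * j"
proof (cases "range (to_complex :: 'f \<Rightarrow> complex) = \<real>")
  case True
  have "\<exists>r. c = of_real r" for c :: 'f
  proof -
    have "to_complex c \<in> \<real>" using True by blast
    then obtain r where "to_complex c = to_complex (of_real r :: 'f)" by (auto elim: Reals_cases)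
    then show ?thesis using to_complex_eq_iff by blast
  qed
  then show ?thesis by (rule real)
next
  case False
  then have "range (to_complex :: 'f \<Rightarrow> complex) = UNIV" using range_to_complex by blast
  then obtain j :: 'f where j: "to_complex j = \<i>" by (metis UNIV_I image_iff)
  have "\<exists>a b. c = of_real a + of_real b * j" for c :: 'f
  proof -
    have "to_complex c = to_complex (of_real (Re (to_complex c)) + of_real (Im (to_complex c)) * j :: 'f)"
      by (simp add: to_complex_add to_complex_mult j complex_eq_iff)
    then show ?thesis using to_complex_eq_iff by blast
  qed
  with j show ?thesis by (rule complex)
qed

lemma norm_scalar_conj: "norm (scalar_conj c) = norm (c :: 'f::real_or_complex)"
  by (metis cmod_to_complex complex_mod_cnj to_complex_scalar_conj)

lemma scalar_conj_add: "scalar_conj (x + y) = scalar_conj x + scalar_conj (y :: 'f::real_or_complex)"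
  by (simp add: to_complex_eq_iff[symmetric] to_complex_add to_complex_scalar_conj)

lemma scalar_conj_mult: "scalar_conj (x * y) = scalar_conj x * scalar_conj (y :: 'f::real_or_complex)"
  by (simp add: to_complex_eq_iff[symmetric] to_complex_mult to_complex_scalar_conj)

lemma scalar_conj_of_real: "scalar_conj (of_real r) = (of_real r :: 'f::real_or_complex)"
  by (simp add: to_complex_eq_iff[symmetric] to_complex_scalar_conj)

text \<open>Every automorphism fixes the rationals. On the reals \<theta>(s) - s is additive and
  vanishes at rationals, so a bound near 0 bounds it everywhere, and additivity makes it zero. An
  imaginary unit can only go to itself or to its negative.\<close>

lemma bounded_automorphism:
  fixes \<theta> :: "'f::real_or_complex \<Rightarrow> 'f"
  assumes aut: "field_automorphism \<theta>" and \<delta>: "\<delta> > 0" and bnd: "\<And>c. norm c \<le> \<delta> \<Longrightarrow> norm (\<theta> c) \<le> K"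
  shows "(\<forall>c. \<theta> c = c) \<or> (\<forall>c. \<theta> c = scalar_conj c)"
proof -
  note F = field_automorphism_facts[OF aut]
  have minus: "\<theta> (- x) = - \<theta> x" for x
    using F(1)[of x "- x"] F(4) by (simp add: eq_neg_iff_add_eq_0 add.commute)
  have diff: "\<theta> (x - y) = \<theta> x - \<theta> y" for x y using F(1)[of x "- y"] minus by simp
  have of_nat: "\<theta> (of_nat n) = of_nat n" for n by (induction n) (simp_all add: F(1,3,4))
  have of_int: "\<theta> (of_int k) = of_int k" for k
    by (cases k) (simp_all add: of_nat minus diff F(3))
  have rat: "\<theta> (of_real q) = of_real q" if "q \<in> \<rat>" for q
  proof -
    obtain a b where ab: "b \<noteq> 0" "q = of_int a / of_int b" using \<open>q \<in> \<rat>\<close> by (metis Rats_cases' less_irrefl)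
    have "(of_real q :: 'f) * of_int b = of_int a" using ab by simp
    then have "\<theta> (of_real q) * of_int b = of_int a" using F(2)[of "of_real q" "of_int b"] of_int by metis
    also have "\<dots> = of_real q * of_int b" using ab by simp
    finally have "\<theta> (of_real q) * of_int b = of_real q * of_int b" .
    moreover have "(of_int b :: 'f) \<noteq> 0" using ab by simp
    ultimately show ?thesis by (metis mult_right_cancel)
  qed
  have real: "\<theta> (of_real r) = of_real r" for r
  proof (rule ccontr)
    define g where "g s = \<theta> (of_real s) - of_real s" for s
    assume "\<not> ?thesis"
    then have gr: "norm (g r) > 0" by (simp add: g_def)
    have g_add: "g (s + t) = g s + g t" for s t by (simp add: g_def F(1))
    have g_mult: "g (real n * s) = of_nat n * g s" for n s
      by (simp add: g_def F(2) of_nat algebra_simps)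
    obtain n where n: "real n * norm (g r) > K + \<delta>" using gr reals_Archimedean3 by blast
    \<comment> \<open>Subtracting a rational within \<delta> of n r does not change the value of
      \<open>g\<close>, so n times the norm of \<open>g r\<close> stays below K + \<delta>.\<close>
    obtain q where q: "q \<in> \<rat>" "real n * r - \<delta> < q" "q < real n * r"
      using Rats_dense_in_real[of "real n * r - \<delta>" "real n * r"] \<delta> by auto
    have "g (real n * r) = g (real n * r - q) + g q" using g_add[of "real n * r - q" q] by simp
    also have "g q = 0" using rat q by (simp add: g_def)
    finally have "real n * norm (g r) = norm (g (real n * r - q))"
      using g_mult[of n r] by (metis add_0_right norm_mult norm_of_nat)
    also have "\<dots> \<le> norm (\<theta> (of_real (real n * r - q))) + norm (of_real (real n * r - q) :: 'f)"
      unfolding g_def by (rule norm_triangle_ineq4)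
    also have "\<dots> \<le> K + \<delta>"
      using bnd[of "of_real (real n * r - q)"] q by (intro add_mono) (simp_all del: of_real_diff of_real_mult)
    finally show False using n by simp
  qed
  show ?thesis
  proof (cases rule: real_or_complex_cases[where 'f = 'f])
    case real
    then show ?thesis using \<open>\<And>r. \<theta> (of_real r) = of_real r\<close> by metis
  next
    case (complex j)
    have conj_j: "scalar_conj j = - j"
      by (simp add: to_complex_eq_iff[symmetric] to_complex_scalar_conj to_complex_minus complex(1))
    have "j * j = - 1"
      by (simp add: to_complex_eq_iff[symmetric] to_complex_mult to_complex_minus complex(1))
    then have "\<theta> j * \<theta> j = j * j" using F(2)[of j j] minus[of 1] F(3) by simp
    then have "\<theta> j = j \<or> \<theta> j = - j" using square_eq_iff by blast
    moreover have "\<theta> c = c" if "\<theta> j = j" for c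
      using complex(2)[of c] that \<open>\<And>r. \<theta> (of_real r) = of_real r\<close> by (auto simp: F(1,2))
    moreover have "\<theta> c = scalar_conj c" if "\<theta> j = - j" for c
      using complex(2)[of c] that \<open>\<And>r. \<theta> (of_real r) = of_real r\<close>
      by (auto simp: F(1,2) scalar_conj_add scalar_conj_mult scalar_conj_of_real conj_j)
    ultimately show ?thesis by blast
  qed
qed

context banach_space_over
begin

definition functionals :: "('x \<Rightarrow> 'f) set" where
  "functionals = blinfun_apply ` dual scl"

definition operators :: "('x \<Rightarrow> 'x) set" where
  "operators = blinfun_apply ` bounded_ops scl"

lemma blinfun_in_dual_iff:
  "f \<in> dual scl \<longleftrightarrow> (\<forall>c x. blinfun_apply f (scl c x) = c * blinfun_apply f x)"
proof
  assume "f \<in> dual scl"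
  then interpret f: Vector_Spaces.linear scl "(*)" "blinfun_apply f" by (simp add: dual_def)
  show "\<forall>c x. blinfun_apply f (scl c x) = c * blinfun_apply f x" by (simp add: f.scale)
next
  assume *: "\<forall>c x. blinfun_apply f (scl c x) = c * blinfun_apply f x"
  have "Vector_Spaces.linear scl (*) (blinfun_apply f)"
    by unfold_locales (auto simp: * blinfun.add_right algebra_simps)
  then show "f \<in> dual scl" by (simp add: dual_def)
qed

lemma blinfun_in_bounded_ops_iff:
  "T \<in> bounded_ops scl \<longleftrightarrow> (\<forall>c x. blinfun_apply T (scl c x) = scl c (blinfun_apply T x))"
proof
  assume "T \<in> bounded_ops scl"
  then interpret T: Vector_Spaces.linear scl scl "blinfun_apply T" by (simp add: bounded_ops_def)
  show "\<forall>c x. blinfun_apply T (scl c x) = scl c (blinfun_apply T x)" by (simp add: T.scale)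
next
  assume *: "\<forall>c x. blinfun_apply T (scl c x) = scl c (blinfun_apply T x)"
  have "Vector_Spaces.linear scl scl (blinfun_apply T)"
    by unfold_locales (auto simp: * blinfun.add_right)
  then show "T \<in> bounded_ops scl" by (simp add: bounded_ops_def)
qed

lemma blinfun_in_conj_bounded_ops_iff:
  "T \<in> conj_bounded_ops scl \<longleftrightarrow> (\<forall>c x. blinfun_apply T (scl c x) = scl (scalar_conj c) (blinfun_apply T x))"
proof
  assume "T \<in> conj_bounded_ops scl"
  then interpret T: Vector_Spaces.linear scl "\<lambda>c. scl (scalar_conj c)" "blinfun_apply T"
    by (simp add: conj_bounded_ops_def)
  show "\<forall>c x. blinfun_apply T (scl c x) = scl (scalar_conj c) (blinfun_apply T x)" by (simp add: T.scale)
next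
  assume *: "\<forall>c x. blinfun_apply T (scl c x) = scl (scalar_conj c) (blinfun_apply T x)"
  have "scalar_conj (1::'f) = 1" using scalar_conj_of_real[of 1] by simp
  then have "Vector_Spaces.linear scl (\<lambda>c. scl (scalar_conj c)) (blinfun_apply T)"
    by unfold_locales (auto simp: * blinfun.add_right scale_right_distrib scale_left_distrib
        scalar_conj_add scalar_conj_mult)
  then show "T \<in> conj_bounded_ops scl" by (simp add: conj_bounded_ops_def)
qed

lemma scaleR_scl: "r *\<^sub>R x = scl (of_real r) x"
  by (simp add: scl_of_real)

lemma functionals_iff: "f \<in> functionals \<longleftrightarrow> (\<forall>x y. f (x + y) = f x + f y)
    \<and> (\<forall>c x. f (scl c x) = c * f x) \<and> (\<exists>K. \<forall>x. norm (f x) \<le> K * norm x)"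
proof
  assume "f \<in> functionals"
  then obtain F where "f = blinfun_apply F" "F \<in> dual scl" unfolding functionals_def by blast
  then show "(\<forall>x y. f (x + y) = f x + f y) \<and> (\<forall>c x. f (scl c x) = c * f x) \<and> (\<exists>K. \<forall>x. norm (f x) \<le> K * norm x)"
    using norm_blinfun[of F] by (auto simp: blinfun_in_dual_iff blinfun.add_right)
next
  assume *: "(\<forall>x y. f (x + y) = f x + f y) \<and> (\<forall>c x. f (scl c x) = c * f x) \<and> (\<exists>K. \<forall>x. norm (f x) \<le> K * norm x)"
  then obtain K where "\<And>x. norm (f x) \<le> norm x * K" by (metis mult.commute)
  then have "bounded_linear f"
    using * by (intro bounded_linear_intro) (auto simp: scaleR_scl scaleR_conv_of_real)
  then have "f = blinfun_apply (Blinfun f)" by (simp add: bounded_linear_Blinfun_apply)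
  moreover from this have "Blinfun f \<in> dual scl" using * by (metis blinfun_in_dual_iff)
  ultimately show "f \<in> functionals" unfolding functionals_def by blast
qed

lemma operators_iff: "T \<in> operators \<longleftrightarrow> (\<forall>x y. T (x + y) = T x + T y)
    \<and> (\<forall>c x. T (scl c x) = scl c (T x)) \<and> (\<exists>K. \<forall>x. norm (T x) \<le> K * norm x)"
proof
  assume "T \<in> operators"
  then obtain F where "T = blinfun_apply F" "F \<in> bounded_ops scl" unfolding operators_def by blast
  then show "(\<forall>x y. T (x + y) = T x + T y) \<and> (\<forall>c x. T (scl c x) = scl c (T x)) \<and> (\<exists>K. \<forall>x. norm (T x) \<le> K * norm x)"
    using norm_blinfun[of F] by (auto simp: blinfun_in_bounded_ops_iff blinfun.add_right)
next
  assume *: "(\<forall>x y. T (x + y) = T x + T y) \<and> (\<forall>c x. T (scl c x) = scl c (T x)) \<and> (\<exists>K. \<forall>x. norm (T x) \<le> K * norm x)"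
  then obtain K where "\<And>x. norm (T x) \<le> norm x * K" by (metis mult.commute)
  then have "bounded_linear T"
    using * by (intro bounded_linear_intro) (auto simp: scaleR_scl)
  then have "T = blinfun_apply (Blinfun T)" by (simp add: bounded_linear_Blinfun_apply)
  moreover from this have "Blinfun T \<in> bounded_ops scl" using * by (metis blinfun_in_bounded_ops_iff)
  ultimately show "T \<in> operators" unfolding operators_def by blast
qed

lemma functional_bound:
  assumes "f \<in> functionals" obtains K where "K \<ge> 0" "\<And>x. norm (f x) \<le> K * norm x"
proof -
  obtain K where K: "\<And>x. norm (f x) \<le> K * norm x" using assms functionals_iff by blast
  have "norm (f x) \<le> \<bar>K\<bar> * norm x" for x
    using K[of x] by (meson abs_ge_self mult_right_mono norm_ge_zero order_trans)
  then show thesis using that[of "\<bar>K\<bar>"] by simp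
qed

lemma functionals_comb:
  assumes fg: "f \<in> functionals" "g \<in> functionals"
  shows "(\<lambda>x. a * f x + b * g x) \<in> functionals"
proof -
  obtain K where K: "\<And>x. norm (f x) \<le> K * norm x" using functional_bound[OF fg(1)] by blast
  obtain L where L: "\<And>x. norm (g x) \<le> L * norm x" using functional_bound[OF fg(2)] by blast
  have "norm (a * f x + b * g x) \<le> (norm a * K + norm b * L) * norm x" for x
  proof -
    have "norm (a * f x + b * g x) \<le> norm a * norm (f x) + norm b * norm (g x)"
      by (metis norm_mult norm_triangle_ineq)
    also have "\<dots> \<le> norm a * (K * norm x) + norm b * (L * norm x)"
      using K L by (intro add_mono mult_left_mono) auto
    finally show ?thesis by (simp add: algebra_simps)
  qed
  then have "\<exists>K. \<forall>x. norm (a * f x + b * g x) \<le> K * norm x" by blast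
  then show ?thesis using fg unfolding functionals_iff by (simp add: algebra_simps)
qed

lemma functionals_cmult: "f \<in> functionals \<Longrightarrow> (\<lambda>x. c * f x) \<in> functionals"
  using functionals_comb[of f f c 0] by simp

lemma functionals_add: "f \<in> functionals \<Longrightarrow> g \<in> functionals \<Longrightarrow> (\<lambda>x. f x + g x) \<in> functionals"
  using functionals_comb[of f g 1 1] by simp

text \<open>In the complex case a real functional \<open>u\<close> is complexified to u(x) - j
  u(jx). Rotating f(x) onto the positive reals carries the bound by the norm over from the real part
  to \<open>f\<close>.\<close>

lemma exists_norming_functional:
  "\<exists>f\<in>functionals. (\<forall>x. norm (f x) \<le> norm x) \<and> norm (f x0) = norm x0"
proof -
  obtain u :: "'x \<Rightarrow> real" where u: "\<And>x y. u (x + y) = u x + u y" "\<And>t x. u (t *\<^sub>R x) = t * u x"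
    "\<And>x. u x \<le> norm x" "u x0 = norm x0"
    using exists_real_norming_functional[of x0] by blast
  have u_minus: "u (- x) = - u x" for x using u(2)[of "-1" x] by simp
  have "\<exists>f::'x \<Rightarrow> 'f. (\<forall>x y. f (x + y) = f x + f y) \<and> (\<forall>c x. f (scl c x) = c * f x)
      \<and> (\<forall>x. Re (to_complex (f x)) = u x)"
  proof (cases rule: real_or_complex_cases[where 'f = 'f])
    case real
    have "of_real (u (scl c x)) = c * of_real (u x)" for c x
    proof -
      obtain r where "c = of_real r" using real by blast
      then show ?thesis using u(2)[of r x] by (simp add: scl_of_real)
    qed
    then show ?thesis using u by (intro exI[of _ "\<lambda>x. of_real (u x)"]) simp
  next
    case (complex j)
    define f where "f x = of_real (u x) - j * of_real (u (scl j x))" for x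
    have jj: "j * j = - 1"
      by (simp add: to_complex_eq_iff[symmetric] to_complex_mult to_complex_minus complex(1))
    have add: "f (x + y) = f x + f y" for x y
      by (simp add: f_def u scale_right_distrib algebra_simps)
    have fr: "f (scl (of_real r) x) = of_real r * f x" for r x
    proof -
      have "scl j (scl (of_real r) x) = r *\<^sub>R scl j x" by (simp add: scaleR_scl mult.commute)
      then show ?thesis by (simp add: f_def u(2) scl_of_real algebra_simps)
    qed
    have fj: "f (scl j x) = j * f x" for x
    proof -
      have "f (scl j x) = of_real (u (scl j x)) + j * of_real (u x)"
        by (simp add: f_def jj u_minus)
      also have "\<dots> = j * of_real (u x) - (j * j) * of_real (u (scl j x))" by (simp add: jj)
      also have "\<dots> = j * f x" by (simp add: f_def algebra_simps)
      finally show ?thesis .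
    qed
    have "f (scl c x) = c * f x" for c x
    proof -
      obtain a b where c: "c = of_real a + of_real b * j" using complex by blast
      have "scl c x = scl (of_real a) x + scl (of_real b) (scl j x)"
        by (simp add: c scale_left_distrib)
      then have "f (scl c x) = of_real a * f x + of_real b * (j * f x)" by (simp only: add fr fj)
      then show ?thesis by (simp add: c algebra_simps)
    qed
    moreover have "Re (to_complex (f x)) = u x" for x
      by (simp add: f_def to_complex_diff to_complex_mult complex(1))
    ultimately show ?thesis using add by blast
  qed
  then obtain f :: "'x \<Rightarrow> 'f" where f: "\<And>x y. f (x + y) = f x + f y" "\<And>c x. f (scl c x) = c * f x"
    "\<And>x. Re (to_complex (f x)) = u x" by blast
  have le: "norm (f x) \<le> norm x" for x
  proof (cases "f x = 0")
    case False
    define e where "e = of_real (norm (f x)) / f x"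
    have "norm e = 1" using False by (simp add: e_def norm_divide)
    have "f (scl e x) = of_real (norm (f x))" using False f(2) by (simp add: e_def)
    then have "norm (f x) = u (scl e x)" using f(3)[of "scl e x"] by simp
    also have "\<dots> \<le> norm (scl e x)" by (rule u(3))
    finally show ?thesis using \<open>norm e = 1\<close> by (simp add: norm_scl)
  qed simp
  moreover have "norm x0 \<le> norm (f x0)"
    using abs_Re_le_cmod[of "to_complex (f x0)"] f(3)[of x0] u(4) by (simp add: cmod_to_complex)
  moreover have "f \<in> functionals" unfolding functionals_iff using f le by (metis mult_1)
  ultimately show ?thesis using antisym by blast
qed

lemma operator_system_functionals:
  assumes dim: "\<And>x y. \<exists>z. z \<notin> span {x, y}"
  shows "operator_system scl functionals operators"
proof (unfold_locales, goal_cases)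
  case (3 f g a b)
  then show ?case by (rule functionals_comb)
next
  case (4 x)
  obtain f where "f \<in> functionals" "norm (f x) = norm x" using exists_norming_functional by blast
  then show ?case using 4 by (intro bexI[of _ f]) auto
next
  case (7 f x)
  obtain K where K: "\<And>y. norm (f y) \<le> K * norm y" using functional_bound 7 by metis
  have "norm (scl (f y) x) \<le> (K * norm x) * norm y" for y
    using mult_right_mono[OF K[of y], of "norm x"] by (simp add: norm_scl mult_ac)
  then have "\<exists>K. \<forall>y. norm (scl (f y) x) \<le> K * norm y" by blast
  then show ?case using 7 unfolding operators_iff functionals_iff by (simp add: scale_left_distrib)
next
  case (8 T U)
  obtain K L where KL: "\<And>x. norm (T x) \<le> K * norm x" "\<And>x. norm (U x) \<le> L * norm x"
    using 8 operators_iff by metis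
  have "norm (T x + U x) \<le> (K + L) * norm x" for x
    using norm_triangle_ineq[of "T x" "U x"] KL[of x] by (simp add: distrib_right)
  then have "\<exists>K. \<forall>x. norm (T x + U x) \<le> K * norm x" by blast
  then show ?case using 8 unfolding operators_iff by (simp add: scale_right_distrib)
next
  case (9 f T)
  obtain K L where K: "K \<ge> 0" "\<And>x. norm (f x) \<le> K * norm x" and L: "\<And>x. norm (T x) \<le> L * norm x"
    using 9 operators_iff functional_bound by metis
  have "norm (f (T x)) \<le> (K * L) * norm x" for x
    using K(2)[of "T x"] mult_left_mono[OF L K(1)] by (simp add: mult.assoc) (meson order_trans)
  then have "\<exists>K. \<forall>x. norm (f (T x)) \<le> K * norm x" by blast
  then show ?case using 9 unfolding operators_iff functionals_iff by simp
qed (auto simp: functionals_iff operators_iff dim)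

text \<open>Uniform boundedness for the seminorms |f(Ax)| with \<open>f\<close> of norm at most one:
  at fixed \<open>x\<close> they are bounded by norm (A x), and a norming functional recovers that
  norm. The domain is a closed subspace \<open>U\<close> because the dual space is one inside the
  type of bounded real-linear maps.\<close>

lemma bounded_if_weakly_bounded:
  fixes A :: "'u::banach \<Rightarrow> 'x" and U :: "'u set"
  assumes U: "Real_Vector_Spaces.subspace U" "closed U"
    and add: "\<And>x y. x \<in> U \<Longrightarrow> y \<in> U \<Longrightarrow> A (x + y) = A x + A y"
    and scale: "\<And>r x. x \<in> U \<Longrightarrow> A (r *\<^sub>R x) = r *\<^sub>R A x"
    and weak: "\<And>f. f \<in> functionals \<Longrightarrow> \<exists>K. \<forall>x\<in>U. norm (f (A x)) \<le> K * norm x"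
  shows "\<exists>K. \<forall>x\<in>U. norm (A x) \<le> K * norm x"
proof -
  let ?I = "{f \<in> functionals. \<forall>x. norm (f x) \<le> norm x}"
  obtain K where K: "\<And>f x. f \<in> functionals \<Longrightarrow> x \<in> U \<Longrightarrow> norm (f (A x)) \<le> K f * norm x"
    using weak by metis
  have "\<exists>C. \<forall>f\<in>?I. \<forall>x\<in>U. norm (f (A x)) \<le> C * norm x"
  proof (rule uniform_boundedness[OF U])
    show "norm (f (A (x + y))) \<le> norm (f (A x)) + norm (f (A y))"
      if "f \<in> ?I" "x \<in> U" "y \<in> U" for f x y
      using that by (simp add: add functionals_iff norm_triangle_ineq)
    show "norm (f (A (r *\<^sub>R x))) = \<bar>r\<bar> * norm (f (A x))" if "f \<in> ?I" "x \<in> U" for f x r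
      using that by (simp add: scale functionals_iff scaleR_scl norm_mult)
    show "norm (f (A x)) \<le> K f * norm x" if "f \<in> ?I" "x \<in> U" for f x using that K by simp
    show "\<exists>M. \<forall>f\<in>?I. norm (f (A x)) \<le> M" for x by (intro exI[of _ "norm (A x)"]) simp
  qed
  then obtain C where C: "\<And>f x. f \<in> ?I \<Longrightarrow> x \<in> U \<Longrightarrow> norm (f (A x)) \<le> C * norm x" by blast
  have "norm (A x) \<le> C * norm x" if "x \<in> U" for x
    using exists_norming_functional[of "A x"] C that by force
  then show ?thesis by blast
qed

text \<open>Gram-Schmidt with functionals in place of inner products: subtracting from a new vector
  its coordinates along the earlier ones makes the earlier functionals vanish on it, and it stays
  outside the span of the earlier vectors, so a new dual functional exists.\<close>

lemma exists_biorthogonal_sequence: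
  assumes inf: "\<not> finite_dimensional scl"
    and sep: "\<And>F w. finite F \<Longrightarrow> w \<notin> span F \<Longrightarrow> \<exists>f\<in>functionals. (\<forall>v\<in>F. f v = 0) \<and> f w = 1"
  shows "\<exists>e f. (\<forall>n::nat. f n \<in> functionals) \<and> (\<forall>n. f n (e n) = 1) \<and> (\<forall>m n. m \<noteq> n \<longrightarrow> f m (e n) = 0)"
proof -
  define P where "P g n z \<longleftrightarrow> snd z \<in> functionals \<and> snd z (fst z) = 1 \<and>
      (\<forall>k<n. snd z (fst (g k)) = 0 \<and> snd (g k) (fst z) = 0)"
    for g :: "nat \<Rightarrow> 'x \<times> ('x \<Rightarrow> 'f)" and n z
  have "\<exists>g. \<forall>n. P g n (g n)"
  proof (rule dependent_wellorder_choice)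
    fix r and f g :: "nat \<Rightarrow> 'x \<times> ('x \<Rightarrow> 'f)" and n :: nat
    assume "\<And>y. y < n \<Longrightarrow> f y = g y"
    then show "P f n r = P g n r" unfolding P_def by auto
  next
    fix n :: nat and g :: "nat \<Rightarrow> 'x \<times> ('x \<Rightarrow> 'f)"
    assume prev: "\<And>y. y < n \<Longrightarrow> P g y (g y)"
    let ?F = "(\<lambda>k. fst (g k)) ` {..<n}"
    have fin: "finite ?F" by simp
    have "span ?F \<noteq> UNIV" using inf fin unfolding finite_dimensional_def by blast
    then obtain v where v: "v \<notin> span ?F" by blast
    define e where "e = v - (\<Sum>k<n. scl (snd (g k) v) (fst (g k)))"
    have "(\<Sum>k<n. scl (snd (g k) v) (fst (g k))) \<in> span ?F"
      by (intro span_sum span_scale span_base) auto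
    then have "e \<notin> span ?F" using v unfolding e_def by (metis diff_add_cancel span_add)
    then obtain h where h: "h \<in> functionals" "\<forall>v\<in>?F. h v = 0" "h e = 1" using sep[OF fin] by blast
    have "snd (g m) e = 0" if m: "m < n" for m
    proof -
      let ?f = "snd (g m)"
      have f: "?f \<in> functionals" using prev m unfolding P_def by blast
      then have f_add: "?f (x + y) = ?f x + ?f y" and f_scale: "?f (scl c x) = c * ?f x" for x y c
        by (auto simp: functionals_iff)
      have f0: "?f 0 = 0" using f_scale[of 0 0] by simp
      have f_sum: "?f (sum h A) = (\<Sum>k\<in>A. ?f (h k))" if "finite A" for h and A :: "nat set"
        using that by (induction A rule: finite_induct) (simp_all add: f0 f_add)
      have \<delta>: "?f (fst (g k)) = (if k = m then 1 else 0)" if k: "k < n" for k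
        using prev[OF k] prev[OF m] unfolding P_def by (cases k m rule: linorder_cases) auto
      have "?f v = ?f e + ?f (\<Sum>k<n. scl (snd (g k) v) (fst (g k)))"
        using f_add[of e "\<Sum>k<n. scl (snd (g k) v) (fst (g k))", symmetric] by (simp add: e_def)
      also have "?f (\<Sum>k<n. scl (snd (g k) v) (fst (g k))) = (\<Sum>k<n. snd (g k) v * (if k = m then 1 else 0))"
        by (simp add: f_sum f_scale \<delta>)
      also have "\<dots> = ?f v" using m by (simp add: if_distrib sum.delta cong: if_cong)
      finally show ?thesis by simp
    qed
    then show "\<exists>r. P g n r" unfolding P_def using h by (intro exI[of _ "(e, h)"]) auto
  qed
  then obtain g where g: "\<And>n. P g n (g n)" by blast
  show ?thesis
  proof (intro exI[of _ "\<lambda>n. fst (g n)"] exI[of _ "\<lambda>n. snd (g n)"] conjI allI impI)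
    show "snd (g n) \<in> functionals" "snd (g n) (fst (g n)) = 1" for n using g[of n] by (simp_all add: P_def)
    show "snd (g m) (fst (g n)) = 0" if "m \<noteq> n" for m n
      using g[of n] g[of m] that unfolding P_def by (cases m n rule: linorder_cases) auto
  qed
qed

text \<open>If \<open>\<theta>\<close> were unbounded near \<open>0\<close>, a norm convergent combination of a biorthogonal sequence would have
  coordinates whose images under \<open>\<theta>\<close> violate the given bound.\<close>

lemma automorphism_cases:
  assumes inf: "\<not> finite_dimensional scl"
    and sep: "\<And>F w. finite F \<Longrightarrow> w \<notin> span F \<Longrightarrow> \<exists>f\<in>functionals. (\<forall>v\<in>F. f v = 0) \<and> f w = 1"
    and aut: "field_automorphism \<theta>"
    and bnd: "\<And>x f. f \<in> functionals \<Longrightarrow> norm (\<theta> (f x)) \<le> M x * N f"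
  shows "(\<forall>c. \<theta> c = c) \<or> (\<forall>c. \<theta> c = scalar_conj c)"
proof (cases "\<exists>\<delta> K. \<delta> > 0 \<and> (\<forall>c. norm c \<le> \<delta> \<longrightarrow> norm (\<theta> c) \<le> K)")
  case True
  then show ?thesis using bounded_automorphism[OF aut] by blast
next
  case False
  then have unb: "\<exists>c. norm c \<le> \<delta> \<and> norm (\<theta> c) > K" if "\<delta> > 0" for \<delta> K
    using that by (meson not_le)
  have "\<exists>e f. (\<forall>n::nat. f n \<in> functionals) \<and> (\<forall>n. f n (e n) = 1) \<and> (\<forall>m n. m \<noteq> n \<longrightarrow> f m (e n) = 0)"
    by (rule exists_biorthogonal_sequence[OF inf sep])
  then obtain e f where H: "(\<forall>n::nat. f n \<in> functionals) \<and> (\<forall>n. f n (e n) = 1) \<and> (\<forall>m n. m \<noteq> n \<longrightarrow> f m (e n) = 0)"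
    by (elim exE)
  then have f: "\<And>n. f n \<in> functionals" "\<And>n. f n (e n) = 1" "\<And>m n. m \<noteq> n \<Longrightarrow> f m (e n) = 0"
    by simp_all
  \<comment> \<open>Small against \<open>e n\<close> for convergence, large under
    \<open>\<theta>\<close> against \<open>N (f n)\<close>; biorthogonality will make
    \<open>c n\<close> the value of \<open>f n\<close> at the sum of the series.\<close>
  have "\<exists>c. norm c \<le> (1/2) ^ n / (1 + norm (e n)) \<and> norm (\<theta> c) > real n * \<bar>N (f n)\<bar>" for n
    by (rule unb) (auto intro!: divide_pos_pos add_pos_nonneg)
  then obtain c where c: "\<And>n. norm (c n) \<le> (1/2) ^ n / (1 + norm (e n))" "\<And>n. norm (\<theta> (c n)) > real n * \<bar>N (f n)\<bar>"
    by metis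
  have small: "norm (scl (c n) (e n)) \<le> (1/2) ^ n" for n
  proof -
    have "norm (c n) * (1 + norm (e n)) \<le> (1/2) ^ n"
      using c(1)[of n] by (simp add: pos_le_divide_eq add_pos_nonneg)
    then have "norm (c n) + norm (c n) * norm (e n) \<le> (1/2) ^ n" by (simp add: distrib_left)
    then show ?thesis unfolding norm_scl using norm_ge_zero[of "c n"] by linarith
  qed
  have half: "summable (\<lambda>n. (1/2::real) ^ n)" by (simp add: summable_geometric)
  have "summable (\<lambda>n. norm (scl (c n) (e n)))"
    by (rule summable_comparison_test'[OF half]) (use small in simp)
  then have summ: "summable (\<lambda>n. scl (c n) (e n))" by (rule summable_norm_cancel)
  define x where "x = (\<Sum>n. scl (c n) (e n))"
  have fx: "f m x = c m" for m
  proof -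
    obtain F where F: "f m = blinfun_apply F" using f(1)[of m] unfolding functionals_def by blast
    have "(\<lambda>n. f m (scl (c n) (e n))) sums f m x"
      unfolding F x_def by (intro bounded_linear.sums[OF blinfun.bounded_linear_right] summable_sums summ)
    moreover have "f m (scl (c n) (e n)) = (if n = m then c m else 0)" for n
      using f by (auto simp: functionals_iff)
    moreover have "(\<lambda>n. if n = m then c m else 0) sums c m" using sums_single[of m "\<lambda>_. c m"] by simp
    ultimately show ?thesis using sums_unique2 by fastforce
  qed
  obtain n where n: "\<bar>M x\<bar> < real n" using reals_Archimedean2 by blast
  have "real n * \<bar>N (f n)\<bar> < norm (\<theta> (f n x))" using c(2)[of n] by (simp add: fx)
  also have "\<dots> \<le> M x * N (f n)" using bnd f(1) by blast
  also have "\<dots> \<le> \<bar>M x\<bar> * \<bar>N (f n)\<bar>" by (metis abs_ge_self abs_mult)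
  also have "\<dots> \<le> real n * \<bar>N (f n)\<bar>" using n by (intro mult_right_mono) auto
  finally show ?thesis by simp
qed

end

section \<open>Bounded form and matrices\<close>

text \<open>The scalars inherit completeness from their closed image in the complex numbers. This
  makes the bounded maps into the scalars a Banach space, to which uniform boundedness is
  applied.\<close>

instance real_or_complex \<subseteq> banach
proof
  fix X :: "nat \<Rightarrow> 'a::real_or_complex"
  assume "Cauchy X"
  have dist: "dist (to_complex x) (to_complex y) = dist x y" for x y :: 'a
    by (simp add: dist_norm cmod_to_complex flip: to_complex_diff)
  have "Cauchy (\<lambda>n. to_complex (X n))" using \<open>Cauchy X\<close> by (simp add: Cauchy_def dist)
  then obtain z where z: "(\<lambda>n. to_complex (X n)) \<longlonglongrightarrow> z" using Cauchy_convergent convergent_def by blast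
  have "z \<in> range (to_complex :: 'a \<Rightarrow> complex)"
    using range_to_complex
  proof
    assume R: "range (to_complex :: 'a \<Rightarrow> complex) = \<real>"
    have "to_complex (X n) \<in> \<real>" for n using R by blast
    then show ?thesis using closed_sequentially[OF closed_complex_Reals _ z] R by blast
  qed simp
  then obtain l :: 'a where "z = to_complex l" by blast
  then have "X \<longlonglongrightarrow> l" using z by (simp add: lim_sequentially dist)
  then show "convergent X" by (rule convergentI)
qed

lemma ascent_kernel_index: "ascent T = kernel_index (blinfun_apply T)"
  by (simp add: ascent_def kernel_index_def)

lemma descent_range_index: "descent T = range_index (blinfun_apply T)"
  by (simp add: descent_def range_index_def)

context banach_space_over
begin

lemma sandwich_preserver_blinfun:
  assumes dim: "\<And>x y. \<exists>z. z \<notin> span {x, y}"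
    and onto: "\<phi> ` bounded_ops scl = bounded_ops scl"
    and pres: "(\<forall>A\<in>bounded_ops scl. \<forall>B\<in>bounded_ops scl.
            ascent (A o\<^sub>L B o\<^sub>L A) = ascent (\<phi> A o\<^sub>L \<phi> B o\<^sub>L \<phi> A))
       \<or> (\<forall>A\<in>bounded_ops scl. \<forall>B\<in>bounded_ops scl.
            descent (A o\<^sub>L B o\<^sub>L A) = descent (\<phi> A o\<^sub>L \<phi> B o\<^sub>L \<phi> A))"
  shows "\<exists>idx. sandwich_preserver scl functionals operators idx (\<lambda>t. blinfun_apply (\<phi> (Blinfun t)))"
proof -
  let ?\<phi> = "\<lambda>t. blinfun_apply (\<phi> (Blinfun t))"
  interpret operator_system scl functionals operators by (rule operator_system_functionals[OF dim])
  have onto': "?\<phi> ` operators = operators"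
    unfolding operators_def image_image by (simp add: blinfun_apply_inverse image_image[symmetric] onto)
  have comp: "(\<lambda>v. A (B (A v))) = blinfun_apply (A o\<^sub>L B o\<^sub>L A)" for A B :: "'x \<Rightarrow>\<^sub>L 'x"
    by (simp add: fun_eq_iff)
  from pres show ?thesis
  proof
    assume *: "\<forall>A\<in>bounded_ops scl. \<forall>B\<in>bounded_ops scl.
      ascent (A o\<^sub>L B o\<^sub>L A) = ascent (\<phi> A o\<^sub>L \<phi> B o\<^sub>L \<phi> A)"
    interpret operator_index scl functionals operators kernel_index by (rule operator_index_kernel_index)
    have "sandwich_preserver scl functionals operators kernel_index ?\<phi>"
      by unfold_locales (use * onto' in \<open>auto simp: operators_def comp ascent_kernel_index blinfun_apply_inverse\<close>)
    then show ?thesis by blast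
  next
    assume *: "\<forall>A\<in>bounded_ops scl. \<forall>B\<in>bounded_ops scl.
      descent (A o\<^sub>L B o\<^sub>L A) = descent (\<phi> A o\<^sub>L \<phi> B o\<^sub>L \<phi> A)"
    interpret operator_index scl functionals operators range_index by (rule operator_index_range_index)
    have "sandwich_preserver scl functionals operators range_index ?\<phi>"
      by unfold_locales (use * onto' in \<open>auto simp: operators_def comp descent_range_index blinfun_apply_inverse\<close>)
    then show ?thesis by blast
  qed
qed

lemma blinfun_functional:
  assumes "f \<in> functionals"
  shows "Blinfun f \<in> dual scl" "blinfun_apply (Blinfun f) = f"
proof -
  obtain F where "f = blinfun_apply F" "F \<in> dual scl" using assms unfolding functionals_def by blast
  then show "Blinfun f \<in> dual scl" "blinfun_apply (Blinfun f) = f" by (simp_all add: blinfun_apply_inverse)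
qed

lemma automorphism_norm:
  assumes "(\<forall>c. \<theta> c = c) \<or> (\<forall>c. \<theta> c = scalar_conj (c :: 'f))"
  shows "norm (\<theta> c) = norm c" "\<theta> (of_real r) = of_real r"
  using assms by (auto simp: norm_scalar_conj scalar_conj_of_real)

text \<open>|\<theta>(f x)| is the absolute value at \<open>S x\<close> of the bounded functional
  \<theta> \<circ> f \<circ> S^-1, hence at most norm (S x) times a constant of \<open>f\<close>:
  the product bound that \<open>automorphism_cases\<close> asks for. Once \<theta> preserves norms,
  \<open>S\<close> and its inverse are weakly bounded and so bounded.\<close>

lemma point_case_infinite_dimensional:
  assumes inf: "\<not> finite_dimensional scl"
    and sep: "\<And>F w. finite F \<Longrightarrow> w \<notin> span F \<Longrightarrow> \<exists>f\<in>functionals. (\<forall>v\<in>F. f v = 0) \<and> f w = 1"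
    and aut: "field_automorphism \<theta>" and bij: "bij S"
    and add: "\<And>x y. S (x + y) = S x + S y" and scale: "\<And>c x. S (scl c x) = scl (\<theta> c) (S x)"
    and fwd: "\<And>f. f \<in> functionals \<Longrightarrow> (\<lambda>z. \<theta> (f (inv_into UNIV S z))) \<in> functionals"
    and bwd: "\<And>f. f \<in> functionals \<Longrightarrow> (\<lambda>x. inv_into UNIV \<theta> (f (S x))) \<in> functionals"
    and form: "\<And>T. T \<in> bounded_ops scl \<Longrightarrow>
      \<exists>a. a \<noteq> 0 \<and> (\<forall>x. blinfun_apply (\<phi> T) (S x) = scl a (S (blinfun_apply T x)))"
  shows "\<exists>(A :: 'x \<Rightarrow>\<^sub>L 'x) Ainv (l :: ('x \<Rightarrow>\<^sub>L 'x) \<Rightarrow> 'f). inverse_ops scl A Ainv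
    \<and> (\<forall>T\<in>bounded_ops scl. l T \<noteq> 0)
    \<and> (\<forall>T\<in>bounded_ops scl. \<forall>x. blinfun_apply (\<phi> T) x = scl (l T) (blinfun_apply (A o\<^sub>L T o\<^sub>L Ainv) x))"
proof -
  note F = field_automorphism_facts[OF aut]
  define R where "R = inv_into UNIV S"
  have R [simp]: "S (R x) = x" "R (S x) = x" for x
    using bij by (simp_all add: R_def bij_is_surj surj_f_inv_f bij_is_inj)
  have "\<exists>N. \<forall>x f. f \<in> functionals \<longrightarrow> norm (\<theta> (f x)) \<le> norm (S x) * N f"
  proof -
    have "\<exists>K. f \<in> functionals \<longrightarrow> (\<forall>x. norm (\<theta> (f x)) \<le> norm (S x) * K)" for f
    proof (cases "f \<in> functionals")
      case True
      obtain K where "\<And>z. norm (\<theta> (f (R z))) \<le> K * norm z"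
        using functional_bound[OF fwd[OF True]] unfolding R_def by blast
      then have "norm (\<theta> (f x)) \<le> norm (S x) * K" for x using R(2) by (metis mult.commute)
      then show ?thesis by blast
    qed simp
    then show ?thesis by metis
  qed
  then obtain N where "\<And>x f. f \<in> functionals \<Longrightarrow> norm (\<theta> (f x)) \<le> norm (S x) * N f" by blast
  from automorphism_cases[OF inf sep aut this]
  have cases: "(\<forall>c. \<theta> c = c) \<or> (\<forall>c. \<theta> c = scalar_conj c)" .
  note \<theta> = automorphism_norm[OF cases]
  have S_real: "S (r *\<^sub>R x) = r *\<^sub>R S x" for r x by (simp add: scaleR_scl scale \<theta>)
  have R_add: "R (x + y) = R x + R y" for x y using add R by metis
  have R_real: "R (r *\<^sub>R x) = r *\<^sub>R R x" for r x using S_real R by metis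
  have "\<exists>K. \<forall>x\<in>UNIV. norm (S x) \<le> K * norm x"
  proof (rule bounded_if_weakly_bounded)
    fix f assume "f \<in> functionals"
    then obtain K where "\<And>x. norm (inv_into UNIV \<theta> (f (S x))) \<le> K * norm x"
      using functional_bound bwd by metis
    then show "\<exists>K. \<forall>x\<in>UNIV. norm (f (S x)) \<le> K * norm x" using \<theta>(1) F(6) by metis
  qed (simp_all add: add S_real)
  then obtain K where "\<And>x. norm (S x) \<le> norm x * K" by (metis UNIV_I mult.commute)
  then have S_bl: "bounded_linear S" by (intro bounded_linear_intro add S_real)
  have "\<exists>K. \<forall>x\<in>UNIV. norm (R x) \<le> K * norm x"
  proof (rule bounded_if_weakly_bounded)
    fix f assume "f \<in> functionals"
    then obtain K where "\<And>x. norm (\<theta> (f (R x))) \<le> K * norm x"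
      using functional_bound fwd unfolding R_def by metis
    then show "\<exists>K. \<forall>x\<in>UNIV. norm (f (R x)) \<le> K * norm x" using \<theta>(1) by metis
  qed (simp_all add: R_add R_real)
  then obtain K where "\<And>x. norm (R x) \<le> norm x * K" by (metis UNIV_I mult.commute)
  then have R_bl: "bounded_linear R" by (intro bounded_linear_intro R_add R_real)
  have app: "blinfun_apply (Blinfun S) = S" "blinfun_apply (Blinfun R) = R"
    using S_bl R_bl by (simp_all add: bounded_linear_Blinfun_apply)
  obtain l where l: "\<And>T. T \<in> bounded_ops scl \<Longrightarrow> l T \<noteq> 0 \<and>
      (\<forall>x. blinfun_apply (\<phi> T) (S x) = scl (l T) (S (blinfun_apply T x)))"
    using form by metis
  have "Blinfun S \<in> bounded_ops scl \<union> conj_bounded_ops scl"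
    using cases by (auto simp: blinfun_in_bounded_ops_iff blinfun_in_conj_bounded_ops_iff app scale)
  then have "inverse_ops scl (Blinfun S) (Blinfun R)"
    unfolding inverse_ops_def by (auto intro!: blinfun_eqI simp: app)
  moreover have "blinfun_apply (\<phi> T) x = scl (l T) (blinfun_apply (Blinfun S o\<^sub>L T o\<^sub>L Blinfun R) x)"
    if "T \<in> bounded_ops scl" for T x
    using l[OF that, THEN conjunct2, rule_format, of "R x"] by (simp add: app)
  ultimately show ?thesis using l by (intro exI[of _ "Blinfun S"] exI[of _ "Blinfun R"] exI[of _ l]) simp
qed

lemma subspace_dual: "Real_Vector_Spaces.subspace (dual scl)"
  by (rule real_vector.subspaceI)
    (auto simp: blinfun_in_dual_iff blinfun.add_left blinfun.scaleR_left blinfun.zero_left algebra_simps)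

lemma closed_dual: "closed (dual scl)"
proof -
  have "dual scl = (\<Inter>c. \<Inter>x. {f. blinfun_apply f (scl c x) = c * blinfun_apply f x})"
    by (auto simp: blinfun_in_dual_iff)
  moreover have "closed {f :: 'x \<Rightarrow>\<^sub>L 'f. blinfun_apply f (scl c x) = c * blinfun_apply f x}" for c x
    by (intro closed_Collect_eq continuous_intros)
  ultimately show ?thesis by (simp add: closed_INT)
qed

lemma dual_scl_apply: "blinfun_apply (dual_scl c f) = (\<lambda>x. c * blinfun_apply f x)"
  by (simp add: dual_scl_def fun_eq_iff)

lemma functionals_separate: "u = v" if "\<And>f. f \<in> functionals \<Longrightarrow> f u = f v"
proof -
  obtain f where f: "f \<in> functionals" "norm (f (u - v)) = norm (u - v)"
    using exists_norming_functional by blast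
  have "f ((u - v) + v) = f (u - v) + f v" using f functionals_iff by blast
  then have "f (u - v) = 0" using that[OF f(1)] by simp
  then show ?thesis using f by simp
qed

text \<open>Adjointness supplies the bounds: |\<theta>(f x)| = |S x (A f)| restricts \<theta>, and
  with \<theta> isometric |S x (A g)| = |g x| makes \<open>A\<close> weakly bounded. Reflexivity
  holds because a bounded functional on the dual, carried to the space along \<open>A\<close>, is
  again some \<open>S x\<close>.\<close>

lemma hyperplane_case_infinite_dimensional:
  assumes inf: "\<not> finite_dimensional scl"
    and sep: "\<And>F w. finite F \<Longrightarrow> w \<notin> span F \<Longrightarrow> \<exists>f\<in>functionals. (\<forall>v\<in>F. f v = 0) \<and> f w = 1"
    and aut: "field_automorphism \<theta>" and bijS: "bij_betw S UNIV functionals"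
    and bijA: "bij_betw A functionals UNIV"
    and SA: "\<And>x f. f \<in> functionals \<Longrightarrow> S x (A f) = \<theta> (f x)"
    and form: "\<And>T. T \<in> bounded_ops scl \<Longrightarrow>
      \<exists>a. a \<noteq> 0 \<and> (\<forall>f\<in>functionals. blinfun_apply (\<phi> T) (A f) = scl a (A (\<lambda>x. f (blinfun_apply T x))))"
  shows "reflexive_space scl
    \<and> (\<exists>(A :: ('x \<Rightarrow>\<^sub>L 'f) \<Rightarrow> 'x) Ainv (l :: ('x \<Rightarrow>\<^sub>L 'x) \<Rightarrow> 'f). inverse_ops_from_dual scl A Ainv
      \<and> (\<forall>T\<in>bounded_ops scl. l T \<noteq> 0)
      \<and> (\<forall>T\<in>bounded_ops scl. \<forall>x. blinfun_apply (\<phi> T) x = scl (l T) (A (adjoint_op T (Ainv x)))))"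
proof -
  note F = field_automorphism_facts[OF aut]
  have S_in: "S x \<in> functionals" for x using bijS by (auto simp: bij_betw_def)
  have S_onto: "\<exists>x. f = S x" if "f \<in> functionals" for f using bijS that by (auto simp: bij_betw_def)
  have S_add: "S x (u + v) = S x u + S x v" and S_scale: "S x (scl c u) = c * S x u" for x u v c
    using S_in[of x] functionals_iff by auto
  have S_eq: "u = v" if "\<And>x. S x u = S x v" for u v
    using functionals_separate S_onto that by metis
  have "\<exists>K. \<forall>z. norm (S x z) \<le> K * norm z" for x using S_in[of x] functionals_iff by blast
  then obtain K where K: "\<And>x z. norm (S x z) \<le> K x * norm z" by metis
  have "norm (\<theta> (f x)) \<le> K x * norm (A f)" if "f \<in> functionals" for x f
    using K[of x "A f"] SA[OF that] by simp
  from automorphism_cases[OF inf sep aut this]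
  have cases: "(\<forall>c. \<theta> c = c) \<or> (\<forall>c. \<theta> c = scalar_conj c)" .
  note \<theta> = automorphism_norm[OF cases]
  have A_add: "A (\<lambda>x. f x + g x) = A f + A g" if "f \<in> functionals" "g \<in> functionals" for f g
    by (rule S_eq) (simp add: SA that functionals_add S_add F(1))
  have A_scale: "A (\<lambda>x. c * f x) = scl (\<theta> c) (A f)" if "f \<in> functionals" for f c
    by (rule S_eq) (simp add: SA that functionals_cmult S_scale F(2))
  define R where "R = inv_into functionals A"
  have R_in: "R z \<in> functionals" and AR: "A (R z) = z" for z
    using bijA unfolding R_def by (metis UNIV_I bij_betw_def inv_into_into, metis UNIV_I bij_betw_inv_into_right)
  have RA: "R (A f) = f" if "f \<in> functionals" for f
    using bijA that unfolding R_def by (rule bij_betw_inv_into_left)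
  have R_add: "R (x + y) = (\<lambda>z. R x z + R y z)" for x y
    using RA[OF functionals_add[OF R_in R_in], of x y] by (simp add: A_add R_in AR)
  have R_scale: "R (scl c x) = (\<lambda>z. inv_into UNIV \<theta> c * R x z)" for c x
    using RA[OF functionals_cmult[OF R_in], of "inv_into UNIV \<theta> c" x] by (simp add: A_scale R_in AR F)
  define A0 where "A0 g = A (blinfun_apply g)" for g
  define B0 where "B0 z = Blinfun (R z)" for z
  have B0: "B0 z \<in> dual scl" "blinfun_apply (B0 z) = R z" for z
    using blinfun_functional[OF R_in] by (simp_all add: B0_def)
  have dual_fun: "blinfun_apply g \<in> functionals" if "g \<in> dual scl" for g
    using that unfolding functionals_def by blast
  have A0_add: "A0 (f + g) = A0 f + A0 g" if "f \<in> dual scl" "g \<in> dual scl" for f g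
    using A_add[OF dual_fun dual_fun, OF that] by (simp add: A0_def plus_blinfun.rep_eq)
  have A0_scale: "A0 (dual_scl c f) = scl (\<theta> c) (A0 f)" if "f \<in> dual scl" for f c
    using A_scale[OF dual_fun[OF that]] by (simp add: A0_def dual_scl_apply)
  have "\<exists>K. \<forall>f\<in>dual scl. norm (A0 f) \<le> K * norm f"
  proof (rule bounded_if_weakly_bounded[OF subspace_dual closed_dual])
    show "A0 (x + y) = A0 x + A0 y" if "x \<in> dual scl" "y \<in> dual scl" for x y by (rule A0_add[OF that])
    show "A0 (r *\<^sub>R x) = r *\<^sub>R A0 x" if "x \<in> dual scl" for r x
    proof -
      have "r *\<^sub>R x = dual_scl (of_real r) x"
        by (rule blinfun_eqI) (simp add: dual_scl_apply blinfun.scaleR_left scaleR_conv_of_real)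
      then show ?thesis using A0_scale[OF that] by (simp add: \<theta> scaleR_scl)
    qed
    fix f assume "f \<in> functionals"
    then obtain x where x: "f = S x" using S_onto by blast
    have "norm (f (A0 g)) \<le> norm x * norm g" if "g \<in> dual scl" for g
      using norm_blinfun[of g x] by (simp add: x A0_def SA[OF dual_fun[OF that]] \<theta> mult.commute)
    then show "\<exists>K. \<forall>g\<in>dual scl. norm (f (A0 g)) \<le> K * norm g" by blast
  qed
  then have bA: "bounded_map_on (dual scl) A0" unfolding bounded_map_on_def .
  \<comment> \<open>The pairing bounds \<open>R x z\<close> in \<open>x\<close> for fixed
    \<open>z\<close> through \<open>S z\<close>, and in \<open>z\<close> for fixed \<open>x\<close>
    through \<open>R x\<close>. Uniform boundedness over the unit ball of \<open>z\<close> turns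
    this into a joint bound.\<close>
  have R_norm: "norm (R x z) = norm (S z x)" for x z
    using SA[OF R_in, of z x] by (simp add: AR \<theta>)
  have "\<exists>C. \<forall>z\<in>{z. norm z \<le> 1}. \<forall>x\<in>UNIV. norm (R x z) \<le> C * norm x"
  proof (rule uniform_boundedness)
    show "norm (R (x + y) z) \<le> norm (R x z) + norm (R y z)" for x y z
      by (simp add: R_add norm_triangle_ineq)
    have "inv_into UNIV \<theta> (of_real r) = of_real r" for r using F(7)[of "of_real r"] \<theta>(2) by simp
    then show "norm (R (r *\<^sub>R x) z) = \<bar>r\<bar> * norm (R x z)" for x z r
      by (simp add: scaleR_scl R_scale norm_mult)
    show "norm (R x z) \<le> K z * norm x" for x z unfolding R_norm by (rule K)
    show "\<exists>M. \<forall>z\<in>{z. norm z \<le> 1}. norm (R x z) \<le> M" for x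
    proof -
      obtain L where L: "L \<ge> 0" "\<And>z. norm (R x z) \<le> L * norm z" using functional_bound[OF R_in] by blast
      have "norm (R x z) \<le> L" if "norm z \<le> 1" for z
        using L(2)[of z] mult_left_mono[OF that L(1)] by simp
      then show ?thesis by blast
    qed
  qed simp_all
  then obtain C where C: "\<And>z x. norm z \<le> 1 \<Longrightarrow> norm (R x z) \<le> C * norm x" by auto
  have "norm (B0 x) \<le> \<bar>C\<bar> * norm x" for x
  proof (rule norm_blinfun_bound)
    show "norm (blinfun_apply (B0 x) z) \<le> \<bar>C\<bar> * norm x * norm z" for z
    proof (cases "z = 0")
      case False
      let ?z = "(1 / norm z) *\<^sub>R z"
      have "norm (R x ?z) \<le> C * norm x" using False by (intro C) simp
      also have "\<dots> \<le> \<bar>C\<bar> * norm x" by (intro mult_right_mono) auto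
      finally have "norm (blinfun_apply (B0 x) z) / norm z \<le> \<bar>C\<bar> * norm x"
        by (simp add: B0(2)[symmetric] blinfun.scaleR_right)
      then show ?thesis using False by (simp add: divide_le_eq)
    qed (simp add: blinfun.zero_right)
  qed simp
  then have bB: "bounded_map_on UNIV B0" unfolding bounded_map_on_def by blast
  have "inverse_ops_from_dual scl A0 B0"
    unfolding inverse_ops_from_dual_def
  proof (intro conjI allI ballI bA bB)
    show "linear_map_on (dual scl) dual_scl scl A0 \<or>
        linear_map_on (dual scl) dual_scl (\<lambda>c. scl (scalar_conj c)) A0"
      using cases unfolding linear_map_on_def by (auto simp: A0_add A0_scale)
    show "B0 x \<in> dual scl" "A0 (B0 x) = x" for x by (simp_all add: B0 A0_def AR)
    show "B0 (A0 f) = f" if "f \<in> dual scl" for f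
      using RA[OF dual_fun[OF that]] by (simp add: A0_def B0_def blinfun_apply_inverse)
  qed
  moreover obtain l where l: "\<And>T. T \<in> bounded_ops scl \<Longrightarrow> l T \<noteq> 0 \<and>
      (\<forall>f\<in>functionals. blinfun_apply (\<phi> T) (A f) = scl (l T) (A (\<lambda>x. f (blinfun_apply T x))))"
    using form by metis
  moreover have "blinfun_apply (\<phi> T) x = scl (l T) (A0 (adjoint_op T (B0 x)))" if "T \<in> bounded_ops scl" for T x
  proof -
    have "blinfun_apply (adjoint_op T (B0 x)) = (\<lambda>y. R x (blinfun_apply T y))"
      by (simp add: adjoint_op_def fun_eq_iff B0)
    then show ?thesis using l[OF that, THEN conjunct2, rule_format, OF R_in[of x]] by (simp add: A0_def AR)
  qed
  moreover have "reflexive_space scl"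
    unfolding reflexive_space_def
  proof (intro allI impI)
    fix \<Phi> :: "('x \<Rightarrow>\<^sub>L 'f) \<Rightarrow> 'f"
    assume \<Phi>: "linear_map_on (dual scl) dual_scl (*) \<Phi> \<and> bounded_map_on (dual scl) \<Phi>"
    then have \<Phi>_add: "\<And>f g. f \<in> dual scl \<Longrightarrow> g \<in> dual scl \<Longrightarrow> \<Phi> (f + g) = \<Phi> f + \<Phi> g"
      and \<Phi>_scale: "\<And>c f. f \<in> dual scl \<Longrightarrow> \<Phi> (dual_scl c f) = c * \<Phi> f"
      unfolding linear_map_on_def by blast+
    obtain L where L: "\<And>f. f \<in> dual scl \<Longrightarrow> norm (\<Phi> f) \<le> L * norm f"
      using \<Phi> unfolding bounded_map_on_def by blast
    \<comment> \<open>\<open>\<Phi>\<close> pulled back along the inverse of \<open>A\<close>. The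
      outer \<open>\<theta>\<close> cancels the inverse automorphism in \<open>R_scale\<close>, so
      \<open>h\<close> is linear even if \<open>A\<close> is conjugate-linear.\<close>
    define h where "h z = \<theta> (\<Phi> (B0 z))" for z
    have "h \<in> functionals"
      unfolding functionals_iff
    proof (intro conjI allI)
      show "h (x + y) = h x + h y" for x y
      proof -
        have "B0 (x + y) = B0 x + B0 y"
          by (rule blinfun_eqI) (simp add: B0 R_add plus_blinfun.rep_eq)
        then show ?thesis using \<Phi>_add B0 by (simp add: h_def F(1))
      qed
      show "h (scl c x) = c * h x" for c x
      proof -
        have "B0 (scl c x) = dual_scl (inv_into UNIV \<theta> c) (B0 x)"
          by (rule blinfun_eqI) (simp add: B0 R_scale dual_scl_apply)
        then show ?thesis using \<Phi>_scale B0 by (simp add: h_def F(2,6))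
      qed
      have "norm (h z) \<le> (\<bar>L\<bar> * \<bar>C\<bar>) * norm z" for z
      proof -
        have "norm (h z) \<le> L * norm (B0 z)" using L[OF B0(1)] by (simp add: h_def \<theta>)
        also have "\<dots> \<le> \<bar>L\<bar> * norm (B0 z)" by (intro mult_right_mono) auto
        also have "\<dots> \<le> \<bar>L\<bar> * (\<bar>C\<bar> * norm z)"
          using \<open>\<And>x. norm (B0 x) \<le> \<bar>C\<bar> * norm x\<close> by (intro mult_left_mono) auto
        finally show ?thesis by (simp add: mult.assoc)
      qed
      then show "\<exists>K. \<forall>x. norm (h x) \<le> K * norm x" by blast
    qed
    then obtain x where x: "h = S x" using S_onto by blast
    have "\<Phi> f = blinfun_apply f x" if f: "f \<in> dual scl" for f
    proof -
      have "B0 (A0 f) = f" using RA[OF dual_fun[OF f]] by (simp add: A0_def B0_def blinfun_apply_inverse)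
      then have "h (A0 f) = \<theta> (\<Phi> f)" by (simp add: h_def)
      moreover have "h (A0 f) = \<theta> (blinfun_apply f x)" unfolding x A0_def by (rule SA[OF dual_fun[OF f]])
      ultimately show ?thesis using F(7) by metis
    qed
    then show "\<exists>x. \<forall>f\<in>dual scl. \<Phi> f = blinfun_apply f x" by blast
  qed
  ultimately show ?thesis by (intro conjI exI[of _ A0] exI[of _ B0] exI[of _ l]) simp_all
qed

end

locale banach_space_basis = banach_space_over +
  fixes bs :: "'b list" and n :: nat
  assumes basis: "ordered_basis scl bs" and n: "n = length bs"
begin

section \<open>Coordinates in a basis and the matrix form of the result\<close>

definition crd :: "nat \<Rightarrow> 'b \<Rightarrow> 'a" where
  "crd i v = representation (set bs) v (bs ! i)"

lemma indep: "independent (set bs)" and span_bs: "span (set bs) = UNIV" and dist: "distinct bs"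
  using basis by (auto simp: ordered_basis_def)

lemma crd_add: "crd i (u + v) = crd i u + crd i v"
  unfolding crd_def using indep span_bs by (simp add: representation_add)

lemma crd_scale: "crd i (scl c v) = c * crd i v"
  unfolding crd_def using indep span_bs by (simp add: representation_scale)

lemma crd_basis: "i < n \<Longrightarrow> j < n \<Longrightarrow> crd i (bs ! j) = (if i = j then 1 else 0)"
  unfolding crd_def using indep dist n by (simp add: representation_basis nth_eq_iff_index_eq eq_commute)

lemma crd_sum: "crd i (\<Sum>k<m. g k) = (\<Sum>k<(m::nat). crd i (g k))"
proof (induction m)
  case 0
  show ?case using crd_scale[of i 0 0] by simp
qed (simp add: crd_add)

lemma expand: "v = (\<Sum>i<n. scl (crd i v) (bs ! i))"
proof -
  have "v = (\<Sum>b\<in>set bs. scl (representation (set bs) v b) b)"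
    using sum_representation_eq[OF indep, of v "set bs"] span_bs by simp
  also have "\<dots> = (\<Sum>i<n. scl (crd i v) (bs ! i))"
    unfolding crd_def n by (rule sum.reindex_bij_betw[OF bij_betw_nth[OF dist refl refl], symmetric])
  finally show ?thesis .
qed

lemma eq_if_crd: "(\<And>i. i < n \<Longrightarrow> crd i u = crd i v) \<Longrightarrow> u = v"
  by (subst (1 2) expand) (auto intro: sum.cong)

lemma crd_semilinear:
  assumes add: "\<And>x y. g (x + y) = g x + g y" and scale: "\<And>c x. g (scl c x) = scl (\<eta> c) (g x)"
  shows "crd i (g v) = (\<Sum>k<n. crd i (g (bs ! k)) * \<eta> (crd k v))"
proof -
  have g0: "g 0 = 0" using add[of 0 0] by simp
  have "g (\<Sum>k<m. h k) = (\<Sum>k<m. g (h k))" for h and m :: nat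
    by (induction m) (simp_all add: g0 add)
  then have "g v = (\<Sum>k<n. scl (\<eta> (crd k v)) (g (bs ! k)))"
    using arg_cong[OF expand[of v], of g] by (simp add: scale)
  then show ?thesis by (simp add: crd_sum crd_scale mult.commute)
qed

lemma matrix_of_op_carrier [simp]: "matrix_of_op scl bs T \<in> carrier_mat n n"
  by (simp add: matrix_of_op_def n)

lemma matrix_of_op_dim [simp]: "dim_row (matrix_of_op scl bs T) = n" "dim_col (matrix_of_op scl bs T) = n"
  by (simp_all add: matrix_of_op_def n)

lemma matrix_of_op_index: "i < n \<Longrightarrow> j < n \<Longrightarrow> matrix_of_op scl bs T $$ (i, j) = crd i (blinfun_apply T (bs ! j))"
  by (simp add: matrix_of_op_def n crd_def)

text \<open>Allows the scalar factor, found for operators, to be regarded as a function of the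
  matrix.\<close>

lemma matrix_of_op_inj: "inj_on (matrix_of_op scl bs) (bounded_ops scl)"
proof (rule inj_onI)
  fix T U assume T: "T \<in> bounded_ops scl" and U: "U \<in> bounded_ops scl"
    and eq: "matrix_of_op scl bs T = matrix_of_op scl bs U"
  have lin: "crd i (blinfun_apply X v) = (\<Sum>k<n. crd i (blinfun_apply X (bs ! k)) * crd k v)"
    if "X \<in> bounded_ops scl" for X i v
    using that by (intro crd_semilinear) (simp_all add: blinfun.add_right blinfun_in_bounded_ops_iff)
  have e: "crd i (blinfun_apply T (bs ! k)) = crd i (blinfun_apply U (bs ! k))" if "i < n" "k < n" for i k
    using eq matrix_of_op_index[OF that] by metis
  show "T = U"
  proof (rule blinfun_eqI, rule eq_if_crd)
    show "crd i (blinfun_apply T v) = crd i (blinfun_apply U v)" if "i < n" for i v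
    proof -
      have "crd i (blinfun_apply T v) = (\<Sum>k<n. crd i (blinfun_apply T (bs ! k)) * crd k v)" by (rule lin[OF T])
      also have "\<dots> = (\<Sum>k<n. crd i (blinfun_apply U (bs ! k)) * crd k v)"
        by (intro sum.cong refl) (simp add: e that)
      also have "\<dots> = crd i (blinfun_apply U v)" by (rule lin[OF U, symmetric])
      finally show ?thesis .
    qed
  qed
qed

text \<open>Common to both cases: the columns of \<open>A\<close> hold the coordinates of the
  vectors \<open>w j\<close>, \<open>base\<close> makes \<open>r\<close> a right inverse of it, and
  \<open>form\<close> is the matrix equation \<phi>(T) A = a A Fm(M), for M the matrix of T, read
  entrywise.\<close>

lemma matrix_form:
  fixes Fm :: "'a mat \<Rightarrow> 'a mat" and w :: "nat \<Rightarrow> 'b" and r :: "nat \<Rightarrow> nat \<Rightarrow> 'a"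
  assumes base: "\<And>i j. i < n \<Longrightarrow> j < n \<Longrightarrow> (\<Sum>k<n. crd i (w k) * r k j) = crd i (bs ! j)"
    and Fm: "\<And>M. M \<in> carrier_mat n n \<Longrightarrow> Fm M \<in> carrier_mat n n"
    and onto: "\<phi> ` bounded_ops scl = bounded_ops scl"
    and form: "\<And>T. T \<in> bounded_ops scl \<Longrightarrow> \<exists>a. a \<noteq> 0 \<and> (\<forall>i<n. \<forall>j<n.
      crd i (blinfun_apply (\<phi> T) (w j)) = a * (\<Sum>k<n. crd i (w k) * Fm (matrix_of_op scl bs T) $$ (k, j)))"
  shows "\<exists>A \<in> carrier_mat n n. \<exists>Ainv \<in> carrier_mat n n. \<exists>l :: 'a mat \<Rightarrow> 'a.
    inverts_mat A Ainv \<and> inverts_mat Ainv A \<and> (\<forall>M\<in>carrier_mat n n. l M \<noteq> 0)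
    \<and> (\<forall>T\<in>bounded_ops scl. matrix_of_op scl bs (\<phi> T) =
        l (matrix_of_op scl bs T) \<cdot>\<^sub>m (A * Fm (matrix_of_op scl bs T) * Ainv))"
proof -
  let ?m = "matrix_of_op scl bs"
  define A where "A = Matrix.mat n n (\<lambda>(i, j). crd i (w j))"
  define Ainv where "Ainv = Matrix.mat n n (\<lambda>(i, j). r i j)"
  have A: "A \<in> carrier_mat n n" and Ainv: "Ainv \<in> carrier_mat n n" by (simp_all add: A_def Ainv_def)
  have inv: "A * Ainv = 1\<^sub>m n"
    by (rule eq_matI) (simp_all add: A_def Ainv_def scalar_prod_def atLeast0LessThan base crd_basis)
  then have "Ainv * A = 1\<^sub>m n" using mat_mult_left_right_inverse[OF A Ainv] by blast
  then have invs: "inverts_mat A Ainv" "inverts_mat Ainv A"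
    using inv A Ainv by (auto simp: inverts_mat_def)
  have F: "Fm (?m T) \<in> carrier_mat n n" for T by (rule Fm) simp
  have "\<exists>a. a \<noteq> 0 \<and> ?m (\<phi> T) * A = a \<cdot>\<^sub>m (A * Fm (?m T))" if T: "T \<in> bounded_ops scl" for T
  proof -
    obtain a where a: "a \<noteq> 0" "\<And>i j. i < n \<Longrightarrow> j < n \<Longrightarrow>
        crd i (blinfun_apply (\<phi> T) (w j)) = a * (\<Sum>k<n. crd i (w k) * Fm (?m T) $$ (k, j))"
      using form[OF T] by blast
    have \<phi>T: "\<phi> T \<in> bounded_ops scl" using onto T by blast
    have \<phi>_exp: "crd i (blinfun_apply (\<phi> T) v) = (\<Sum>k<n. crd i (blinfun_apply (\<phi> T) (bs ! k)) * crd k v)" for i v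
      using \<phi>T by (intro crd_semilinear) (simp_all add: blinfun.add_right blinfun_in_bounded_ops_iff)
    have "?m (\<phi> T) * A = a \<cdot>\<^sub>m (A * Fm (?m T))"
    proof (rule eq_matI)
      fix i j assume "i < dim_row (a \<cdot>\<^sub>m (A * Fm (?m T)))" "j < dim_col (a \<cdot>\<^sub>m (A * Fm (?m T)))"
      then have ij: "i < n" "j < n" using A F[of T] by auto
      have "(?m (\<phi> T) * A) $$ (i, j) = crd i (blinfun_apply (\<phi> T) (w j))"
        using ij unfolding \<phi>_exp[of i "w j"]
        by (simp add: A_def scalar_prod_def atLeast0LessThan matrix_of_op_index)
      also have "\<dots> = (a \<cdot>\<^sub>m (A * Fm (?m T))) $$ (i, j)"
        using ij A F[of T] by (simp add: a(2) A_def scalar_prod_def atLeast0LessThan)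
      finally show "(?m (\<phi> T) * A) $$ (i, j) = (a \<cdot>\<^sub>m (A * Fm (?m T))) $$ (i, j)" .
    qed (use A F[of T] in auto)
    with a(1) show ?thesis by blast
  qed
  then obtain a where a: "\<And>T. T \<in> bounded_ops scl \<Longrightarrow> a T \<noteq> 0 \<and> ?m (\<phi> T) * A = a T \<cdot>\<^sub>m (A * Fm (?m T))"
    by metis
  \<comment> \<open>The value 1 off the matrices of operators keeps \<open>l\<close> nonzero on all
    of \<open>carrier_mat n n\<close>.\<close>
  define l where "l M = (if M \<in> ?m ` bounded_ops scl then a (inv_into (bounded_ops scl) ?m M) else 1)" for M
  have l_m: "l (?m T) = a T" if "T \<in> bounded_ops scl" for T
    using that by (simp add: l_def inv_into_f_f[OF matrix_of_op_inj])
  have "l M \<noteq> 0" for M using a l_m by (cases "M \<in> ?m ` bounded_ops scl") (auto simp: l_def)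
  moreover have "?m (\<phi> T) = l (?m T) \<cdot>\<^sub>m (A * Fm (?m T) * Ainv)" if T: "T \<in> bounded_ops scl" for T
  proof -
    have "?m (\<phi> T) = ?m (\<phi> T) * (A * Ainv)" by (simp add: inv)
    also have "\<dots> = (?m (\<phi> T) * A) * Ainv"
      by (rule assoc_mult_mat[symmetric, OF matrix_of_op_carrier A Ainv])
    also have "\<dots> = (a T \<cdot>\<^sub>m (A * Fm (?m T))) * Ainv" using a[OF T] by simp
    also have "\<dots> = a T \<cdot>\<^sub>m (A * Fm (?m T) * Ainv)"
      by (rule mult_smult_assoc_mat[OF mult_carrier_mat[OF A F] Ainv])
    finally show ?thesis by (simp add: l_m T)
  qed
  ultimately show ?thesis using invs A Ainv by blast
qed

lemma point_case_matrix:
  assumes bij: "bij S"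
    and add: "\<And>x y. S (x + y) = S x + S y" and scale: "\<And>c x. S (scl c x) = scl (\<theta> c) (S x)"
    and onto: "\<phi> ` bounded_ops scl = bounded_ops scl"
    and form: "\<And>T. T \<in> bounded_ops scl \<Longrightarrow>
      \<exists>a. a \<noteq> 0 \<and> (\<forall>x. blinfun_apply (\<phi> T) (S x) = scl a (S (blinfun_apply T x)))"
  shows "\<exists>A \<in> carrier_mat n n. \<exists>Ainv \<in> carrier_mat n n. \<exists>l :: 'a mat \<Rightarrow> 'a.
    inverts_mat A Ainv \<and> inverts_mat Ainv A \<and> (\<forall>M\<in>carrier_mat n n. l M \<noteq> 0)
    \<and> (\<forall>T\<in>bounded_ops scl. matrix_of_op scl bs (\<phi> T) =
        l (matrix_of_op scl bs T) \<cdot>\<^sub>m (A * map_mat \<theta> (matrix_of_op scl bs T) * Ainv))"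
proof (rule matrix_form[where w = "\<lambda>j. S (bs ! j)" and r = "\<lambda>k j. \<theta> (crd k (inv_into UNIV S (bs ! j)))"])
  have S_exp: "(\<Sum>k<n. crd i (S (bs ! k)) * \<theta> (crd k v)) = crd i (S v)" for i v
    by (rule crd_semilinear[OF add scale, symmetric])
  show "(\<Sum>k<n. crd i (S (bs ! k)) * \<theta> (crd k (inv_into UNIV S (bs ! j)))) = crd i (bs ! j)" for i j
    unfolding S_exp using bij by (simp add: bij_is_surj surj_f_inv_f)
  fix T assume "T \<in> bounded_ops scl"
  then obtain a where a: "a \<noteq> 0" "\<And>x. blinfun_apply (\<phi> T) (S x) = scl a (S (blinfun_apply T x))"
    using form by blast
  have "crd i (blinfun_apply (\<phi> T) (S (bs ! j)))
      = a * (\<Sum>k<n. crd i (S (bs ! k)) * map_mat \<theta> (matrix_of_op scl bs T) $$ (k, j))" if "j < n" for i j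
    using that S_exp[of i "blinfun_apply T (bs ! j)", symmetric]
    by (simp add: a(2) crd_scale matrix_of_op_index)
  with a(1) show "\<exists>a. a \<noteq> 0 \<and> (\<forall>i<n. \<forall>j<n. crd i (blinfun_apply (\<phi> T) (S (bs ! j)))
      = a * (\<Sum>k<n. crd i (S (bs ! k)) * map_mat \<theta> (matrix_of_op scl bs T) $$ (k, j)))" by blast
qed (use onto in simp_all)

text \<open>\<open>A\<close> is evaluated on the dual basis \<open>crd j\<close>. The functional crd
  j \<circ> T takes at \<open>bs ! k\<close> the entry (j, k) of the matrix of \<open>T\<close> as
  its value, whence the transpose.\<close>

lemma hyperplane_case_matrix:
  assumes aut: "field_automorphism \<theta>"
    and S: "bij_betw S UNIV functionals" and bijA: "bij_betw A functionals UNIV"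
    and SA: "\<And>x f. f \<in> functionals \<Longrightarrow> S x (A f) = \<theta> (f x)"
    and crd_in: "\<And>i. i < n \<Longrightarrow> crd i \<in> functionals"
    and comp: "\<And>f T. f \<in> functionals \<Longrightarrow> T \<in> bounded_ops scl \<Longrightarrow> (\<lambda>x. f (blinfun_apply T x)) \<in> functionals"
    and onto: "\<phi> ` bounded_ops scl = bounded_ops scl"
    and form: "\<And>T. T \<in> bounded_ops scl \<Longrightarrow>
      \<exists>a. a \<noteq> 0 \<and> (\<forall>f\<in>functionals. blinfun_apply (\<phi> T) (A f) = scl a (A (\<lambda>x. f (blinfun_apply T x))))"
  shows "\<exists>A \<in> carrier_mat n n. \<exists>Ainv \<in> carrier_mat n n. \<exists>l :: 'a mat \<Rightarrow> 'a.
    inverts_mat A Ainv \<and> inverts_mat Ainv A \<and> (\<forall>M\<in>carrier_mat n n. l M \<noteq> 0)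
    \<and> (\<forall>T\<in>bounded_ops scl. matrix_of_op scl bs (\<phi> T) =
        l (matrix_of_op scl bs T) \<cdot>\<^sub>m (A * transpose_mat (map_mat \<theta> (matrix_of_op scl bs T)) * Ainv))"
proof -
  note F = field_automorphism_facts[OF aut]
  have S_in: "S x \<in> functionals" for x using S by (auto simp: bij_betw_def)
  have S_onto: "\<exists>x. f = S x" if "f \<in> functionals" for f using S that by (auto simp: bij_betw_def)
  have S_eq: "u = v" if "\<And>x. S x u = S x v" for u v
    using functionals_separate S_onto that by metis
  have f_sum: "f (\<Sum>k<m. g k) = (\<Sum>k<m. f (g k))" if "f \<in> functionals" for f g and m :: nat
  proof (induction m)
    case 0
    have "f (scl 0 0) = 0 * f 0" using that functionals_iff by blast
    then show ?case by simp
  qed (use that functionals_iff in simp)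
  have f_scale: "f (scl c x) = c * f x" if "f \<in> functionals" for f c x using that functionals_iff by blast
  have \<theta>_sum: "\<theta> (\<Sum>k<m. g k) = (\<Sum>k<m. \<theta> (g k))" for g and m :: nat
    by (induction m) (simp_all add: F(1,4))
  have A_exp: "A f = (\<Sum>k<n. scl (\<theta> (f (bs ! k))) (A (crd k)))" if f: "f \<in> functionals" for f
  proof (rule S_eq)
    fix x
    have "S x (A f) = \<theta> (f (\<Sum>k<n. scl (crd k x) (bs ! k)))" using SA[OF f] expand[of x] by simp
    also have "\<dots> = (\<Sum>k<n. \<theta> (f (bs ! k)) * \<theta> (crd k x))"
      by (simp add: f_sum[OF f] f_scale[OF f] \<theta>_sum F(2) mult.commute)
    also have "\<dots> = S x (\<Sum>k<n. scl (\<theta> (f (bs ! k))) (A (crd k)))"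
      by (simp add: f_sum[OF S_in] f_scale[OF S_in] SA crd_in)
    finally show "S x (A f) = S x (\<Sum>k<n. scl (\<theta> (f (bs ! k))) (A (crd k)))" .
  qed
  have crd_A: "crd i (A f) = (\<Sum>k<n. crd i (A (crd k)) * \<theta> (f (bs ! k)))" if "f \<in> functionals" for i f
    using arg_cong[OF A_exp[OF that], of "crd i"] by (simp add: crd_sum crd_scale mult.commute)
  define R where "R = inv_into functionals A"
  have R_in: "R z \<in> functionals" and AR: "A (R z) = z" for z
    using bijA unfolding R_def by (metis UNIV_I bij_betw_def inv_into_into, metis UNIV_I bij_betw_inv_into_right)
  show ?thesis
  proof (rule matrix_form[where w = "\<lambda>j. A (crd j)" and r = "\<lambda>k j. \<theta> (R (bs ! j) (bs ! k))"])
    show "(\<Sum>k<n. crd i (A (crd k)) * \<theta> (R (bs ! j) (bs ! k))) = crd i (bs ! j)" for i j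
      using crd_A[OF R_in, of i "bs ! j"] by (simp add: AR)
    fix T assume T: "T \<in> bounded_ops scl"
    let ?M = "transpose_mat (map_mat \<theta> (matrix_of_op scl bs T))"
    obtain a where a: "a \<noteq> 0"
      "\<And>f. f \<in> functionals \<Longrightarrow> blinfun_apply (\<phi> T) (A f) = scl a (A (\<lambda>x. f (blinfun_apply T x)))"
      using form[OF T] by blast
    have "crd i (blinfun_apply (\<phi> T) (A (crd j))) = a * (\<Sum>k<n. crd i (A (crd k)) * ?M $$ (k, j))" if "j < n" for i j
      using that a(2)[OF crd_in] crd_A[OF comp[OF crd_in T], of j i] by (simp add: crd_scale matrix_of_op_index)
    with a(1) show "\<exists>a. a \<noteq> 0 \<and> (\<forall>i<n. \<forall>j<n. crd i (blinfun_apply (\<phi> T) (A (crd j)))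
        = a * (\<Sum>k<n. crd i (A (crd k)) * ?M $$ (k, j)))" by blast
  qed (use onto in simp_all)
qed

end

text \<open>Continuity of the coordinates comes from separation: a bounded functional that is 1 at
  \<open>bs ! i\<close> and 0 at the other basis vectors agrees with the coordinate on the basis,
  hence everywhere.\<close>

lemma (in banach_space_basis) crd_in_functionals:
  assumes sep: "\<And>F w. finite F \<Longrightarrow> w \<notin> span F \<Longrightarrow> \<exists>f\<in>functionals. (\<forall>v\<in>F. f v = 0) \<and> f w = 1"
    and i: "i < n"
  shows "crd i \<in> functionals"
proof -
  have mem: "bs ! k \<in> set bs" if "k < n" for k using that n by simp
  have "bs ! i \<notin> span (set bs - {bs ! i})" using indep mem[OF i] by (auto simp: dependent_def)
  then obtain f where f: "f \<in> functionals" "\<forall>v\<in>set bs - {bs ! i}. f v = 0" "f (bs ! i) = 1"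
    using sep by blast
  have f_add: "f (x + y) = f x + f y" and f_scale: "f (scl c x) = c * f x" for x y c
    using f functionals_iff by auto
  have f0: "f 0 = 0" using f_scale[of 0 0] by simp
  have f_sum: "f (\<Sum>k<m. g k) = (\<Sum>k<m. f (g k))" for g and m :: nat
    by (induction m) (simp_all add: f0 f_add)
  have "f v = crd i v" for v
  proof -
    have "f v = (\<Sum>k<n. crd k v * f (bs ! k))"
      using arg_cong[OF expand[of v], of f] by (simp add: f_sum f_scale)
    also have "\<dots> = (\<Sum>k<n. if k = i then crd i v else 0)"
      using f(2,3) mem dist n i by (intro sum.cong refl) (auto simp: nth_eq_iff_index_eq)
    also have "\<dots> = crd i v" using i by simp
    finally show ?thesis .
  qed
  then have "f = crd i" by (rule ext)
  then show ?thesis using f by simp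
qed

theorem theorem1p1:
  fixes scl :: "'f::real_or_complex \<Rightarrow> 'x::banach \<Rightarrow> 'x"
    and \<phi> :: "('x \<Rightarrow>\<^sub>L 'x) \<Rightarrow> ('x \<Rightarrow>\<^sub>L 'x)"
  assumes "banach_space_over scl"
    and "\<not> finite_dimensional scl \<or> Vector_Spaces.vector_space.dim scl UNIV \<ge> 3"
    and "\<phi> ` bounded_ops scl = bounded_ops scl"
    and "(\<forall>A\<in>bounded_ops scl. \<forall>B\<in>bounded_ops scl.
            ascent (A o\<^sub>L B o\<^sub>L A) = ascent (\<phi> A o\<^sub>L \<phi> B o\<^sub>L \<phi> A))
       \<or> (\<forall>A\<in>bounded_ops scl. \<forall>B\<in>bounded_ops scl.
            descent (A o\<^sub>L B o\<^sub>L A) = descent (\<phi> A o\<^sub>L \<phi> B o\<^sub>L \<phi> A))"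
  shows
    "(\<not> finite_dimensional scl \<longrightarrow>
        (\<exists>(A :: 'x \<Rightarrow>\<^sub>L 'x) Ainv (l :: ('x \<Rightarrow>\<^sub>L 'x) \<Rightarrow> 'f).
            inverse_ops scl A Ainv
          \<and> (\<forall>T\<in>bounded_ops scl. l T \<noteq> 0)
          \<and> (\<forall>T\<in>bounded_ops scl. \<forall>x.
               blinfun_apply (\<phi> T) x = scl (l T) (blinfun_apply (A o\<^sub>L T o\<^sub>L Ainv) x)))
      \<or> (reflexive_space scl
          \<and> (\<exists>(A :: ('x \<Rightarrow>\<^sub>L 'f) \<Rightarrow> 'x) Ainv (l :: ('x \<Rightarrow>\<^sub>L 'x) \<Rightarrow> 'f).
                inverse_ops_from_dual scl A Ainv
              \<and> (\<forall>T\<in>bounded_ops scl. l T \<noteq> 0)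
              \<and> (\<forall>T\<in>bounded_ops scl. \<forall>x.
                   blinfun_apply (\<phi> T) x = scl (l T) (A (adjoint_op T (Ainv x)))))))
   \<and> (finite_dimensional scl \<longrightarrow>
        (\<forall>bs n. ordered_basis scl bs \<and> n = Vector_Spaces.vector_space.dim scl UNIV \<longrightarrow>
          (\<exists>A \<in> carrier_mat n n. \<exists>Ainv \<in> carrier_mat n n. \<exists>(\<tau> :: 'f \<Rightarrow> 'f) (l :: 'f mat \<Rightarrow> 'f).
              inverts_mat A Ainv \<and> inverts_mat Ainv A
            \<and> field_automorphism \<tau>
            \<and> (\<forall>M \<in> carrier_mat n n. l M \<noteq> 0)
            \<and> ((\<forall>T\<in>bounded_ops scl. let M = matrix_of_op scl bs T in
                  matrix_of_op scl bs (\<phi> T) = l M \<cdot>\<^sub>m (A * map_mat \<tau> M * Ainv))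
              \<or> (\<forall>T\<in>bounded_ops scl. let M = matrix_of_op scl bs T in
                  matrix_of_op scl bs (\<phi> T) = l M \<cdot>\<^sub>m (A * transpose_mat (map_mat \<tau> M) * Ainv))))))"
proof -
  interpret B: banach_space_over scl by fact
  \<comment> \<open>Two vectors spanning the space would make it finite-dimensional of dimension at
    most 2, against both alternatives of the dimension hypothesis.\<close>
  have dim: "\<exists>z. z \<notin> B.span {x, y}" for x y
  proof (rule ccontr)
    assume "\<not> ?thesis"
    then have span: "B.span {x, y} = UNIV" by auto
    then have "finite_dimensional scl" unfolding finite_dimensional_def by (intro exI[of _ "{x, y}"]) simp
    then have "B.dim UNIV \<ge> 3" using assms(2) by blast
    moreover have "B.dim UNIV \<le> card {x, y}" by (rule B.dim_le_card) (simp_all add: span)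
    moreover have "card {x, y} \<le> 2" by (simp add: card_insert_if)
    ultimately show False by simp
  qed
  let ?\<phi> = "\<lambda>t. blinfun_apply (\<phi> (Blinfun t))"
  obtain idx where "sandwich_preserver scl B.functionals B.operators idx ?\<phi>"
    using B.sandwich_preserver_blinfun[OF dim assms(3,4)] by blast
  then interpret P: sandwich_preserver scl B.functionals B.operators idx ?\<phi> .
  have op: "blinfun_apply T \<in> B.operators" if "T \<in> bounded_ops scl" for T
    using that unfolding B.operators_def by blast
  note sep = P.separate
  have basis: "banach_space_basis scl bs n"
    if "ordered_basis scl bs \<and> n = Vector_Spaces.vector_space.dim scl UNIV" for bs n
  proof (unfold_locales, goal_cases)
    case 2
    have "B.dim UNIV = card (set bs)"
      using that by (intro B.dim_eq_card) (auto simp: ordered_basis_def)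
    then show ?case using that by (simp add: distinct_card ordered_basis_def)
  qed (use that in simp)
  from P.preserver_form show ?thesis
  proof (elim disjE exE)
    fix S \<theta> assume H: "P.point_form ?\<phi> S \<theta>"
    then have aut: "field_automorphism \<theta>" and bij: "bij S"
      and add: "\<And>x y. S (x + y) = S x + S y" and scale: "\<And>c x. S (scl c x) = scl (\<theta> c) (S x)"
      and fwd: "\<And>f. f \<in> B.functionals \<Longrightarrow> (\<lambda>z. \<theta> (f (inv_into UNIV S z))) \<in> B.functionals"
      and bwd: "\<And>f. f \<in> B.functionals \<Longrightarrow> (\<lambda>x. inv_into UNIV \<theta> (f (S x))) \<in> B.functionals"
      by (simp_all add: P.point_form_def)
    have form: "\<exists>a. a \<noteq> 0 \<and> (\<forall>x. blinfun_apply (\<phi> T) (S x) = scl a (S (blinfun_apply T x)))"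
      if "T \<in> bounded_ops scl" for T
      using H[unfolded P.point_form_def, THEN conjunct2, THEN conjunct2, THEN conjunct2, THEN conjunct2, THEN conjunct2, THEN conjunct2, THEN bspec, OF op[OF that]]
      by (simp add: blinfun_apply_inverse)
    show ?thesis
    proof (intro conjI impI allI, goal_cases)
      case 1
      show ?case
        by (rule disjI1, rule B.point_case_infinite_dimensional[OF 1 sep aut bij add scale fwd bwd form])
    next
      case (2 bs n)
      then interpret banach_space_basis scl bs n by (intro basis)
      show ?case using point_case_matrix[OF bij add scale assms(3) form] aut unfolding Let_def by blast
    qed
  next
    fix S A \<theta> assume H: "P.hyperplane_form ?\<phi> S A \<theta>"
    then have aut: "field_automorphism \<theta>" and bijS: "bij_betw S UNIV B.functionals"
      and bijA: "bij_betw A B.functionals UNIV"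
      and SA: "\<And>x f. f \<in> B.functionals \<Longrightarrow> S x (A f) = \<theta> (f x)"
      by (simp_all add: P.hyperplane_form_def)
    have form: "\<exists>a. a \<noteq> 0 \<and> (\<forall>f\<in>B.functionals. blinfun_apply (\<phi> T) (A f) = scl a (A (\<lambda>x. f (blinfun_apply T x))))"
      if "T \<in> bounded_ops scl" for T
      using H[unfolded P.hyperplane_form_def, THEN conjunct2, THEN conjunct2, THEN conjunct2, THEN conjunct2, THEN bspec, OF op[OF that]]
      by (simp add: blinfun_apply_inverse)
    show ?thesis
    proof (intro conjI impI allI, goal_cases)
      case 1
      show ?case
        by (rule disjI2, rule B.hyperplane_case_infinite_dimensional[OF 1 sep aut bijS bijA SA form])
    next
      case (2 bs n)
      then interpret banach_space_basis scl bs n by (intro basis)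
      show ?case
        using hyperplane_case_matrix[OF aut bijS bijA SA crd_in_functionals[OF sep] P.D_comp[OF _ op] assms(3) form]
          aut unfolding Let_def by blast
    qed
  qed
qed

end
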